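(* Let $e^{\mathrm{i}\theta}$ be a root of unity and let $\kappa>1$. Then $\mathrm{IQPIsing}(\kappa,2\theta)$ and $\mathrm{SSimIQP}(\kappa^{1/2},\theta)$ are equivalent under polynomial-time Turing reductions.
   Context: Qubit basis $|0\rangle=(1,0)^T$, $|1\rangle=(0,1)^T$, $|\mathbf x\rangle=\bigotimes_i|x_i\rangle$. $H=\frac1{\sqrt2}\begin{pmatrix}1&1\\1&-1\end{pmatrix}$, $P_\theta=\mathrm{diag}(e^{\mathrm{i}\theta},e^{-\mathrm{i}\theta})$, $ZZ_\theta=\mathrm{diag}(e^{\mathrm{i}\theta},e^{-\mathrm{i}\theta},e^{-\mathrm{i}\theta},e^{\mathrm{i}\theta})$. An $\mathrm{IQP}_{1,2}(\theta)$ circuit on $n$ lines is a sequence of gates $U_1,\dots,U_m$ with $U_1=U_m=H^{\otimes n}$ and every other gate $P_\theta$ on one qubit or $ZZ_\theta$ on two qubits; each gate is identified with the $2^n\times2^n$ matrix acting as the gate on its qubits and identity elsewhere; input $|0^n\rangle$; $\Pr_C(\mathbf Y=\mathbf y)=|\langle\mathbf y|M_{U_m}\cdots M_{U_1}|0^n\rangle|^2$ and for $I\subseteq[n]$, $\Pr_{C;I}(\mathbf Y'=\mathbf y')=\sum_{\mathbf z:\mathbf z|_I=\mathbf y'}\Pr_C(\mathbf Y=\mathbf z)$. $\mathrm{SSimIQP}(\kappa,\theta)$: given such $C$, $I\subseteq[n]$, $\mathbf y\in\{0,1\}^{|I|}$, output rational $p$ with $\Pr_{C;I}(\mathbf Y=\mathbf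 y)/\kappa\le p\le\kappa\Pr_{C;I}(\mathbf Y=\mathbf y)$. Non-uniform Ising: $Z_{\mathrm{Ising}}(G;\varphi,\tau)=\sum_{\sigma:V\to\{0,1\}}\prod_{e=(u,v)\in E}\varphi(e)^{\delta(\sigma(u),\sigma(v))}\prod_{v}\tau(v)^{\sigma(v)}$. $\mathrm{IQPIsing}(\kappa,\alpha)$: given a multigraph $G$, an edge interaction function $\varphi$ with values in $\{e^{\mathrm{i}\alpha},e^{-\mathrm{i}\alpha}\}$, and an external field $\tau$ such that for each vertex $v$ there are non-negative integers $a_v,b_v$ with $\tau(v)=(-1)^{a_v}(e^{\mathrm{i}\alpha})^{b_v}$ or $\tau(v)=(-1)^{a_v}(e^{-\mathrm{i}\alpha})^{b_v}$, output a rational $p$ with $|Z_{\mathrm{Ising}}(G;\varphi,\tau)|/\kappa\le p\le\kappa|Z_{\mathrm{Ising}}(G;\varphi,\tau)|$. *)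

theory Defs
  imports
    "Jordan_Normal_Form.Matrix"
    "HOL-Computational_Algebra.Polynomial"
    "HOL-Library.FuncSet"
    "HOL-Library.Log_Nat"
    Complex_Main
begin

section \<open>Polynomial-time Turing reductions between search problems\<close>

text \<open>
  Machine model: WHILE programs over S-expressions with natural numbers as atoms, extended by an
  oracle call. Time is charged with the logarithmic cost criterion: evaluating an expression costs
  the total size (numbers in binary) of the values of all its subexpressions. Every
  primitive is computable on a Turing machine in time polynomial in the sizes of its arguments, and
  every value that is built has been paid for in full, so running times agree with those of
  multi-tape (oracle) Turing machines up to a polynomial, in both directions.
\<close>

datatype val = Num nat | Pair val val

fun vsize :: "val \<Rightarrow> nat" where
  "vsize (Num k) = 1 + floorlog 2 k"
| "vsize (Pair u v) = 1 + vsize u + vsize v"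

fun val_num :: "val \<Rightarrow> nat" where
  "val_num (Num k) = k"
| "val_num (Pair u v) = 0"

fun val_fst :: "val \<Rightarrow> val" where
  "val_fst (Num k) = Num 0"
| "val_fst (Pair u v) = u"

fun val_snd :: "val \<Rightarrow> val" where
  "val_snd (Num k) = Num 0"
| "val_snd (Pair u v) = v"

fun val_is_pair :: "val \<Rightarrow> bool" where
  "val_is_pair (Num k) = False"
| "val_is_pair (Pair u v) = True"

datatype expr =
    Var nat | Const nat
  | MkPair expr expr | Fst expr | Snd expr | IsPair expr
  | Plus expr expr | Minus expr expr | Times expr expr | Div expr expr | Mod expr expr
  | Less expr expr | Equal expr expr

type_synonym state = "nat \<Rightarrow> val"

fun eval_expr :: "state \<Rightarrow> expr \<Rightarrow> val" where
  "eval_expr s (Var x) = s x"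
| "eval_expr s (Const k) = Num k"
| "eval_expr s (MkPair e f) = Pair (eval_expr s e) (eval_expr s f)"
| "eval_expr s (Fst e) = val_fst (eval_expr s e)"
| "eval_expr s (Snd e) = val_snd (eval_expr s e)"
| "eval_expr s (IsPair e) = Num (of_bool (val_is_pair (eval_expr s e)))"
| "eval_expr s (Plus e f) = Num (val_num (eval_expr s e) + val_num (eval_expr s f))"
| "eval_expr s (Minus e f) = Num (val_num (eval_expr s e) - val_num (eval_expr s f))"
| "eval_expr s (Times e f) = Num (val_num (eval_expr s e) * val_num (eval_expr s f))"
| "eval_expr s (Div e f) = Num (val_num (eval_expr s e) div val_num (eval_expr s f))"
| "eval_expr s (Mod e f) = Num (val_num (eval_expr s e) mod val_num (eval_expr s f))"
| "eval_expr s (Less e f) = Num (of_bool (val_num (eval_expr s e) < val_num (eval_expr s f)))"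
| "eval_expr s (Equal e f) = Num (of_bool (eval_expr s e = eval_expr s f))"

fun expr_args :: "expr \<Rightarrow> expr list" where
  "expr_args (Var x) = []"
| "expr_args (Const k) = []"
| "expr_args (MkPair e f) = [e, f]"
| "expr_args (Fst e) = [e]"
| "expr_args (Snd e) = [e]"
| "expr_args (IsPair e) = [e]"
| "expr_args (Plus e f) = [e, f]"
| "expr_args (Minus e f) = [e, f]"
| "expr_args (Times e f) = [e, f]"
| "expr_args (Div e f) = [e, f]"
| "expr_args (Mod e f) = [e, f]"
| "expr_args (Less e f) = [e, f]"
| "expr_args (Equal e f) = [e, f]"

lemma size_expr_args [termination_simp]: "f \<in> set (expr_args e) \<Longrightarrow> size f < size e"
  by (cases e) auto

fun expr_cost :: "state \<Rightarrow> expr \<Rightarrow> nat" where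
  "expr_cost s e = vsize (eval_expr s e) + (\<Sum>f\<leftarrow>expr_args e. expr_cost s f)"

declare expr_cost.simps [simp del]

datatype com =
    Skip
  | Assign nat expr
  | Query nat expr
  | Seq com com
  | Cond expr com com
  | While expr com

text \<open>
  \<open>exec ora c s t s'\<close>: with oracle \<open>ora\<close>, program \<open>c\<close> started in state \<open>s\<close> halts in state \<open>s'\<close>
  after time \<open>t\<close>. A test succeeds iff its value is not \<open>Num 0\<close>.
\<close>

inductive exec :: "(val \<Rightarrow> val) \<Rightarrow> com \<Rightarrow> state \<Rightarrow> nat \<Rightarrow> state \<Rightarrow> bool" for ora where
  exec_Skip: "exec ora Skip s 1 s"
| exec_Assign: "exec ora (Assign x e) s (1 + expr_cost s e) (s(x := eval_expr s e))"
| exec_Query: "a = ora (eval_expr s e) \<Longrightarrow>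
    exec ora (Query x e) s (1 + expr_cost s e + vsize a) (s(x := a))"
| exec_Seq: "exec ora c s t s' \<Longrightarrow> exec ora d s' t' s'' \<Longrightarrow> exec ora (Seq c d) s (1 + t + t') s''"
| exec_CondTrue: "eval_expr s e \<noteq> Num 0 \<Longrightarrow> exec ora c s t s' \<Longrightarrow>
    exec ora (Cond e c d) s (1 + expr_cost s e + t) s'"
| exec_CondFalse: "eval_expr s e = Num 0 \<Longrightarrow> exec ora d s t s' \<Longrightarrow>
    exec ora (Cond e c d) s (1 + expr_cost s e + t) s'"
| exec_WhileFalse: "eval_expr s e = Num 0 \<Longrightarrow>
    exec ora (While e c) s (1 + expr_cost s e) s"
| exec_WhileTrue: "eval_expr s e \<noteq> Num 0 \<Longrightarrow> exec ora c s t s' \<Longrightarrow>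
    exec ora (While e c) s' t' s'' \<Longrightarrow>
    exec ora (While e c) s (1 + expr_cost s e + t + t') s''"

definition init_state :: "val \<Rightarrow> state" where
  "init_state x = (\<lambda>_. Num 0)(0 := x)"

record search_problem =
  instances :: "val set"
  solutions :: "val \<Rightarrow> val set"

text \<open>
  \<open>ora\<close> answers every instance of \<open>B\<close> correctly, with answers of length bounded by \<open>q\<close>; nothing is
  assumed about its answers to queries that are not instances of \<open>B\<close>. The length bound is
  needed because a problem with rational outputs has solutions of unbounded length, which no
  polynomial-time machine could read.
\<close>

definition solves_within :: "nat poly \<Rightarrow> (val \<Rightarrow> val) \<Rightarrow> search_problem \<Rightarrow> bool" where
  "solves_within q ora B \<longleftrightarrow>
     (\<forall>w\<in>instances B. ora w \<in> solutions B w \<and> vsize (ora w) \<le> poly q (vsize w))"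

text \<open>
  One oracle program must work for every correct, polynomially length-bounded oracle, in polynomial
  time. Input and output are passed in variable \<open>0\<close>.
\<close>

definition poly_turing_reducible :: "search_problem \<Rightarrow> search_problem \<Rightarrow> bool" where
  "poly_turing_reducible A B \<longleftrightarrow>
     (\<exists>c. \<forall>q. \<exists>p :: nat poly. \<forall>ora. solves_within q ora B \<longrightarrow>
        (\<forall>x\<in>instances A. \<exists>t s. exec ora c (init_state x) t s \<and>
           t \<le> poly p (vsize x) \<and> s 0 \<in> solutions A x))"

definition poly_turing_equivalent :: "search_problem \<Rightarrow> search_problem \<Rightarrow> bool" where
  "poly_turing_equivalent A B \<longleftrightarrow> poly_turing_reducible A B \<and> poly_turing_reducible B A"


section \<open>Encodings\<close>

fun enc_list :: "('a \<Rightarrow> val) \<Rightarrow> 'a list \<Rightarrow> val" where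
  "enc_list f [] = Num 0"
| "enc_list f (x # xs) = Pair (f x) (enc_list f xs)"

definition enc_bool :: "bool \<Rightarrow> val" where
  "enc_bool b = Num (of_bool b)"

definition enc_int :: "int \<Rightarrow> val" where
  "enc_int i = Pair (enc_bool (i < 0)) (Num (nat \<bar>i\<bar>))"

text \<open>Fractions need not be in lowest terms.\<close>

definition represents_rat :: "val \<Rightarrow> rat \<Rightarrow> bool" where
  "represents_rat v p \<longleftrightarrow>
     (\<exists>a b. b > 0 \<and> v = Pair (enc_int a) (Num b) \<and> p = of_int a / of_nat b)"

definition approximates :: "real \<Rightarrow> real \<Rightarrow> rat \<Rightarrow> bool" where
  "approximates \<kappa> x p \<longleftrightarrow> x / \<kappa> \<le> of_rat p \<and> of_rat p \<le> \<kappa> * x"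


section \<open>IQP circuits\<close>

definition kron_vec :: "complex vec \<Rightarrow> complex vec \<Rightarrow> complex vec" where
  "kron_vec u v = vec (dim_vec u * dim_vec v) (\<lambda>i. u $ (i div dim_vec v) * v $ (i mod dim_vec v))"

definition kron_mat :: "complex mat \<Rightarrow> complex mat \<Rightarrow> complex mat" where
  "kron_mat A B = mat (dim_row A * dim_row B) (dim_col A * dim_col B)
     (\<lambda>(i, j). A $$ (i div dim_row B, j div dim_col B) * B $$ (i mod dim_row B, j mod dim_col B))"

definition qubit :: "bool \<Rightarrow> complex vec" where
  "qubit b = (if b then vec_of_list [0, 1] else vec_of_list [1, 0])"

fun ket :: "bool list \<Rightarrow> complex vec" where
  "ket [] = vec_of_list [1]"
| "ket (x # xs) = kron_vec (qubit x) (ket xs)"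

text \<open>
  Position of the basis vector \<open>ket x\<close> in the computational basis (the first qubit is the most
  significant one, see \<open>ket_eq_unit_vec\<close>), and its inverse for \<open>n\<close> qubits.
\<close>

definition basis_index :: "bool list \<Rightarrow> nat" where
  "basis_index x = foldl (\<lambda>k b. 2 * k + of_bool b) 0 x"

definition basis_bits :: "nat \<Rightarrow> nat \<Rightarrow> bool list" where
  "basis_bits n k = map (\<lambda>i. odd (k div 2 ^ (n - 1 - i))) [0..<n]"

definition H_gate :: "complex mat" where
  "H_gate = complex_of_real (1 / sqrt 2) \<cdot>\<^sub>m mat_of_rows_list 2 [[1, 1], [1, -1]]"

fun H_tensor :: "nat \<Rightarrow> complex mat" where
  "H_tensor 0 = 1\<^sub>m 1"
| "H_tensor (Suc n) = kron_mat H_gate (H_tensor n)"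

definition P_gate :: "real \<Rightarrow> complex mat" where
  "P_gate \<theta> = mat_diag 2 (\<lambda>i. [cis \<theta>, cis (- \<theta>)] ! i)"

definition ZZ_gate :: "real \<Rightarrow> complex mat" where
  "ZZ_gate \<theta> = mat_diag 4 (\<lambda>i. [cis \<theta>, cis (- \<theta>), cis (- \<theta>), cis \<theta>] ! i)"

text \<open>
  The matrix on \<open>n\<close> qubits acting as \<open>U\<close> on the qubits listed in \<open>qs\<close> (in this order) and as the
  identity elsewhere.
\<close>

definition act_on :: "nat \<Rightarrow> nat list \<Rightarrow> complex mat \<Rightarrow> complex mat" where
  "act_on n qs U = mat (2 ^ n) (2 ^ n) (\<lambda>(r, c).
     let x = basis_bits n r; y = basis_bits n c in
       if \<forall>i<n. i \<notin> set qs \<longrightarrow> x ! i = y ! i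
       then U $$ (basis_index (map ((!) x) qs), basis_index (map ((!) y) qs))
       else 0)"

datatype gate = HAll | PGate nat | ZZGate nat nat

fun gate_mat :: "real \<Rightarrow> nat \<Rightarrow> gate \<Rightarrow> complex mat" where
  "gate_mat \<theta> n HAll = H_tensor n"
| "gate_mat \<theta> n (PGate i) = act_on n [i] (P_gate \<theta>)"
| "gate_mat \<theta> n (ZZGate i j) = act_on n [i, j] (ZZ_gate \<theta>)"

fun diagonal_gate :: "nat \<Rightarrow> gate \<Rightarrow> bool" where
  "diagonal_gate n HAll \<longleftrightarrow> False"
| "diagonal_gate n (PGate i) \<longleftrightarrow> i < n"
| "diagonal_gate n (ZZGate i j) \<longleftrightarrow> i < n \<and> j < n \<and> i \<noteq> j"

definition iqp_circuit :: "nat \<Rightarrow> gate list \<Rightarrow> bool" where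
  "iqp_circuit n Us \<longleftrightarrow> (\<exists>Ds. Us = [HAll] @ Ds @ [HAll] \<and> (\<forall>U\<in>set Ds. diagonal_gate n U))"

definition circuit_mat :: "real \<Rightarrow> nat \<Rightarrow> gate list \<Rightarrow> complex mat" where
  "circuit_mat \<theta> n Us = foldl (\<lambda>M U. gate_mat \<theta> n U * M) (1\<^sub>m (2 ^ n)) Us"

definition output_prob :: "real \<Rightarrow> nat \<Rightarrow> gate list \<Rightarrow> bool list \<Rightarrow> real" where
  "output_prob \<theta> n Us y =
     (cmod ((circuit_mat \<theta> n Us *\<^sub>v ket (replicate n False)) \<bullet>c ket y))\<^sup>2"

definition marginal_prob :: "real \<Rightarrow> nat \<Rightarrow> gate list \<Rightarrow> nat set \<Rightarrow> bool list \<Rightarrow> real" where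
  "marginal_prob \<theta> n Us I y =
     (\<Sum>z | length z = n \<and> nths z I = y. output_prob \<theta> n Us z)"

fun enc_gate :: "gate \<Rightarrow> val" where
  "enc_gate HAll = Num 0"
| "enc_gate (PGate i) = Pair (Num 0) (Num i)"
| "enc_gate (ZZGate i j) = Pair (Num 1) (Pair (Num i) (Num j))"

text \<open>
  \<open>I\<close> is given by its characteristic bit vector, so an instance has size at least \<open>n\<close> even
  though \<open>n\<close> itself is written in binary.
\<close>

definition enc_iqp :: "nat \<Rightarrow> gate list \<Rightarrow> nat set \<Rightarrow> bool list \<Rightarrow> val" where
  "enc_iqp n Us I y =
     Pair (Num n) (Pair (enc_list enc_gate Us)
       (Pair (enc_list enc_bool (map (\<lambda>i. i \<in> I) [0..<n])) (enc_list enc_bool y)))"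

definition iqp_instance :: "nat \<Rightarrow> gate list \<Rightarrow> nat set \<Rightarrow> bool list \<Rightarrow> bool" where
  "iqp_instance n Us I y \<longleftrightarrow> iqp_circuit n Us \<and> I \<subseteq> {..<n} \<and> length y = card I"

definition SSimIQP :: "real \<Rightarrow> real \<Rightarrow> search_problem" where
  "SSimIQP \<kappa> \<theta> = \<lparr>
     instances = {enc_iqp n Us I y | n Us I y. iqp_instance n Us I y},
     solutions = (\<lambda>w. {v. \<exists>n Us I y p. iqp_instance n Us I y \<and> w = enc_iqp n Us I y \<and>
       represents_rat v p \<and> approximates \<kappa> (marginal_prob \<theta> n Us I y) p}) \<rparr>"


section \<open>The non-uniform Ising model\<close>

text \<open>
  A multigraph has vertex set \<open>V\<close>, edge set \<open>E\<close> and a map assigning to every edge its pair of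
  end points (the order of the pair is irrelevant).
\<close>

definition Z_Ising :: "'v set \<Rightarrow> 'e set \<Rightarrow> ('e \<Rightarrow> 'v \<times> 'v) \<Rightarrow> ('e \<Rightarrow> complex) \<Rightarrow> ('v \<Rightarrow> complex) \<Rightarrow> complex"
  where "Z_Ising V E ends \<phi> \<tau> =
    (\<Sum>\<sigma>\<in>V \<rightarrow>\<^sub>E {0, 1 :: nat}.
       (\<Prod>e\<in>E. \<phi> e ^ of_bool (\<sigma> (fst (ends e)) = \<sigma> (snd (ends e)))) * (\<Prod>v\<in>V. \<tau> v ^ \<sigma> v))"

text \<open>
  Finite presentation of an input: \<open>n\<close> is the number of vertices; an edge \<open>(u, v, b)\<close> joins \<open>u\<close> and
  \<open>v\<close> and has interaction \<open>cis \<alpha>\<close> or \<open>cis (- \<alpha>)\<close> according to \<open>b\<close>; the field entry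
  \<open>(a, s, k)\<close> of a vertex stands for the value \<open>(-1) ^ a * cis (\<plusminus> \<alpha>) ^ k\<close>, with the sign given by \<open>s\<close>.
\<close>

type_synonym edge = "nat \<times> nat \<times> bool"
type_synonym field = "nat \<times> bool \<times> nat"

definition signed_cis :: "real \<Rightarrow> bool \<Rightarrow> complex" where
  "signed_cis \<alpha> b = (if b then cis \<alpha> else cis (- \<alpha>))"

fun edge_ends :: "edge \<Rightarrow> nat \<times> nat" where
  "edge_ends (u, v, b) = (u, v)"

fun edge_weight :: "real \<Rightarrow> edge \<Rightarrow> complex" where
  "edge_weight \<alpha> (u, v, b) = signed_cis \<alpha> b"

fun field_value :: "real \<Rightarrow> field \<Rightarrow> complex" where
  "field_value \<alpha> (a, s, k) = (-1) ^ a * signed_cis \<alpha> s ^ k"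

definition ising_instance :: "nat \<Rightarrow> edge list \<Rightarrow> field list \<Rightarrow> bool" where
  "ising_instance n es ts \<longleftrightarrow>
     (\<forall>e\<in>set es. fst (edge_ends e) < n \<and> snd (edge_ends e) < n) \<and> length ts = n"

definition ising_value :: "real \<Rightarrow> nat \<Rightarrow> edge list \<Rightarrow> field list \<Rightarrow> complex" where
  "ising_value \<alpha> n es ts =
     Z_Ising {..<n} {..<length es} (\<lambda>e. edge_ends (es ! e))
       (\<lambda>e. edge_weight \<alpha> (es ! e)) (\<lambda>v. field_value \<alpha> (ts ! v))"

fun enc_edge :: "edge \<Rightarrow> val" where
  "enc_edge (u, v, b) = Pair (Num u) (Pair (Num v) (enc_bool b))"

fun enc_field :: "field \<Rightarrow> val" where
  "enc_field (a, s, k) = Pair (Num a) (Pair (enc_bool s) (Num k))"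

definition enc_ising :: "nat \<Rightarrow> edge list \<Rightarrow> field list \<Rightarrow> val" where
  "enc_ising n es ts = Pair (Num n) (Pair (enc_list enc_edge es) (enc_list enc_field ts))"

definition IQPIsing :: "real \<Rightarrow> real \<Rightarrow> search_problem" where
  "IQPIsing \<kappa> \<alpha> = \<lparr>
     instances = {enc_ising n es ts | n es ts. ising_instance n es ts},
     solutions = (\<lambda>w. {v. \<exists>n es ts p. ising_instance n es ts \<and> w = enc_ising n es ts \<and>
       represents_rat v p \<and> approximates \<kappa> (cmod (ising_value \<alpha> n es ts)) p}) \<rparr>"


section \<open>Consistency of the encodings\<close>

lemma enc_bool_inject [simp]: "enc_bool a = enc_bool b \<longleftrightarrow> a = b"
  by (cases a; cases b) (simp_all add: enc_bool_def)

lemma enc_list_inject: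
  assumes "\<And>x y. f x = f y \<longleftrightarrow> x = y"
  shows "enc_list f xs = enc_list f ys \<longleftrightarrow> xs = ys"
proof (induction xs arbitrary: ys)
  case Nil
  then show ?case by (cases ys) auto
next
  case (Cons x xs)
  then show ?case by (cases ys) (auto simp: assms)
qed

lemma enc_gate_inject [simp]: "enc_gate a = enc_gate b \<longleftrightarrow> a = b"
  by (cases a; cases b) auto

lemma enc_edge_inject [simp]: "enc_edge a = enc_edge b \<longleftrightarrow> a = b"
  by (cases a; cases b) auto

lemma enc_field_inject [simp]: "enc_field a = enc_field b \<longleftrightarrow> a = b"
  by (cases a; cases b) auto

lemma enc_iqp_inject:
  assumes "I \<subseteq> {..<n}" "I' \<subseteq> {..<n'}"
  shows "enc_iqp n Us I y = enc_iqp n' Us' I' y' \<longleftrightarrow> n = n' \<and> Us = Us' \<and> I = I' \<and> y = y'"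
  using assms by (auto simp: enc_iqp_def enc_list_inject)

lemma enc_ising_inject:
  "enc_ising n es ts = enc_ising n' es' ts' \<longleftrightarrow> n = n' \<and> es = es' \<and> ts = ts'"
  by (auto simp: enc_ising_def enc_list_inject)

lemma basis_index_Cons: "basis_index (x # xs) = of_bool x * 2 ^ length xs + basis_index xs"
proof -
  have "foldl (\<lambda>k b. 2 * k + of_bool b) m xs = m * 2 ^ length xs + basis_index xs" for m
  proof (induction xs arbitrary: m)
    case (Cons b xs)
    show ?case
      using Cons[of "2 * m + of_bool b"] Cons[of "of_bool b"]
      by (simp add: basis_index_def algebra_simps)
  qed (simp add: basis_index_def)
  from this[of "of_bool x"] show ?thesis by (simp add: basis_index_def)
qed

lemma basis_index_Nil [simp]: "basis_index [] = 0"
  by (simp add: basis_index_def)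

lemma basis_index_less: "basis_index x < 2 ^ length x"
  by (induction x) (auto simp: basis_index_Cons)

lemma ket_eq_unit_vec: "ket x = unit_vec (2 ^ length x) (basis_index x)"
proof (induction x)
  case Nil
  show ?case by (rule eq_vecI) (auto simp: basis_index_def)
next
  case (Cons b x)
  let ?N = "2 ^ length x :: nat"
  have less: "basis_index x < ?N" by (rule basis_index_less)
  show ?case
  proof (rule eq_vecI)
    fix i assume "i < dim_vec (unit_vec (2 ^ length (b # x)) (basis_index (b # x)) :: complex vec)"
    then have i: "i < 2 * ?N" by simp
    then have d: "i div ?N < 2" by (simp add: div_less_iff_less_mult)
    have split: "i = (i div ?N) * ?N + i mod ?N" by (metis div_mult_mod_eq)
    have "i = basis_index (b # x) \<longleftrightarrow> i div ?N = of_bool b \<and> i mod ?N = basis_index x"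
      using less split by (auto simp: basis_index_Cons)
    moreover have "qubit b $ (i div ?N) = (if i div ?N = of_bool b then 1 else 0)"
      using d by (cases b) (auto simp: qubit_def less_2_cases_iff)
    ultimately show "ket (b # x) $ i =
        unit_vec (2 ^ length (b # x)) (basis_index (b # x)) $ i"
      using i less Cons by (auto simp: kron_vec_def qubit_def unit_vec_def)
  qed (auto simp: kron_vec_def Cons qubit_def)
qed

lemma basis_bits_basis_index: "length x = n \<Longrightarrow> basis_bits n (basis_index x) = x"
proof (induction x arbitrary: n)
  case (Cons b x)
  have "odd ((of_bool b * 2 ^ length x + basis_index x) div 2 ^ (length x - i)) =
      (if i = 0 then b else odd (basis_index x div 2 ^ (length x - i)))" if "i \<le> length x" for i
  proof (cases i)
    case (Suc j)
    have "(2::nat) ^ length x = 2 * 2 ^ j * 2 ^ (length x - i)"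
      using Suc that by (simp flip: power_add power_Suc)
    then show ?thesis using Suc by (auto simp: add.commute)
  qed (use basis_index_less[of x] in auto)
  note odd_iff = this
  have "basis_bits n (basis_index (b # x)) ! i = (b # x) ! i" if "i < n" for i
  proof (cases i)
    case 0
    then show ?thesis
      using odd_iff[of 0] Cons.prems by (auto simp: basis_bits_def basis_index_Cons)
  next
    case (Suc j)
    then have "j < length x" using that Cons.prems by simp
    then have "basis_bits (length x) (basis_index x) ! j =
        odd (basis_index x div 2 ^ (length x - 1 - j))"
      by (simp add: basis_bits_def)
    then have "x ! j = odd (basis_index x div 2 ^ (length x - i))"
      using Cons.IH[OF refl] Suc by simp
    then show ?thesis
      using odd_iff[of i] Suc Cons.prems \<open>j < length x\<close>
      by (simp add: basis_bits_def basis_index_Cons flip: Cons.prems del: upt_Suc)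
  qed
  then show ?case
    using Cons.prems by (intro nth_equalityI) (simp_all add: basis_bits_def)
qed (simp add: basis_bits_def)

end

theory Submission
  imports Defs
begin

text \<open>
  The amplitude of an outcome \<open>y\<close> of an IQP circuit is \<open>2 ^ - n\<close> times a sum over bit strings \<open>x\<close> of
  \<open>(-1) ^ (x \<bullet> y)\<close> times a product of gate phases, which is an Ising partition function: \<open>ZZ\<close> gates are
  edges, and \<open>P\<close> gates and outcome bits are external fields. As \<open>cis \<theta>\<close> is a root of unity, inverse gates
  are powers of gates; so \<open>|Z|\<^sup>2 = 4 ^ n * Pr\<close> for the circuit of a given Ising instance, with all qubits
  measured.

  Conversely, a marginal probability expands into a double sum over pairs of bit strings that agree on the
  unmeasured qubits. This is a single partition function, on two copies of the measured qubits whose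
  edges carry opposite interactions. Isolated second copies of the unmeasured qubits supply the
  factors \<open>2\<close>. The fields in the two copies agree, so the weights are invariant under a global spin flip
  and \<open>P\<close> gates can be replaced by edges to an ancilla. Four disjoint copies of this graph give the
  fourth power of the probability, so that the fourth root of the answer has error \<open>\<kappa> powr (1 / 4)\<close>.

  Both programs extract a root of the answer by a geometric search with a ratio \<open>1 + 1 / r\<close> close to \<open>1\<close>; the
  slack in the exponents of \<open>\<kappa>\<close> absorbs its error.
\<close>

section \<open>Time bounds for WHILE programs\<close>

text \<open>The program of a reduction is fixed before the bound \<open>q\<close> on the answers is
  known; only the polynomial may depend on \<open>q\<close>. Time is therefore kept apart from
  correctness: one budget \<open>M\<close>, polynomial in the input size, bounds all stored values
  and all loop counts, and the time is a polynomial in \<open>M\<close> read off the program text.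

  Field exponents come in binary and may be exponentially large, whereas gates are written out one
  by one. So a \<open>k > 0\<close> with \<open>cis \<theta> ^ k = 1\<close> serves twice: it turns
  inverses into powers, and it allows exponents to be reduced modulo \<open>k\<close>.

  The angle doubles because \<open>ZZ\<close> gives \<open>cis \<theta>\<close> on equal and
  \<open>cis (- \<theta>)\<close> on different bits, a ratio of \<open>cis (2 * \<theta>)\<close>.
  For one copy the translation holds up to a constant of modulus 1; for two copies with opposite
  interactions the constants cancel, and the partition function is a nonnegative real.

  Several disjoint copies are taken because roots of rationals can only be approximated. One copy
  yields error \<kappa> instead of its square root, two would require an exact square root, and four
  leave room for the search.\<close>

lemma vsize_pos: "1 \<le> vsize v"
  by (cases v) auto

text \<open>For nonzero arguments with leading powers \<open>2 ^ k\<close> and \<open>2 ^ l\<close>,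
  each power is at most the product of the two, so the sum is below
  \<open>4 * 2 ^ k * 2 ^ l\<close>. Subadditivity is what makes the size bound for expressions
  linear.\<close>

lemma floorlog_add: "floorlog 2 (a + b) \<le> floorlog 2 a + floorlog 2 b"
proof (cases "a = 0 \<or> b = 0")
  case False
  have "a < 2 ^ floorlog 2 a" "b < 2 ^ floorlog 2 b"
    using floorlog_le_iff[of 2 a "floorlog 2 a"] floorlog_le_iff[of 2 b "floorlog 2 b"] by auto
  moreover obtain k l where kl: "floorlog 2 a = Suc k" "floorlog 2 b = Suc l"
    using False by (cases "floorlog 2 a"; cases "floorlog 2 b") (auto simp: floorlog_def split: if_splits)
  ultimately have "a + b < 2 * 2 ^ k + 2 * 2 ^ l" by simp
  also have "\<dots> \<le> 4 * (2 ^ k * 2 ^ l :: nat)"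
  proof -
    have "(2::nat) ^ k \<le> 2 ^ k * 2 ^ l" "(2::nat) ^ l \<le> 2 ^ k * 2 ^ l" by simp_all
    then show ?thesis by linarith
  qed
  finally have "a + b < 2 ^ (floorlog 2 a + floorlog 2 b)"
    by (simp add: kl power_add)
  then show ?thesis by (simp add: floorlog_le_iff)
qed auto

lemma floorlog_mult: "floorlog 2 (a * b) \<le> floorlog 2 a + floorlog 2 b"
proof -
  have "a < 2 ^ floorlog 2 a" "b < 2 ^ floorlog 2 b"
    using floorlog_le_iff[of 2 a "floorlog 2 a"] floorlog_le_iff[of 2 b "floorlog 2 b"] by auto
  then have "a * b < 2 ^ (floorlog 2 a + floorlog 2 b)"
    by (simp add: power_add mult_strict_mono')
  then show ?thesis by (simp add: floorlog_le_iff)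
qed

lemma floorlog_less_self: "floorlog 2 a \<le> a"
  by (simp add: floorlog_le_iff)

lemma vsize_Num_mono: "a \<le> b \<Longrightarrow> vsize (Num a) \<le> vsize (Num b)"
  by (simp add: floorlog_mono)

lemma vsize_Num_le: "vsize (Num a) \<le> Suc a"
  using floorlog_less_self by simp

lemma vsize_val_num: "vsize (Num (val_num v)) \<le> vsize v"
  by (cases v) (auto simp: floorlog_def)

lemma vsize_val_fst: "vsize (val_fst v) \<le> vsize v"
  by (cases v) (auto simp: floorlog_def)

lemma vsize_val_snd: "vsize (val_snd v) \<le> vsize v"
  by (cases v) (auto simp: floorlog_def)

lemma vsize_of_bool: "vsize (Num (of_bool b)) \<le> 2"
  by (cases b) (auto simp: floorlog_def)

text \<open>Factor by which the value of an expression can exceed a common size bound of the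
  variables. A constant counts with its own size, since it is not governed by the state.\<close>

fun expr_weight :: "expr \<Rightarrow> nat" where
  "expr_weight e = (case e of Const k \<Rightarrow> vsize (Num k) | _ \<Rightarrow> 1) +
     (\<Sum>f\<leftarrow>expr_args e. expr_weight f)"

declare expr_weight.simps [simp del]

text \<open>The weights summed over all subexpressions, because the logarithmic cost charges each of
  them for its value.\<close>

fun expr_factor :: "expr \<Rightarrow> nat" where
  "expr_factor e = expr_weight e + (\<Sum>f\<leftarrow>expr_args e. expr_factor f)"

declare expr_factor.simps [simp del]

definition bounded :: "nat \<Rightarrow> state \<Rightarrow> bool" where
  "bounded M s \<longleftrightarrow> (\<forall>x. vsize (s x) \<le> M)"

lemma boundedD: "bounded M s \<Longrightarrow> vsize (s x) \<le> M"
  by (simp add: bounded_def)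

lemma bounded_upd: "bounded M s \<Longrightarrow> vsize v \<le> M \<Longrightarrow> bounded M (s(x := v))"
  by (simp add: bounded_def)

lemma bounded_pos: "bounded M s \<Longrightarrow> 1 \<le> M"
  using vsize_pos boundedD le_trans by blast

lemma val_num_bounded: "floorlog 2 (val_num v) \<le> vsize v - 1"
  using vsize_val_num[of v] by simp

text \<open>No operation of the language is superadditive in the sizes of its arguments, hence a linear
  bound.\<close>

lemma vsize_eval_expr:
  assumes "bounded M s"
  shows "vsize (eval_expr s e) \<le> expr_weight e * M"
proof (induction e)
  case (Var x)
  then show ?case using assms by (simp add: expr_weight.simps boundedD)
next
  case (Const k)
  have "vsize (Num k) * 1 \<le> vsize (Num k) * M"
    by (intro mult_le_mono2 bounded_pos[OF assms])
  then show ?case by (simp add: expr_weight.simps)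
next
  case (MkPair e f)
  then show ?case using bounded_pos[OF assms] by (simp add: expr_weight.simps algebra_simps)
next
  case (Fst e)
  then show ?case using vsize_val_fst[of "eval_expr s e"]
    by (simp add: expr_weight.simps algebra_simps)
next
  case (Snd e)
  then show ?case using vsize_val_snd[of "eval_expr s e"]
    by (simp add: expr_weight.simps algebra_simps)
next
  case (IsPair e)
  then show ?case using vsize_of_bool[of "val_is_pair (eval_expr s e)"] bounded_pos[OF assms]
      vsize_pos[of "eval_expr s e"]
    by (simp add: expr_weight.simps algebra_simps del: vsize.simps)
next
  case (Plus e f)
  then show ?case
    using floorlog_add[of "val_num (eval_expr s e)" "val_num (eval_expr s f)"]
      val_num_bounded[of "eval_expr s e"] val_num_bounded[of "eval_expr s f"] bounded_pos[OF assms]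
    by (simp add: expr_weight.simps algebra_simps)
next
  case (Minus e f)
  then show ?case
    using floorlog_mono[of "val_num (eval_expr s e) - val_num (eval_expr s f)"
      "val_num (eval_expr s e)" 2]
      val_num_bounded[of "eval_expr s e"] bounded_pos[OF assms]
    by (simp add: expr_weight.simps algebra_simps)
next
  case (Times e f)
  then show ?case
    using floorlog_mult[of "val_num (eval_expr s e)" "val_num (eval_expr s f)"]
      val_num_bounded[of "eval_expr s e"] val_num_bounded[of "eval_expr s f"] bounded_pos[OF assms]
    by (simp add: expr_weight.simps algebra_simps)
next
  case (Div e f)
  then show ?case
    using floorlog_mono[of "val_num (eval_expr s e) div val_num (eval_expr s f)"
      "val_num (eval_expr s e)" 2]
      val_num_bounded[of "eval_expr s e"] bounded_pos[OF assms]
    by (simp add: expr_weight.simps algebra_simps)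
next
  case (Mod e f)
  then show ?case
    using floorlog_mono[of "val_num (eval_expr s e) mod val_num (eval_expr s f)"
      "val_num (eval_expr s e)" 2]
      val_num_bounded[of "eval_expr s e"] bounded_pos[OF assms]
    by (simp add: expr_weight.simps algebra_simps)
next
  case (Less e f)
  then show ?case
    using vsize_of_bool[of "val_num (eval_expr s e) < val_num (eval_expr s f)"]
      vsize_pos[of "eval_expr s e"] bounded_pos[OF assms]
    by (simp add: expr_weight.simps algebra_simps del: vsize.simps)
next
  case (Equal e f)
  then show ?case
    using vsize_of_bool[of "eval_expr s e = eval_expr s f"]
      vsize_pos[of "eval_expr s e"] bounded_pos[OF assms]
    by (simp add: expr_weight.simps algebra_simps del: vsize.simps)
qed

lemma expr_cost_le: "bounded M s \<Longrightarrow> expr_cost s e \<le> expr_factor e * M"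
proof (induction e rule: expr_factor.induct)
  case (1 e)
  have "(\<Sum>f\<leftarrow>expr_args e. expr_cost s f) \<le> (\<Sum>f\<leftarrow>expr_args e. expr_factor f * M)"
    by (rule sum_list_mono) (use 1 in auto)
  then show ?case
    using vsize_eval_expr[OF 1(2), of e]
    by (subst expr_cost.simps, subst expr_factor.simps)
      (simp add: algebra_simps sum_list_const_mult)
qed

text \<open>The polynomial is evaluated at the budget \<open>M\<close>. A query pays one further
  \<open>M\<close> for its answer, and a loop of at most \<open>M\<close> iterations evaluates its
  guard up to \<open>M + 1\<close> times.\<close>

fun time_bound :: "com \<Rightarrow> nat poly" where
  "time_bound Skip = 1"
| "time_bound (Assign x e) = [:1, expr_factor e:]"
| "time_bound (Query x e) = [:1, Suc (expr_factor e):]"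
| "time_bound (Seq c d) = 1 + time_bound c + time_bound d"
| "time_bound (Cond e c d) = [:1, expr_factor e:] + time_bound c + time_bound d"
| "time_bound (While e c) = [:1, 1:] * ([:1, expr_factor e:] + time_bound c)"

text \<open>The time bound stands for at most \<open>M\<close> iterations of every loop each time it is entered.\<close>

definition wp :: "(val \<Rightarrow> val) \<Rightarrow> nat \<Rightarrow> com \<Rightarrow> (state \<Rightarrow> bool) \<Rightarrow> state \<Rightarrow> bool" where
  "wp ora M c Q s \<longleftrightarrow> (bounded M s \<longrightarrow>
     (\<exists>t s'. exec ora c s t s' \<and> t \<le> poly (time_bound c) M \<and> bounded M s' \<and> Q s'))"

text \<open>Makes the size bounds of the current state available when the size obligations of later
  assignments are discharged.\<close>

lemma wp_bounded: "(bounded M s \<Longrightarrow> wp ora M c Q s) \<Longrightarrow> wp ora M c Q s"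
  by (auto simp: wp_def)

lemma wp_mono: "wp ora M c Q s \<Longrightarrow> (\<And>s'. bounded M s' \<Longrightarrow> Q s' \<Longrightarrow> R s') \<Longrightarrow> wp ora M c R s"
  unfolding wp_def by blast

section \<open>Proof rules for the commands\<close>

lemma wp_Skip: "Q s \<Longrightarrow> wp ora M Skip Q s"
  by (auto simp: wp_def intro!: exI exec_Skip)

lemma wp_Assign:
  assumes "bounded M s \<Longrightarrow> vsize (eval_expr s e) \<le> M"
    and "Q (s(x := eval_expr s e))"
  shows "wp ora M (Assign x e) Q s"
  unfolding wp_def
proof
  assume b: "bounded M s"
  show "\<exists>t s'. exec ora (Assign x e) s t s' \<and> t \<le> poly (time_bound (Assign x e)) M \<and>
      bounded M s' \<and> Q s'"
    using exec_Assign[of ora x e s] expr_cost_le[OF b, of e] assms bounded_upd[OF b] b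
    by (intro exI conjI) (auto simp: algebra_simps)
qed

lemma wp_Query:
  assumes "vsize (ora (eval_expr s e)) \<le> M"
    and "Q (s(x := ora (eval_expr s e)))"
  shows "wp ora M (Query x e) Q s"
  unfolding wp_def
proof
  assume b: "bounded M s"
  show "\<exists>t s'. exec ora (Query x e) s t s' \<and> t \<le> poly (time_bound (Query x e)) M \<and>
      bounded M s' \<and> Q s'"
    using exec_Query[of "ora (eval_expr s e)" ora s e x] expr_cost_le[OF b, of e] assms
      bounded_upd[OF b]
    by (intro exI conjI) (auto simp: algebra_simps)
qed

lemma wp_Seq:
  assumes "wp ora M c (wp ora M d Q) s"
  shows "wp ora M (Seq c d) Q s"
  unfolding wp_def
proof
  assume b: "bounded M s"
  then obtain t s' where 1: "exec ora c s t s'" "t \<le> poly (time_bound c) M" "bounded M s'"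
      "wp ora M d Q s'"
    using assms unfolding wp_def[of _ _ c] by blast
  then obtain t' s'' where 2: "exec ora d s' t' s''" "t' \<le> poly (time_bound d) M" "bounded M s''"
      "Q s''"
    unfolding wp_def by blast
  show "\<exists>t s'. exec ora (Seq c d) s t s' \<and> t \<le> poly (time_bound (Seq c d)) M \<and>
      bounded M s' \<and> Q s'"
    using exec_Seq[OF 1(1) 2(1)] 1 2 by (intro exI conjI) auto
qed

lemma wp_Cond:
  assumes "eval_expr s e \<noteq> Num 0 \<Longrightarrow> wp ora M c Q s"
    and "eval_expr s e = Num 0 \<Longrightarrow> wp ora M d Q s"
  shows "wp ora M (Cond e c d) Q s"
  unfolding wp_def
proof
  assume b: "bounded M s"
  note cost = expr_cost_le[OF b, of e]
  show "\<exists>t s'. exec ora (Cond e c d) s t s' \<and> t \<le> poly (time_bound (Cond e c d)) M \<and>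
      bounded M s' \<and> Q s'"
  proof (cases "eval_expr s e = Num 0")
    case True
    then obtain t s' where 1: "exec ora d s t s'" "t \<le> poly (time_bound d) M" "bounded M s'" "Q s'"
      using assms(2) b unfolding wp_def by blast
    show ?thesis
      using exec_CondFalse[OF True 1(1), of c] 1 cost
      by (intro exI conjI) (auto simp: algebra_simps)
  next
    case False
    then obtain t s' where 1: "exec ora c s t s'" "t \<le> poly (time_bound c) M" "bounded M s'" "Q s'"
      using assms(1) b unfolding wp_def by blast
    show ?thesis
      using exec_CondTrue[OF False 1(1), of d] 1 cost
      by (intro exI conjI) (auto simp: algebra_simps)
  qed
qed

text \<open>The index of \<open>Inv\<close> counts the remaining iterations, so it is invariant and
  variant at once. Termination and the iteration bound both come from its initial value
  \<open>k\<close>.\<close>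

lemma wp_While:
  assumes step: "\<And>i s. Inv (Suc i) s \<Longrightarrow> eval_expr s e \<noteq> Num 0 \<and> wp ora M c (Inv i) s"
    and stop: "\<And>s. Inv 0 s \<Longrightarrow> eval_expr s e = Num 0 \<and> Q s"
    and "Inv k s" "bounded M s \<Longrightarrow> k \<le> M"
  shows "wp ora M (While e c) Q s"
  unfolding wp_def
proof
  let ?C = "1 + expr_factor e * M"
  assume b: "bounded M s"
  \<comment> \<open>The bound is exact about the shape of a run: \<open>k\<close> rounds of test and
    body, then one last failing test.\<close>
  have "\<exists>t s'. exec ora (While e c) s t s' \<and> t \<le> k * (?C + poly (time_bound c) M) + ?C \<and>
      bounded M s' \<and> Q s'"
    using assms(3) b
  proof (induction k arbitrary: s)
    case 0
    show ?case
      using exec_WhileFalse[of s e ora c] stop[OF 0(1)] expr_cost_le[OF 0(2), of e] 0(2)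
      by (intro exI conjI) auto
  next
    case (Suc k)
    obtain t s' where 1: "exec ora c s t s'" "t \<le> poly (time_bound c) M" "bounded M s'" "Inv k s'"
      using step[OF Suc.prems(1)] Suc.prems(2) unfolding wp_def by blast
    obtain t' s'' where 2: "exec ora (While e c) s' t' s''"
      "t' \<le> k * (?C + poly (time_bound c) M) + ?C" "bounded M s''" "Q s''"
      using Suc.IH[OF 1(4,3)] by blast
    have "eval_expr s e \<noteq> Num 0" using step[OF Suc.prems(1)] by simp
    from exec_WhileTrue[OF this 1(1) 2(1)] show ?case
      using 1 2 expr_cost_le[OF Suc.prems(2), of e] by (intro exI conjI) auto
  qed
  then obtain t s' where *: "exec ora (While e c) s t s'"
    "t \<le> k * (?C + poly (time_bound c) M) + ?C" "bounded M s'" "Q s'" by blast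
  have "k * (?C + poly (time_bound c) M) \<le> M * (?C + poly (time_bound c) M)"
    using assms(4)[OF b] by (rule mult_right_mono) simp
  then have "t \<le> poly (time_bound (While e c)) M"
    using *(2) by (simp add: algebra_simps)
  with * show "\<exists>t s'. exec ora (While e c) s t s' \<and> t \<le> poly (time_bound (While e c)) M \<and>
      bounded M s' \<and> Q s'" by blast
qed

lemma length_le_vsize_enc_list: "length xs < vsize (enc_list f xs)"
  by (induction xs) auto

text \<open>Traversal of an encoded list: \<open>ys\<close> is the consumed prefix and variable
  \<open>x\<close> holds the rest. An encoded list is larger than its length, so the iteration count
  is within the budget without further assumptions.\<close>

lemma wp_list_loop:
  assumes step: "\<And>ys z zs s. xs = ys @ z # zs \<Longrightarrow> Inv ys s \<Longrightarrow> bounded M s \<Longrightarrow>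
      s x = Pair (f z) (enc_list f zs) \<Longrightarrow>
      wp ora M c (\<lambda>s. Inv (ys @ [z]) s \<and> s x = enc_list f zs) s"
    and stop: "\<And>s. Inv xs s \<Longrightarrow> s x = Num 0 \<Longrightarrow> Q s"
    and "Inv [] s" "s x = enc_list f xs"
  shows "wp ora M (While (IsPair (Var x)) c) Q s"
proof (rule wp_While[where Inv = "\<lambda>i s. \<exists>ys zs. xs = ys @ zs \<and> length zs = i \<and>
      Inv ys s \<and> s x = enc_list f zs" and k = "length xs"])
  fix i s assume "\<exists>ys zs. xs = ys @ zs \<and> length zs = Suc i \<and> Inv ys s \<and> s x = enc_list f zs"
  then obtain ys z zs where *: "xs = ys @ z # zs" "length zs = i" "Inv ys s"
      "s x = Pair (f z) (enc_list f zs)"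
    by (auto simp: length_Suc_conv)
  then have "wp ora M c (\<lambda>s. \<exists>ys zs. xs = ys @ zs \<and> length zs = i \<and> Inv ys s \<and>
      s x = enc_list f zs) s"
    by (intro wp_bounded[OF wp_mono[OF step[of ys z zs]]] exI[of _ "ys @ [z]"] exI[of _ zs]) auto
  with * show "eval_expr s (IsPair (Var x)) \<noteq> Num 0 \<and>
      wp ora M c (\<lambda>s. \<exists>ys zs. xs = ys @ zs \<and> length zs = i \<and> Inv ys s \<and> s x = enc_list f zs) s"
    by simp
next
  show "\<exists>ys zs. xs = ys @ zs \<and> length zs = length xs \<and> Inv ys s \<and> s x = enc_list f zs"
    using assms(3,4) by (intro exI[of _ "[]"] exI[of _ xs]) auto
  assume "bounded M s"
  then show "length xs \<le> M"
    using boundedD[of M s x] length_le_vsize_enc_list[of xs f] assms(4) by simp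
qed (use stop in auto)

section \<open>From budgets to reductions; list operations of the programs\<close>

lemma vsize_enc_list_le:
  "(\<And>x. x \<in> set xs \<Longrightarrow> vsize (f x) \<le> B) \<Longrightarrow> vsize (enc_list f xs) \<le> 1 + length xs * (1 + B)"
proof (induction xs)
  case (Cons x xs)
  from Cons.IH Cons.prems[of x] Cons.prems show ?case by fastforce
qed (simp add: floorlog_def)

lemma poly_nat_mono: "(x::nat) \<le> y \<Longrightarrow> poly p x \<le> poly p y"
  by (induction p) (auto intro!: add_mono mult_mono)

text \<open>The budget \<open>poly B (vsize x)\<close> may depend on \<open>q\<close> but not on the
  oracle. It has to dominate the input size for the initial state to be bounded; the running time is
  \<open>time_bound c\<close> composed with \<open>B\<close>.\<close>

lemma poly_turing_reducibleI:
  assumes "\<And>q. \<exists>B. \<forall>ora. solves_within q ora P \<longrightarrow> (\<forall>x\<in>instances A. vsize x \<le> poly B (vsize x) \<and>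
      wp ora (poly B (vsize x)) c (\<lambda>s. s 0 \<in> solutions A x) (init_state x))"
  shows "poly_turing_reducible A P"
  unfolding poly_turing_reducible_def
proof (rule exI[of _ c], rule allI)
  fix q
  obtain B where B: "\<And>ora x. solves_within q ora P \<Longrightarrow> x \<in> instances A \<Longrightarrow>
      vsize x \<le> poly B (vsize x) \<and>
      wp ora (poly B (vsize x)) c (\<lambda>s. s 0 \<in> solutions A x) (init_state x)"
    using assms by blast
  have "\<exists>t s. exec ora c (init_state x) t s \<and> t \<le> poly (pcompose (time_bound c) B) (vsize x) \<and>
      s 0 \<in> solutions A x" if "solves_within q ora P" "x \<in> instances A" for ora x
  proof -
    have "bounded (poly B (vsize x)) (init_state x)"
      using B[OF that] vsize_pos[of x] by (auto simp: bounded_def init_state_def floorlog_def)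
    with B[OF that] show ?thesis unfolding wp_def poly_pcompose by blast
  qed
  then show "\<exists>p. \<forall>ora. solves_within q ora P \<longrightarrow> (\<forall>x\<in>instances A. \<exists>t s.
      exec ora c (init_state x) t s \<and> t \<le> poly p (vsize x) \<and> s 0 \<in> solutions A x)"
    by blast
qed

text \<open>The repetition is unrolled into the expression, which is possible for counts fixed in
  the program text.\<close>

fun push :: "nat \<Rightarrow> expr \<Rightarrow> expr \<Rightarrow> expr" where
  "push 0 g l = l"
| "push (Suc k) g l = MkPair g (push k g l)"

lemma eval_push:
  assumes "eval_expr s g = f x" "eval_expr s l = enc_list f xs"
  shows "eval_expr s (push k g l) = enc_list f (replicate k x @ xs)"
  using assms by (induction k) auto

text \<open>Loops build lists by prepending, hence backwards. Only lists whose positions matter,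
  outcomes and fields, are turned round; for edges and diagonal gates the order does not affect the
  product.\<close>

definition reverse :: "nat \<Rightarrow> nat \<Rightarrow> com" where
  "reverse x y = Seq (Assign y (Const 0)) (While (IsPair (Var x))
     (Seq (Assign y (MkPair (Fst (Var x)) (Var y))) (Assign x (Snd (Var x)))))"

lemma vsize_enc_list: "vsize (enc_list f xs) = 1 + (\<Sum>x\<leftarrow>xs. 1 + vsize (f x))"
  by (induction xs) (auto simp: floorlog_def)

lemma wp_reverse:
  assumes "x \<noteq> y" "s x = enc_list f xs"
    and Q: "Q (s(x := Num 0, y := enc_list f (rev xs)))"
  shows "wp ora M (reverse x y) Q s"
proof (rule wp_bounded)
  assume b: "bounded M s"
  have M: "vsize (enc_list f xs) \<le> M" using boundedD[OF b, of x] assms(2) by simp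
  show ?thesis
    unfolding reverse_def
  proof (rule wp_Seq, rule wp_Assign)
    show "vsize (eval_expr s (Const 0)) \<le> M" using bounded_pos[OF b] by (simp add: floorlog_def)
    show "wp ora M (While (IsPair (Var x)) (Seq (Assign y (MkPair (Fst (Var x)) (Var y)))
        (Assign x (Snd (Var x))))) Q (s(y := eval_expr s (Const 0)))"
    proof (rule wp_list_loop[where xs = xs and f = f and
          Inv = "\<lambda>ys t. t y = enc_list f (rev ys) \<and> (\<forall>z. z \<noteq> x \<longrightarrow> z \<noteq> y \<longrightarrow> t z = s z)"])
      fix t assume t: "t y = enc_list f (rev xs) \<and> (\<forall>z. z \<noteq> x \<longrightarrow> z \<noteq> y \<longrightarrow> t z = s z)" "t x = Num 0"
      then have "t = s(x := Num 0, y := enc_list f (rev xs))" by auto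
      then show "Q t" using Q by simp
    next
      fix ys z zs t
      assume t: "xs = ys @ z # zs" "t y = enc_list f (rev ys) \<and> (\<forall>z. z \<noteq> x \<longrightarrow> z \<noteq> y \<longrightarrow> t z = s z)"
        "bounded M t" "t x = Pair (f z) (enc_list f zs)"
      \<comment> \<open>Sizes are sums over the entries, so a reversed prefix is no larger than the
        whole list.\<close>
      have le: "vsize (enc_list f (z # rev ys)) \<le> M"
        using M unfolding t(1) vsize_enc_list by (simp add: rev_map sum_list_rev del: vsize.simps flip: rev_map)
      show "wp ora M (Seq (Assign y (MkPair (Fst (Var x)) (Var y))) (Assign x (Snd (Var x))))
          (\<lambda>s'. (s' y = enc_list f (rev (ys @ [z])) \<and> (\<forall>z. z \<noteq> x \<longrightarrow> z \<noteq> y \<longrightarrow> s' z = s z)) \<and>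
            s' x = enc_list f zs) t"
        using t le boundedD[OF t(3), of x] assms(1)
        by (intro wp_Seq wp_Assign) auto
    qed (use assms in auto)
  qed
qed

section \<open>Amplitudes of IQP circuits\<close>

definition bits :: "nat \<Rightarrow> bool list set" where
  "bits n = {x. length x = n}"

lemma bits_0 [simp]: "bits 0 = {[]}"
  by (auto simp: bits_def)

lemma bits_Suc: "bits (Suc n) = Cons False ` bits n \<union> Cons True ` bits n"
proof -
  have "x \<in> Cons False ` bits n \<union> Cons True ` bits n" if "length x = Suc n" for x :: "bool list"
    using that by (cases x; cases "hd x") (auto simp: bits_def)
  then show ?thesis by (auto simp: bits_def)
qed

lemma finite_bits [simp]: "finite (bits n)"
  by (induction n) (auto simp: bits_Suc)

lemma sum_bits_Suc:
  "(\<Sum>x\<in>bits (Suc n). f x) = (\<Sum>x\<in>bits n. f (False # x)) + (\<Sum>x\<in>bits n. f (True # x))"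
  unfolding bits_Suc
  by (subst sum.union_disjoint) (auto simp: sum.reindex inj_on_def)

lemma sum_bits_append:
  "(\<Sum>x\<in>bits (m + n). f x) = (\<Sum>x\<in>bits m. \<Sum>y\<in>bits n. f (x @ y))"
proof (induction m arbitrary: f)
  case 0
  then show ?case by simp
next
  case (Suc m)
  show ?case using Suc[of "\<lambda>x. f (False # x)"] Suc[of "\<lambda>x. f (True # x)"]
    by (simp add: sum_bits_Suc)
qed

lemma sum_bits_snoc:
  "(\<Sum>x\<in>bits (Suc n). f x) = (\<Sum>x\<in>bits n. f (x @ [False]) + f (x @ [True]))"
  using sum_bits_append[of f n 1] by (simp add: sum_bits_Suc)

lemma card_bits: "card (bits n) = 2 ^ n"
  by (induction n) (auto simp: card_eq_sum sum_bits_Suc simp del: sum_constant)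

text \<open>\<open>basis_bits\<close> is a left inverse, which gives injectivity; counting gives
  surjectivity.\<close>

lemma bij_betw_basis_index: "bij_betw basis_index (bits n) {..<2 ^ n}"
proof -
  have inj: "inj_on basis_index (bits n)"
    by (rule inj_on_inverseI[where g = "basis_bits n"]) (auto simp: bits_def basis_bits_basis_index)
  have "basis_index ` bits n \<subseteq> {..<2 ^ n}"
    using basis_index_less by (auto simp: bits_def)
  moreover have "card (basis_index ` bits n) = card {..<2 ^ n :: nat}"
    using card_image[OF inj] by (simp add: card_bits)
  ultimately have "basis_index ` bits n = {..<2 ^ n}"
    by (intro card_subset_eq) auto
  with inj show ?thesis by (simp add: bij_betw_def)
qed

lemma basis_index_basis_bits: "k < 2 ^ n \<Longrightarrow> basis_index (basis_bits n k) = k"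
proof -
  assume "k < 2 ^ n"
  then obtain x where "length x = n" "basis_index x = k"
    using bij_betw_basis_index[of n] by (force simp: bij_betw_def bits_def)
  then show ?thesis using basis_bits_basis_index by force
qed

lemma length_basis_bits [simp]: "length (basis_bits n k) = n"
  by (simp add: basis_bits_def)

text \<open>The character \<open>(-1) ^ (x \<bullet> y)\<close>, as a product over positions so that
  it factors qubit by qubit.\<close>

definition bit_sign :: "bool list \<Rightarrow> bool list \<Rightarrow> complex" where
  "bit_sign x y = (\<Prod>i<length x. if x ! i \<and> y ! i then -1 else 1)"

lemma bit_sign_Cons: "bit_sign (a # x) (b # y) = (if a \<and> b then -1 else 1) * bit_sign x y"
  by (simp add: bit_sign_def prod.lessThan_Suc_shift del: prod.lessThan_Suc)

lemma bit_sign_replicate_False [simp]: "length x = n \<Longrightarrow> bit_sign x (replicate n False) = 1"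
  by (simp add: bit_sign_def)

lemma cnj_bit_sign [simp]: "cnj (bit_sign x y) = bit_sign x y"
  by (simp add: bit_sign_def if_distrib cong: if_cong)

section \<open>Hadamard layers and diagonal gates acting on functions of bit strings\<close>

lemma H_tensor_carrier: "H_tensor n \<in> carrier_mat (2 ^ n) (2 ^ n)"
  by (induction n) (auto simp: kron_mat_def H_gate_def mat_of_rows_list_def)

text \<open>Up to scaling, the tensor power of \<open>H\<close> is the character table of the group
  of bit strings. The leading bits select the block, and the blocks differ only by the sign of
  \<open>H_gate\<close>.\<close>

lemma H_tensor_entry:
  "x \<in> bits n \<Longrightarrow> y \<in> bits n \<Longrightarrow>
     H_tensor n $$ (basis_index x, basis_index y) = complex_of_real (1 / sqrt 2) ^ n * bit_sign x y"
proof (induction n arbitrary: x y)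
  case 0
  then show ?case by (simp add: bit_sign_def)
next
  case (Suc n)
  obtain a x' where x: "x = a # x'" "length x' = n" using Suc.prems(1)
    by (cases x) (auto simp: bits_def)
  obtain b y' where y: "y = b # y'" "length y' = n" using Suc.prems(2)
    by (cases y) (auto simp: bits_def)
  have less: "basis_index x' < 2 ^ n" "basis_index y' < 2 ^ n"
    using basis_index_less[of x'] basis_index_less[of y'] x y by auto
  have dm: "(of_bool a * 2 ^ n + basis_index x') div 2 ^ n = of_bool a"
    "(of_bool b * 2 ^ n + basis_index y') div 2 ^ n = of_bool b"
    "(of_bool a * 2 ^ n + basis_index x') mod 2 ^ n = basis_index x'"
    "(of_bool b * 2 ^ n + basis_index y') mod 2 ^ n = basis_index y'"
    using less by auto
  have l2: "of_bool a * 2 ^ n + basis_index x' < 2 * 2 ^ n"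
    "of_bool b * 2 ^ n + basis_index y' < 2 * 2 ^ n"
    using less by (cases a; cases b; simp)+
  have H: "H_gate $$ (of_bool a, of_bool b) = complex_of_real (1 / sqrt 2) *
      (if a \<and> b then -1 else 1)"
    by (cases a; cases b) (simp_all add: H_gate_def mat_of_rows_list_def)
  have dim: "dim_row H_gate = 2" "dim_col H_gate = 2"
    by (simp_all add: H_gate_def mat_of_rows_list_def)
  have IH: "H_tensor n $$ (basis_index x', basis_index y') =
      complex_of_real (1 / sqrt 2) ^ n * bit_sign x' y'"
    using Suc.IH[of x' y'] x y by (simp add: bits_def)
  show ?case
    using carrier_matD[OF H_tensor_carrier[of n]] l2 dim less
    by (simp add: x(1) y(1) basis_index_Cons x(2) y(2) kron_mat_def dm H IH bit_sign_Cons)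
qed

text \<open>Turns a function on bit strings into a vector, so that gates can be followed as
  operations on functions rather than on numerical indices.\<close>

definition state_vec :: "nat \<Rightarrow> (bool list \<Rightarrow> complex) \<Rightarrow> complex vec" where
  "state_vec n f = vec (2 ^ n) (\<lambda>k. f (basis_bits n k))"

lemma mult_state_vec:
  assumes "A \<in> carrier_mat (2 ^ n) (2 ^ n)"
  shows "A *\<^sub>v state_vec n f =
    state_vec n (\<lambda>x. \<Sum>y\<in>bits n. A $$ (basis_index x, basis_index y) * f y)"
proof (rule eq_vecI)
  fix k assume "k < dim_vec (state_vec n (\<lambda>x. \<Sum>y\<in>bits n. A $$ (basis_index x, basis_index y) * f y))"
  then have k: "k < 2 ^ n" by (simp add: state_vec_def)
  have "(A *\<^sub>v state_vec n f) $ k = (\<Sum>j<2 ^ n. A $$ (k, j) * f (basis_bits n j))"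
    using assms k by (simp add: state_vec_def scalar_prod_def lessThan_atLeast0)
  also have "\<dots> = (\<Sum>y\<in>bits n. A $$ (k, basis_index y) * f y)"
    using sum.reindex_bij_betw[OF bij_betw_basis_index[of n],
        of "\<lambda>j. A $$ (k, j) * f (basis_bits n j)"]
    by (simp add: bits_def basis_bits_basis_index)
  finally show "(A *\<^sub>v state_vec n f) $ k =
      state_vec n (\<lambda>x. \<Sum>y\<in>bits n. A $$ (basis_index x, basis_index y) * f y) $ k"
    using k by (simp add: state_vec_def basis_index_basis_bits)
qed (use assms in \<open>simp add: state_vec_def\<close>)

lemma state_vec_cong: "(\<And>x. x \<in> bits n \<Longrightarrow> f x = g x) \<Longrightarrow> state_vec n f = state_vec n g"
  unfolding state_vec_def by (rule eq_vecI) (auto simp: bits_def)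

text \<open>The negation reflects that \<open>P\<close> has \<open>cis \<theta>\<close> on the basis
  state 0. The value at \<open>HAll\<close> is a default; the phase is used for diagonal
  gates.\<close>

fun gate_phase :: "real \<Rightarrow> gate \<Rightarrow> bool list \<Rightarrow> complex" where
  "gate_phase \<theta> HAll x = 1"
| "gate_phase \<theta> (PGate i) x = signed_cis \<theta> (\<not> x ! i)"
| "gate_phase \<theta> (ZZGate i j) x = signed_cis \<theta> (x ! i = x ! j)"

lemma gate_mat_carrier: "gate_mat \<theta> n U \<in> carrier_mat (2 ^ n) (2 ^ n)"
  by (cases U) (auto simp: H_tensor_carrier act_on_def)

text \<open>Away from the qubits of the gate, \<open>act_on\<close> forces equal bits; on them the
  small matrix is diagonal. Together these conditions say \<open>x = y\<close>.\<close>

lemma gate_mat_diagonal: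
  assumes "diagonal_gate n U" "x \<in> bits n" "y \<in> bits n"
  shows "gate_mat \<theta> n U $$ (basis_index x, basis_index y) = (if x = y then gate_phase \<theta> U x else 0)"
proof -
  have less: "basis_index x < 2 ^ n" "basis_index y < 2 ^ n"
    using basis_index_less[of x] basis_index_less[of y] assms(2,3) by (auto simp: bits_def)
  have eq: "x = y \<longleftrightarrow> (\<forall>i<n. x ! i = y ! i)"
    using assms(2,3) by (auto simp: bits_def list_eq_iff_nth_eq)
  have bb: "basis_bits n (basis_index x) = x" "basis_bits n (basis_index y) = y"
    using assms(2,3) by (auto simp: bits_def basis_bits_basis_index)
  show ?thesis
  proof (cases U)
    case HAll
    then show ?thesis using assms(1) by simp
  next
    case (PGate i)
    have "x = y \<longleftrightarrow> (\<forall>k<n. k \<noteq> i \<longrightarrow> x ! k = y ! k) \<and> x ! i = y ! i"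
      using assms(1) PGate unfolding eq by auto
    then show ?thesis
      using less PGate
      by (cases "x ! i"; cases "y ! i")
        (auto simp: act_on_def bb P_gate_def mat_diag_def basis_index_Cons signed_cis_def Let_def)
  next
    case (ZZGate i j)
    have "x = y \<longleftrightarrow> (\<forall>k<n. k \<noteq> i \<and> k \<noteq> j \<longrightarrow> x ! k = y ! k) \<and> x ! i = y ! i \<and> x ! j = y ! j"
      using assms(1) ZZGate unfolding eq by auto
    then show ?thesis
      using less ZZGate
      by (cases "x ! i"; cases "y ! i"; cases "x ! j"; cases "y ! j")
        (auto simp: act_on_def bb ZZ_gate_def mat_diag_def basis_index_Cons signed_cis_def Let_def)
  qed
qed

lemma circuit_mat_carrier: "circuit_mat \<theta> n Us \<in> carrier_mat (2 ^ n) (2 ^ n)"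
  unfolding circuit_mat_def
  by (induction Us rule: rev_induct) (auto intro: mult_carrier_mat gate_mat_carrier)

lemma circuit_mat_snoc: "circuit_mat \<theta> n (Us @ [U]) = gate_mat \<theta> n U * circuit_mat \<theta> n Us"
  by (simp add: circuit_mat_def)

lemma circuit_mat_snoc_vec:
  assumes "v \<in> carrier_vec (2 ^ n)"
  shows "circuit_mat \<theta> n (Us @ [U]) *\<^sub>v v = gate_mat \<theta> n U *\<^sub>v (circuit_mat \<theta> n Us *\<^sub>v v)"
  unfolding circuit_mat_snoc
  by (rule assoc_mult_mat_vec[OF gate_mat_carrier circuit_mat_carrier assms])

lemma ket_zero: "ket (replicate n False) = state_vec n (\<lambda>x. if x = replicate n False then 1 else 0)"
proof (rule eq_vecI)
  fix k assume "k < dim_vec (state_vec n (\<lambda>x. if x = replicate n False then 1 else 0))"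
  then have k: "k < 2 ^ n" by (simp add: state_vec_def)
  then have "k = basis_index (replicate n False) \<longleftrightarrow> basis_bits n k = replicate n False"
    using basis_index_basis_bits[OF k] by (auto simp: basis_bits_basis_index)
  then show "ket (replicate n False) $ k =
      state_vec n (\<lambda>x. if x = replicate n False then 1 else 0) $ k"
    using k basis_index_less[of "replicate n False"]
    by (auto simp: ket_eq_unit_vec state_vec_def unit_vec_def)
qed (simp add: ket_eq_unit_vec state_vec_def)

lemma H_state_vec:
  "H_tensor n *\<^sub>v state_vec n f =
    state_vec n (\<lambda>x. complex_of_real (1 / sqrt 2) ^ n * (\<Sum>y\<in>bits n. bit_sign x y * f y))"
  unfolding mult_state_vec[OF H_tensor_carrier]
  by (rule state_vec_cong) (simp add: H_tensor_entry sum_distrib_left mult.assoc)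

lemma diagonal_state_vec:
  assumes "diagonal_gate n U"
  shows "gate_mat \<theta> n U *\<^sub>v state_vec n f = state_vec n (\<lambda>x. gate_phase \<theta> U x * f x)"
  unfolding mult_state_vec[OF gate_mat_carrier]
  by (rule state_vec_cong)
    (simp add: gate_mat_diagonal[OF assms] if_distribR if_distrib[of "\<lambda>a. a * _"] sum.delta cong: if_cong)

definition phase :: "real \<Rightarrow> gate list \<Rightarrow> bool list \<Rightarrow> complex" where
  "phase \<theta> Us x = (\<Prod>U\<leftarrow>Us. gate_phase \<theta> U x)"

text \<open>The first layer sends the zero string to a constant function, since its characters are
  all 1; afterwards diagonal gates only multiply phases.\<close>

lemma iqp_state:
  assumes "\<forall>U\<in>set Ds. diagonal_gate n U"
  shows "circuit_mat \<theta> n ([HAll] @ Ds) *\<^sub>v ket (replicate n False) =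
    state_vec n (\<lambda>x. complex_of_real (1 / sqrt 2) ^ n * phase \<theta> Ds x)"
  using assms
proof (induction Ds rule: rev_induct)
  case Nil
  have "circuit_mat \<theta> n [HAll] *\<^sub>v ket (replicate n False) =
      H_tensor n *\<^sub>v ket (replicate n False)"
    using H_tensor_carrier[of n] by (simp add: circuit_mat_def)
  also have "\<dots> = state_vec n (\<lambda>x. complex_of_real (1 / sqrt 2) ^ n * phase \<theta> [] x)"
    unfolding ket_zero H_state_vec
  proof (rule state_vec_cong)
    fix x assume "x \<in> bits n"
    then have "(\<Sum>y\<in>bits n. bit_sign x y * (if y = replicate n False then 1 else 0)) = 1"
      using sum.delta[OF finite_bits[of n], of "replicate n False" "bit_sign x"]
      by (simp add: bits_def if_distrib cong: if_cong)
    then show "complex_of_real (1 / sqrt 2) ^ n *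
        (\<Sum>y\<in>bits n. bit_sign x y * (if y = replicate n False then 1 else 0)) =
        complex_of_real (1 / sqrt 2) ^ n * phase \<theta> [] x"
      by (simp add: phase_def)
  qed
  finally show ?case by simp
next
  case (snoc U Ds)
  have "ket (replicate n False) \<in> carrier_vec (2 ^ n)"
    by (simp add: ket_eq_unit_vec)
  then have "circuit_mat \<theta> n (([HAll] @ Ds) @ [U]) *\<^sub>v ket (replicate n False) =
      gate_mat \<theta> n U *\<^sub>v state_vec n (\<lambda>x. complex_of_real (1 / sqrt 2) ^ n * phase \<theta> Ds x)"
    using snoc by (simp only: circuit_mat_snoc_vec) simp
  also have "\<dots> = state_vec n (\<lambda>x. complex_of_real (1 / sqrt 2) ^ n * phase \<theta> (Ds @ [U]) x)"
    using snoc.prems by (simp add: diagonal_state_vec phase_def mult_ac)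
  finally show ?case by simp
qed

text \<open>Unnormalised: the two Hadamard layers contribute \<open>1 / 2 ^ n\<close>, which appears
  as \<open>4 ^ n\<close> after squaring the modulus.\<close>

definition amplitude :: "real \<Rightarrow> nat \<Rightarrow> gate list \<Rightarrow> bool list \<Rightarrow> complex" where
  "amplitude \<theta> n Ds y = (\<Sum>x\<in>bits n. bit_sign y x * phase \<theta> Ds x)"

lemma output_prob_eq:
  assumes "\<forall>U\<in>set Ds. diagonal_gate n U" "length y = n"
  shows "output_prob \<theta> n ([HAll] @ Ds @ [HAll]) y = (cmod (amplitude \<theta> n Ds y))\<^sup>2 / 4 ^ n"
proof -
  let ?c = "complex_of_real (1 / sqrt 2) ^ n"
  have k: "ket (replicate n False) \<in> carrier_vec (2 ^ n)"
    by (simp add: ket_eq_unit_vec)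
  have "circuit_mat \<theta> n ([HAll] @ Ds @ [HAll]) *\<^sub>v ket (replicate n False) =
      H_tensor n *\<^sub>v state_vec n (\<lambda>x. ?c * phase \<theta> Ds x)"
    using circuit_mat_snoc_vec[OF k, of \<theta> "[HAll] @ Ds" HAll] iqp_state[OF assms(1)] by simp
  also have "\<dots> = state_vec n (\<lambda>z. ?c * (?c * amplitude \<theta> n Ds z))"
    unfolding H_state_vec amplitude_def
    by (rule state_vec_cong) (simp add: sum_distrib_left mult_ac)
  finally have *: "circuit_mat \<theta> n ([HAll] @ Ds @ [HAll]) *\<^sub>v ket (replicate n False) =
      state_vec n (\<lambda>z. ?c * (?c * amplitude \<theta> n Ds z))" .
  have less: "basis_index y < 2 ^ n" using basis_index_less[of y] assms(2) by simp
  have conj: "conjugate (ket y) = unit_vec (2 ^ n) (basis_index y)"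
    by (rule eq_vecI) (auto simp: ket_eq_unit_vec assms(2) unit_vec_def)
  have "(circuit_mat \<theta> n ([HAll] @ Ds @ [HAll]) *\<^sub>v ket (replicate n False)) \<bullet>c ket y =
      ?c * (?c * amplitude \<theta> n Ds y)"
    unfolding * conj using less assms(2)
    by (subst scalar_prod_right_unit) (auto simp: state_vec_def basis_bits_basis_index)
  also have "\<dots> = complex_of_real ((1 / 2) ^ n) * amplitude \<theta> n Ds y"
    by (simp add: field_simps flip: of_real_mult power_mult_distrib)
  finally show ?thesis
    by (simp add: output_prob_def norm_mult norm_divide norm_power power_divide
        power_even_eq[symmetric] power2_eq_square flip: power_mult_distrib)
qed

section \<open>The Ising partition function as a sum over bit strings\<close>

fun edge_factor :: "real \<Rightarrow> bool list \<Rightarrow> edge \<Rightarrow> complex" where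
  "edge_factor \<alpha> x (u, v, b) = (if x ! u = x ! v then signed_cis \<alpha> b else 1)"

definition field_factor :: "real \<Rightarrow> field list \<Rightarrow> bool list \<Rightarrow> complex" where
  "field_factor \<alpha> fs x = (\<Prod>v<length fs. if x ! v then field_value \<alpha> (fs ! v) else 1)"

definition ising_sum :: "real \<Rightarrow> nat \<Rightarrow> edge list \<Rightarrow> field list \<Rightarrow> complex" where
  "ising_sum \<alpha> n es fs = (\<Sum>x\<in>bits n. (\<Prod>e\<leftarrow>es. edge_factor \<alpha> x e) * field_factor \<alpha> fs x)"

text \<open>Spin 1 corresponds to \<open>True\<close>; extensional functions on the vertices and bit
  strings of length \<open>n\<close> are matched by an explicit bijection.\<close>

lemma ising_value_eq:
  assumes "ising_instance n es fs"
  shows "ising_value \<alpha> n es fs = ising_sum \<alpha> n es fs"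
  unfolding ising_value_def Z_Ising_def ising_sum_def
proof (rule sum.reindex_bij_witness[where j = "\<lambda>\<sigma>. map (\<lambda>v. \<sigma> v = 1) [0..<n]" and
      i = "\<lambda>x. \<lambda>v\<in>{..<n}. of_bool (x ! v)"])
  fix \<sigma> :: "nat \<Rightarrow> nat" assume \<sigma>: "\<sigma> \<in> {..<n} \<rightarrow>\<^sub>E {0, 1}"
  let ?x = "map (\<lambda>v. \<sigma> v = 1) [0..<n]"
  have 01: "\<sigma> v = of_bool (?x ! v)" if "v < n" for v
    using PiE_mem[OF \<sigma>, of v] that by auto
  show "(\<lambda>v\<in>{..<n}. of_bool (?x ! v)) = \<sigma>"
    using 01 \<sigma> by (auto simp: restrict_def PiE_def extensional_def)
  show "?x \<in> bits n" by (simp add: bits_def)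
  have "edge_factor \<alpha> ?x e = edge_weight \<alpha> e ^ of_bool (\<sigma> (fst (edge_ends e)) = \<sigma> (snd (edge_ends e)))"
    if "e \<in> set es" for e
  proof -
    obtain u v b where e: "e = (u, v, b)" by (cases e)
    with that assms have "u < n" "v < n" by (auto simp: ising_instance_def)
    then show ?thesis using 01[of u] 01[of v] e by auto
  qed
  then have "(\<Prod>e\<leftarrow>es. edge_factor \<alpha> ?x e) = (\<Prod>e\<leftarrow>es. edge_weight \<alpha> e ^
      of_bool (\<sigma> (fst (edge_ends e)) = \<sigma> (snd (edge_ends e))))"
    by (intro arg_cong[where f = prod_list] map_cong) auto
  also have "\<dots> = (\<Prod>e<length es. edge_weight \<alpha> (es ! e) ^
      of_bool (\<sigma> (fst (edge_ends (es ! e))) = \<sigma> (snd (edge_ends (es ! e)))))"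
    by (subst prod.list_conv_set_nth) (simp add: lessThan_atLeast0)
  moreover have "field_factor \<alpha> fs ?x = (\<Prod>v<n. field_value \<alpha> (fs ! v) ^ \<sigma> v)"
    unfolding field_factor_def
  proof (rule prod.cong)
    fix v assume "v \<in> {..<n}"
    then have "\<sigma> v = of_bool (?x ! v)" using 01 by blast
    then show "(if ?x ! v then field_value \<alpha> (fs ! v) else 1) = field_value \<alpha> (fs ! v) ^ \<sigma> v"
      by (cases "?x ! v") (auto simp only: if_True if_False of_bool_eq power_0 power_one_right)
  qed (use assms in \<open>simp add: ising_instance_def\<close>)
  ultimately show "(\<Prod>e\<leftarrow>es. edge_factor \<alpha> ?x e) * field_factor \<alpha> fs ?x =
     (\<Prod>e<length es. edge_weight \<alpha> (es ! e) ^
       of_bool (\<sigma> (fst (edge_ends (es ! e))) = \<sigma> (snd (edge_ends (es ! e))))) *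
     (\<Prod>v<n. field_value \<alpha> (fs ! v) ^ \<sigma> v)"
    by simp
next
  fix x assume "x \<in> bits n"
  then show "map (\<lambda>v. (\<lambda>v\<in>{..<n}. of_bool (x ! v) :: nat) v = 1) [0..<n] = x"
    by (intro nth_equalityI) (auto simp: bits_def)
  show "(\<lambda>v\<in>{..<n}. of_bool (x ! v)) \<in> {..<n} \<rightarrow>\<^sub>E {0, 1::nat}"
    by auto
qed

lemma prod_lessThan_add:
  fixes m n :: nat
  shows "(\<Prod>i<m + n. f i) = (\<Prod>i<m. f i) * (\<Prod>i<n. f (m + i) :: 'a :: comm_monoid_mult)"
  by (induction n) (simp_all add: mult.assoc)

section \<open>From Ising instances to IQP circuits\<close>

text \<open>A self-loop contributes the same factor of modulus 1 to every configuration and yields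
  no gate; a \<open>ZZ\<close> gate would also need two different qubits. The interaction with
  negative angle is the inverse gate, written as the power \<open>k - 1\<close>.\<close>

fun edge_gates :: "nat \<Rightarrow> edge \<Rightarrow> gate list" where
  "edge_gates k (u, v, b) = (if u = v then [] else replicate (if b then 1 else k - 1) (ZZGate u v))"

text \<open>A \<open>P\<close> gate changes the weight of bit 1 relative to bit 0 by
  \<open>cis (- 2 * \<theta>)\<close>, so \<open>s = False\<close> is the direct case and
  \<open>s = True\<close> uses inverses. Reduction modulo \<open>k\<close> keeps the number of gates
  bounded, as \<open>b\<close> is given in binary.\<close>

fun field_gates :: "nat \<Rightarrow> nat \<Rightarrow> field \<Rightarrow> gate list" where
  "field_gates k v (a, s, b) = replicate ((if s then b * (k - 1) else b) mod k) (PGate v)"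

section \<open>Gate phases compared with Ising factors\<close>

lemma phase_append: "phase \<theta> (Us @ Vs) x = phase \<theta> Us x * phase \<theta> Vs x"
  by (simp add: phase_def)

lemma phase_concat: "phase \<theta> (concat Uss) x = (\<Prod>Us\<leftarrow>Uss. phase \<theta> Us x)"
  by (induction Uss) (simp_all add: phase_append, simp add: phase_def)

lemma phase_concat_rev: "phase \<theta> (concat (rev Uss)) x = phase \<theta> (concat Uss) x"
  by (simp add: phase_concat prod_list.rev flip: rev_map)

lemma phase_replicate: "phase \<theta> (replicate k U) x = gate_phase \<theta> U x ^ k"
  by (simp add: phase_def)

lemma signed_cis_power:
  assumes "cis \<theta> ^ k = 1" "k > 0"
  shows "signed_cis \<theta> b ^ (k - 1) = signed_cis \<theta> (\<not> b)" "signed_cis \<theta> b ^ k = 1"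
proof -
  show *: "signed_cis \<theta> b ^ k = 1" for b
  proof (cases b)
    case False
    have "cis (- \<theta>) ^ k = inverse (cis \<theta> ^ k)" by (simp add: cis_inverse flip: power_inverse)
    then show ?thesis using assms False by (simp add: signed_cis_def)
  qed (simp add: signed_cis_def assms)
  have "signed_cis \<theta> b ^ (k - 1) * signed_cis \<theta> b * signed_cis \<theta> (\<not> b) = signed_cis \<theta> (\<not> b)"
    unfolding power_minus_mult[OF assms(2)] by (simp add: *)
  moreover have "signed_cis \<theta> b * signed_cis \<theta> (\<not> b) = 1"
    by (simp add: signed_cis_def cis_mult)
  ultimately show "signed_cis \<theta> b ^ (k - 1) = signed_cis \<theta> (\<not> b)"
    by (simp add: mult.assoc)
qed

lemma power_mod_order: "z ^ k = 1 \<Longrightarrow> z ^ (j mod k) = (z :: 'a :: monoid_mult) ^ j"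
  by (metis mult_div_mod_eq power_add power_mult power_one mult_1)

lemma norm_signed_cis [simp]: "cmod (signed_cis \<theta> b) = 1"
  by (simp add: signed_cis_def)

lemma signed_cis_double: "signed_cis (2 * \<theta>) b = signed_cis \<theta> b * signed_cis \<theta> b"
  by (simp add: signed_cis_def cis_mult)

lemma signed_cis_inverse: "signed_cis \<theta> b * signed_cis \<theta> (\<not> b) = 1"
  by (simp add: signed_cis_def cis_mult)

text \<open>\<open>cis \<theta>\<close> on equal and \<open>cis (- \<theta>)\<close> on different
  ends is \<open>cis (- \<theta>)\<close> times the Ising factor with interaction
  \<open>cis (2 * \<theta>)\<close>. The constant does not depend on \<open>x\<close>, so it is
  invisible in the modulus of the sum.\<close>

lemma edge_gates_phase:
  assumes "cis \<theta> ^ k = 1" "k > 0"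
  obtains c where "cmod c = 1" "\<And>x. phase \<theta> (edge_gates k e) x = c * edge_factor (2 * \<theta>) x e"
proof -
  obtain u v b where e: "e = (u, v, b)" by (cases e)
  show thesis
  proof (cases "u = v")
    case True
    have "phase \<theta> (edge_gates k e) x = signed_cis (2 * \<theta>) (\<not> b) * edge_factor (2 * \<theta>) x e" for x
      using signed_cis_inverse[of "2 * \<theta>" b] True by (simp add: e phase_def mult.commute)
    then show thesis by (rule that[rotated]) simp
  next
    case False
    have "phase \<theta> (edge_gates k e) x = signed_cis \<theta> (if b then x ! u = x ! v else x ! u \<noteq> x ! v)" for x
      using False signed_cis_power(1)[OF assms, of "x ! u = x ! v"]
      by (simp add: e phase_replicate)
    then have "phase \<theta> (edge_gates k e) x = signed_cis \<theta> (\<not> b) * edge_factor (2 * \<theta>) x e" for x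
      by (cases b) (auto simp: e signed_cis_def cis_mult simp del: edge_gates.simps)
    then show thesis by (rule that[rotated]) simp
  qed
qed

text \<open>The constant is the phase at bit 0, and the quotient of the phases at bits 1 and 0 has
  angle \<open>2 * \<theta>\<close>. The sign \<open>(-1) ^ a\<close> is realised by the outcome bit
  \<open>odd a\<close> and not by a gate.\<close>

lemma field_gates_phase:
  assumes "cis \<theta> ^ k = 1" "k > 0"
  obtains c where "cmod c = 1" "\<And>x. (if odd a \<and> x ! v then -1 else 1) *
    phase \<theta> (field_gates k v (a, s, b)) x = c * (if x ! v then field_value (2 * \<theta>) (a, s, b) else 1)"
proof -
  have *: "phase \<theta> (field_gates k v (a, s, b)) x = signed_cis \<theta> (s = x ! v) ^ b" for x
  proof -
    have "phase \<theta> (field_gates k v (a, s, b)) x =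
        signed_cis \<theta> (\<not> x ! v) ^ (if s then (k - 1) * b else b)"
      using signed_cis_power(2)[OF assms, of "\<not> x ! v"]
      by (simp add: phase_replicate power_mod_order mult.commute)
    also have "\<dots> = signed_cis \<theta> (s = x ! v) ^ b"
      using signed_cis_power(1)[OF assms, of "\<not> x ! v"] by (simp add: power_mult)
    finally show ?thesis .
  qed
  have "signed_cis \<theta> (\<not> s) ^ b * signed_cis \<theta> s ^ b = 1"
    using signed_cis_inverse[of \<theta> s] by (simp add: mult.commute flip: power_mult_distrib)
  then have ***: "signed_cis \<theta> (\<not> s) ^ b * (signed_cis \<theta> s ^ b * z) = z" for z
    by (simp flip: mult.assoc)
  have "(if odd a \<and> x ! v then -1 else 1) * phase \<theta> (field_gates k v (a, s, b)) x =
      signed_cis \<theta> (\<not> s) ^ b * (if x ! v then field_value (2 * \<theta>) (a, s, b) else 1)" for x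
  proof (cases "x ! v")
    case True
    have "signed_cis \<theta> (\<not> s) ^ b * ((-1) ^ a * (signed_cis \<theta> s ^ b * signed_cis \<theta> s ^ b)) =
        (-1) ^ a * signed_cis \<theta> s ^ b"
      by (simp only: mult.left_commute[of _ "(-1) ^ a"] ***)
    moreover have "(if odd a then -1 else 1) = (-1 :: complex) ^ a" by simp
    ultimately show ?thesis
      unfolding * using True by (simp add: signed_cis_double power_mult_distrib)
  qed (auto simp only: * if_False simp_thms mult_1_left mult_1_right)
  then show thesis by (rule that[rotated]) (simp add: norm_power)
qed

text \<open>Collects the constants of the single factors into one that is still independent of the
  configuration \<open>x\<close> and can be pulled out of the sum.\<close>

lemma prod_list_phase:
  assumes "\<And>a. a \<in> set as \<Longrightarrow> \<exists>c. cmod c = 1 \<and> (\<forall>x. f a x = c * g a x)"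
  shows "\<exists>c. cmod c = 1 \<and> (\<forall>x. (\<Prod>a\<leftarrow>as. f a x) = c * (\<Prod>a\<leftarrow>as. g a x))"
  using assms
proof (induction as)
  case Nil
  show ?case by (intro exI[of _ 1]) simp
next
  case (Cons a as)
  obtain c where c: "cmod c = 1" "\<And>x. f a x = c * g a x" using Cons.prems by force
  obtain d where d: "cmod d = 1" "\<And>x. (\<Prod>a\<leftarrow>as. f a x) = d * (\<Prod>a\<leftarrow>as. g a x)"
    using Cons by force
  show ?case using c d by (intro exI[of _ "c * d"]) (simp add: norm_mult mult_ac)
qed

lemma prod_list_upt: "(\<Prod>v\<leftarrow>[0..<n]. f v) = (\<Prod>v<n. f v :: 'a :: comm_monoid_mult)"
  by (induction n) simp_all

definition ising_gates :: "nat \<Rightarrow> edge list \<Rightarrow> field list \<Rightarrow> gate list" where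
  "ising_gates k es fs = concat (rev (map (edge_gates k) es)) @
     concat (rev (map (\<lambda>v. field_gates k v (fs ! v)) [0..<length fs]))"

lemma diagonal_ising_gates:
  assumes "ising_instance n es fs"
  shows "\<forall>U\<in>set (ising_gates k es fs). diagonal_gate n U"
proof
  fix U assume "U \<in> set (ising_gates k es fs)"
  then consider e where "e \<in> set es" "U \<in> set (edge_gates k e)"
    | v where "v < length fs" "U \<in> set (field_gates k v (fs ! v))"
    by (auto simp: ising_gates_def)
  then show "diagonal_gate n U"
  proof cases
    case (1 e)
    moreover have "fst (edge_ends e) < n" "snd (edge_ends e) < n"
      using assms 1(1) by (auto simp: ising_instance_def)
    moreover obtain u w b where "e = (u, w, b)" by (rule prod_cases3)
    ultimately show ?thesis by (auto split: if_splits)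
  next
    case (2 v)
    then show ?thesis using assms
      by (cases "fs ! v") (auto simp: ising_instance_def)
  qed
qed

lemma amplitude_ising_gates:
  assumes "cis \<theta> ^ k = 1" "k > 0"
  shows "cmod (amplitude \<theta> (length fs) (ising_gates k es fs) (map (\<lambda>f. odd (fst f)) fs)) =
    cmod (ising_sum (2 * \<theta>) (length fs) es fs)"
proof -
  let ?n = "length fs" and ?y = "map (\<lambda>f. odd (fst f)) fs"
  let ?\<epsilon> = "\<lambda>v x. if ?y ! v \<and> x ! v then -1 else 1 :: complex"
  have "\<exists>c. cmod c = 1 \<and> (\<forall>x. (\<Prod>e\<leftarrow>es. phase \<theta> (edge_gates k e) x) =
      c * (\<Prod>e\<leftarrow>es. edge_factor (2 * \<theta>) x e))"
    by (rule prod_list_phase) (meson edge_gates_phase[OF assms])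
  then obtain c where c: "cmod c = 1" "\<And>x. (\<Prod>e\<leftarrow>es. phase \<theta> (edge_gates k e) x) =
      c * (\<Prod>e\<leftarrow>es. edge_factor (2 * \<theta>) x e)" by blast
  have "\<exists>d. cmod d = 1 \<and> (\<forall>x. (\<Prod>v\<leftarrow>[0..<?n]. ?\<epsilon> v x * phase \<theta> (field_gates k v (fs ! v)) x) =
      d * (\<Prod>v\<leftarrow>[0..<?n]. if x ! v then field_value (2 * \<theta>) (fs ! v) else 1))"
  proof (rule prod_list_phase)
    fix v assume "v \<in> set [0..<?n]"
    obtain a s b where f: "fs ! v = (a, s, b)" by (cases "fs ! v")
    with \<open>v \<in> set [0..<?n]\<close> have y: "?y ! v = odd a" by simp
    obtain c where "cmod c = 1" "\<And>x. (if odd a \<and> x ! v then -1 else 1) *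
        phase \<theta> (field_gates k v (a, s, b)) x =
        c * (if x ! v then field_value (2 * \<theta>) (a, s, b) else 1)"
      using field_gates_phase[OF assms] by blast
    then show "\<exists>c. cmod c = 1 \<and> (\<forall>x. ?\<epsilon> v x * phase \<theta> (field_gates k v (fs ! v)) x =
        c * (if x ! v then field_value (2 * \<theta>) (fs ! v) else 1))"
      unfolding f y by (intro exI[of _ c]) blast
  qed
  then obtain d where d: "cmod d = 1"
    "\<And>x. (\<Prod>v<?n. ?\<epsilon> v x * phase \<theta> (field_gates k v (fs ! v)) x) =
      d * (\<Prod>v<?n. if x ! v then field_value (2 * \<theta>) (fs ! v) else 1)"
    unfolding prod_list_upt by blast
  have "bit_sign ?y x * phase \<theta> (ising_gates k es fs) x =
      c * d * ((\<Prod>e\<leftarrow>es. edge_factor (2 * \<theta>) x e) * field_factor (2 * \<theta>) fs x)" for x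
  proof -
    have "bit_sign ?y x * phase \<theta> (ising_gates k es fs) x =
        (\<Prod>e\<leftarrow>es. phase \<theta> (edge_gates k e) x) *
        (\<Prod>v<?n. ?\<epsilon> v x * phase \<theta> (field_gates k v (fs ! v)) x)"
      unfolding ising_gates_def phase_append phase_concat_rev
      by (simp add: phase_concat bit_sign_def prod.distrib o_def prod_list_upt del: upt_Suc)
    then show ?thesis unfolding c d field_factor_def by (simp only: mult_ac)
  qed
  then have "amplitude \<theta> ?n (ising_gates k es fs) ?y = c * d * ising_sum (2 * \<theta>) ?n es fs"
    by (simp add: amplitude_def ising_sum_def sum_distrib_left)
  then show ?thesis by (simp add: norm_mult c d)
qed

lemma marginal_prob_full:
  assumes "length y = n"
  shows "marginal_prob \<theta> n Us {..<n} y = output_prob \<theta> n Us y"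
proof -
  have "{z. length z = n \<and> nths z {..<n} = y} = {y}"
    using assms by (auto simp: nths_all)
  then show ?thesis by (simp add: marginal_prob_def)
qed

lemma ising_to_iqp:
  assumes "ising_instance n es fs" "cis \<theta> ^ k = 1" "k > 0"
  shows "(cmod (ising_value (2 * \<theta>) n es fs))\<^sup>2 = 4 ^ n *
    marginal_prob \<theta> n ([HAll] @ ising_gates k es fs @ [HAll]) {..<n} (map (\<lambda>f. odd (fst f)) fs)"
proof -
  have n: "length fs = n" using assms(1) by (simp add: ising_instance_def)
  show ?thesis
    using amplitude_ising_gates[OF assms(2,3), of fs es] ising_value_eq[OF assms(1)]
      output_prob_eq[OF diagonal_ising_gates[OF assms(1)]]
    by (simp add: marginal_prob_full n)
qed

section \<open>From IQP circuits to Ising instances\<close>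

text \<open>An outcome lists the measured bits only; here they are moved to the positions of their
  qubits. With \<open>False\<close> elsewhere, \<open>bit_sign\<close> of the result ignores the
  unmeasured qubits. The clause for an exhausted \<open>y\<close> is a default.\<close>

fun expand :: "bool list \<Rightarrow> bool list \<Rightarrow> bool list" where
  "expand [] y = []"
| "expand (False # m) y = False # expand m y"
| "expand (True # m) [] = False # expand m []"
| "expand (True # m) (b # y) = b # expand m y"

lemma length_expand [simp]: "length (expand m y) = length m"
  by (induction m y rule: expand.induct) auto

lemma expand_unmasked: "i < length m \<Longrightarrow> \<not> m ! i \<Longrightarrow> \<not> expand m y ! i"
  by (induction m y arbitrary: i rule: expand.induct) (auto simp: nth_Cons split: nat.splits)

lemma nths_eq_iff_expand:
  "length y = count_list m True \<Longrightarrow> length z = length m \<Longrightarrow>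
    nths z {i. i < length m \<and> m ! i} = y \<longleftrightarrow> (\<forall>i<length m. m ! i \<longrightarrow> z ! i = expand m y ! i)"
proof (induction m y arbitrary: z rule: expand.induct)
  case (2 m y)
  then obtain c z' where z: "z = c # z'" "length z' = length m" by (cases z) auto
  show ?case using 2 z by (simp add: nths_Cons All_less_Suc2)
next
  case (4 m b y)
  then obtain c z' where z: "z = c # z'" "length z' = length m" by (cases z) auto
  show ?case using 4 z by (simp add: nths_Cons All_less_Suc2)
qed auto

text \<open>Distributivity: a sum over independent bits of a product of local factors is the product
  of the local sums.\<close>

lemma sum_bits_prod:
  "(\<Sum>z\<in>bits n. \<Prod>i<n. h i (z ! i)) = (\<Prod>i<n. h i False + h i True :: 'a :: comm_semiring_1)"
proof (induction n arbitrary: h)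
  case (Suc n)
  show ?case using Suc[of "\<lambda>i. h (Suc i)"]
    by (simp add: sum_bits_Suc prod.lessThan_Suc_shift distrib_right flip: sum_distrib_left
        del: prod.lessThan_Suc)
qed simp

text \<open>Every summation over the unmeasured bits of an outcome, and over the copies of the unmeasured
  qubits, leaves this weight on a pair of bit strings.\<close>

definition glue :: "bool list \<Rightarrow> bool list \<Rightarrow> bool list \<Rightarrow> complex" where
  "glue m x x' = (\<Prod>i<length m. if m ! i then 1 else if x ! i = x' ! i then 2 else 0)"

text \<open>The second configuration as the edges see it: own spins for measured qubits, the spins
  of the first copy for the others.\<close>

definition mix :: "bool list \<Rightarrow> bool list \<Rightarrow> bool list \<Rightarrow> bool list" where
  "mix m x x' = map (\<lambda>i. if m ! i then x' ! i else x ! i) [0..<length m]"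

lemma nth_mix: "i < length m \<Longrightarrow> mix m x x' ! i = (if m ! i then x' ! i else x ! i)"
  by (simp add: mix_def)

lemma mix_Cons: "mix (b # m) (c # x) (d # x') = (if b then d else c) # mix m x x'"
  by (simp add: mix_def map_upt_Suc del: upt_Suc)

lemma glue_Cons: "glue (b # m) (c # x) (d # x') =
    (if b then 1 else if c = d then 2 else 0) * glue m x x'"
  by (simp add: glue_def prod.lessThan_Suc_shift del: prod.lessThan_Suc cong: if_cong)

text \<open>At an unmeasured position the bit of \<open>x'\<close> is free but \<open>mix\<close>
  ignores it: this gives the factor 2 and forces agreement with \<open>x\<close>, just as
  \<open>glue\<close> prescribes.\<close>

lemma sum_mix:
  assumes "length x = length m"
  shows "(\<Sum>x'\<in>bits (length m). f (mix m x x')) = (\<Sum>x'\<in>bits (length m). f x' * glue m x x')"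
  using assms
proof (induction m arbitrary: x f)
  case Nil
  then show ?case by (simp add: mix_def glue_def)
next
  case (Cons b m)
  then obtain c y where x: "x = c # y" "length y = length m" by (cases x) auto
  show ?case
    using Cons.IH[OF x(2), of "\<lambda>z. f (False # z)"] Cons.IH[OF x(2), of "\<lambda>z. f (True # z)"]
    by (cases b; cases c) (simp_all add: x(1) sum_bits_Suc mix_Cons glue_Cons
        mult.left_commute[of _ 2] flip: sum_distrib_left)
qed

text \<open>A measured position fixes the bit of \<open>z\<close>. At an unmeasured one, the sum of
  1 and the product of the signs of \<open>x\<close> and \<open>x'\<close> is 2 if these bits agree
  and 0 otherwise: orthogonality of characters.\<close>

lemma sum_signs:
  assumes "length y = length m" "\<And>i. i < length m \<Longrightarrow> \<not> m ! i \<Longrightarrow> \<not> y ! i"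
  shows "(\<Sum>z\<in>bits (length m). (if \<forall>i<length m. m ! i \<longrightarrow> z ! i = y ! i then 1 else 0) *
      (bit_sign z x * bit_sign z x')) = bit_sign y x * bit_sign y x' * glue m x x'"
proof -
  let ?n = "length m" and ?s = "\<lambda>b i. if b \<and> x ! i then -1 else 1 :: complex"
    and ?s' = "\<lambda>b i. if b \<and> x' ! i then -1 else 1 :: complex"
  let ?h = "\<lambda>i b. (if m ! i \<longrightarrow> b = y ! i then 1 else 0) * (?s b i * ?s' b i)"
  have "(if \<forall>i<?n. m ! i \<longrightarrow> z ! i = y ! i then 1 else 0) * (bit_sign z x * bit_sign z x') =
      (\<Prod>i<?n. ?h i (z ! i))" if "z \<in> bits ?n" for z
  proof -
    have "(if \<forall>i<?n. m ! i \<longrightarrow> z ! i = y ! i then 1 else 0) =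
        (\<Prod>i<?n. if m ! i \<longrightarrow> z ! i = y ! i then 1 else 0 :: complex)"
      by (auto intro!: prod.neutral[symmetric] prod_zero[symmetric])
    then show ?thesis using that by (simp only: prod.distrib bit_sign_def) (simp add: bits_def)
  qed
  then have "(\<Sum>z\<in>bits ?n. (if \<forall>i<?n. m ! i \<longrightarrow> z ! i = y ! i then 1 else 0) *
      (bit_sign z x * bit_sign z x')) = (\<Prod>i<?n. ?h i False + ?h i True)"
    using sum_bits_prod[of ?h ?n] by (simp only: cong: sum.cong)
  also have "\<dots> = (\<Prod>i<?n. ?s (y ! i) i * ?s' (y ! i) i *
      (if m ! i then 1 else if x ! i = x' ! i then 2 else 0))"
  proof (rule prod.cong)
    fix i assume "i \<in> {..<?n}"
    then show "?h i False + ?h i True = ?s (y ! i) i * ?s' (y ! i) i *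
        (if m ! i then 1 else if x ! i = x' ! i then 2 else 0)"
      using assms(2)[of i] by (cases "m ! i"; cases "y ! i") auto
  qed simp
  also have "\<dots> = bit_sign y x * bit_sign y x' * glue m x x'"
    by (simp only: prod.distrib bit_sign_def glue_def assms(1))
  finally show ?thesis .
qed

definition double_sum :: "real \<Rightarrow> gate list \<Rightarrow> bool list \<Rightarrow> bool list \<Rightarrow> complex" where
  "double_sum \<theta> Ds m y = (\<Sum>x\<in>bits (length m). \<Sum>x'\<in>bits (length m).
     phase \<theta> Ds x * cnj (phase \<theta> Ds x') * (bit_sign y x * bit_sign y x' * glue m x x'))"

lemma marginal_prob_eq:
  assumes "\<forall>U\<in>set Ds. diagonal_gate n U" "length m = n" "length y = count_list m True"
  shows "4 ^ n * complex_of_real (marginal_prob \<theta> n ([HAll] @ Ds @ [HAll])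
    {i. i < n \<and> m ! i} y) = double_sum \<theta> Ds m (expand m y)"
proof -
  let ?Y = "expand m y" and ?p = "\<lambda>z. phase \<theta> Ds z"
  let ?c = "\<lambda>z. if \<forall>i<n. m ! i \<longrightarrow> z ! i = ?Y ! i then 1 else 0 :: complex"
  have set: "{z. length z = n \<and> nths z {i. i < n \<and> m ! i} = y} =
      {z \<in> bits n. \<forall>i<n. m ! i \<longrightarrow> z ! i = ?Y ! i}"
    using nths_eq_iff_expand[OF assms(3)] assms(2) by (auto simp: bits_def)
  have "4 ^ n * complex_of_real (marginal_prob \<theta> n ([HAll] @ Ds @ [HAll]) {i. i < n \<and> m ! i} y) =
      (\<Sum>z | z \<in> bits n \<and> (\<forall>i<n. m ! i \<longrightarrow> z ! i = ?Y ! i).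
        complex_of_real ((cmod (amplitude \<theta> n Ds z))\<^sup>2))"
    unfolding marginal_prob_def set of_real_sum sum_distrib_left
    by (rule sum.cong) (use output_prob_eq[OF assms(1)] in \<open>auto simp: bits_def\<close>)
  also have "\<dots> = (\<Sum>z\<in>bits n. ?c z * (amplitude \<theta> n Ds z * cnj (amplitude \<theta> n Ds z)))"
    by (rule sum.mono_neutral_cong_left) (auto simp: complex_norm_square simp del: of_real_power)
  also have "\<dots> = (\<Sum>z\<in>bits n. \<Sum>x\<in>bits n. \<Sum>x'\<in>bits n.
      ?p x * cnj (?p x') * (?c z * (bit_sign z x * bit_sign z x')))"
  proof (rule sum.cong[OF refl])
    fix z
    have amp: "amplitude \<theta> n Ds z * cnj (amplitude \<theta> n Ds z) =
        (\<Sum>x\<in>bits n. \<Sum>x'\<in>bits n. bit_sign z x * ?p x * (bit_sign z x' * cnj (?p x')))"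
      by (simp only: amplitude_def cnj_sum sum_product complex_cnj_mult cnj_bit_sign)
    show "?c z * (amplitude \<theta> n Ds z * cnj (amplitude \<theta> n Ds z)) =
        (\<Sum>x\<in>bits n. \<Sum>x'\<in>bits n. ?p x * cnj (?p x') * (?c z * (bit_sign z x * bit_sign z x')))"
      unfolding amp sum_distrib_left by (intro sum.cong refl) (simp only: mult_ac)
  qed
  \<comment> \<open>The outcome is summed innermost, so that orthogonality can be applied for each
    fixed pair \<open>x\<close>, \<open>x'\<close>.\<close>
  also have "\<dots> = (\<Sum>x\<in>bits n. \<Sum>x'\<in>bits n. \<Sum>z\<in>bits n.
      ?p x * cnj (?p x') * (?c z * (bit_sign z x * bit_sign z x')))"
    by (subst sum.swap, rule sum.cong[OF refl], rule sum.swap)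
  also have "\<dots> = double_sum \<theta> Ds m ?Y"
    unfolding double_sum_def
    using sum_signs[of ?Y m] expand_unmasked[of _ m y] assms(2)
    by (simp flip: sum_distrib_left)
  finally show ?thesis .
qed

text \<open>A gate \<open>P\<close> on qubit \<open>i\<close> acts like \<open>ZZ\<close> on \<open>i\<close> and an ancilla in state \<open>0\<close>; the ancilla
  gets the number \<open>n\<close>.\<close>

fun gate_ends :: "nat \<Rightarrow> gate \<Rightarrow> nat \<times> nat" where
  "gate_ends n HAll = (n, n)"
| "gate_ends n (PGate i) = (i, n)"
| "gate_ends n (ZZGate i j) = (i, j)"

text \<open>Numbers up to \<open>length m\<close> are the first copy, with the ancilla last; the
  second copy starts at \<open>Suc (length m)\<close>. Unmeasured qubits and the ancilla are their
  own copies.\<close>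

definition copy_vertex :: "bool list \<Rightarrow> nat \<Rightarrow> nat" where
  "copy_vertex m i = (if i < length m \<and> m ! i then Suc (length m) + i else i)"

text \<open>The edge in the second copy produces the conjugate phase, hence the opposite
  interaction.\<close>

definition circuit_edges :: "bool list \<Rightarrow> gate \<Rightarrow> edge list" where
  "circuit_edges m U = (case gate_ends (length m) U of (i, j) \<Rightarrow>
     [(copy_vertex m i, copy_vertex m j, False), (i, j, True)])"

text \<open>With exponent 0 the fields are pure signs, given by the outcome bits; the ancilla has
  field 1.\<close>

definition circuit_fields :: "bool list \<Rightarrow> bool list \<Rightarrow> field list" where
  "circuit_fields m y = map (\<lambda>b. (of_bool b, False, 0)) (expand m y @ [False])"

text \<open>The phase with the ancilla as an extra last bit. It depends only on which spins are
  equal, which is the source of the invariance under a global flip.\<close>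

definition pair_phase :: "real \<Rightarrow> nat \<Rightarrow> gate list \<Rightarrow> bool list \<Rightarrow> complex" where
  "pair_phase \<theta> n Ds x = (\<Prod>U\<leftarrow>Ds. case gate_ends n U of (i, j) \<Rightarrow> signed_cis \<theta> (x ! i = x ! j))"

section \<open>The ancilla and the global spin flip\<close>

lemma pair_phase_snoc_False:
  assumes "\<forall>U\<in>set Ds. diagonal_gate n U" "length x = n"
  shows "pair_phase \<theta> n Ds (x @ [False]) = phase \<theta> Ds x"
  unfolding pair_phase_def phase_def
proof (intro arg_cong[where f = prod_list] map_cong refl)
  fix U assume "U \<in> set Ds"
  with assms(1) have "diagonal_gate n U" by blast
  then show "(case gate_ends n U of (i, j) \<Rightarrow> signed_cis \<theta> ((x @ [False]) ! i = (x @ [False]) ! j)) =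
      gate_phase \<theta> U x"
    using assms(2) by (cases U) (auto simp: nth_append)
qed

lemma pair_phase_map_Not:
  assumes "\<forall>U\<in>set Ds. diagonal_gate n U" "length x = Suc n"
  shows "pair_phase \<theta> n Ds (map Not x) = pair_phase \<theta> n Ds x"
  unfolding pair_phase_def
proof (intro arg_cong[where f = prod_list] map_cong refl)
  fix U assume "U \<in> set Ds"
  with assms(1) have "diagonal_gate n U" by blast
  then show "(case gate_ends n U of (i, j) \<Rightarrow> signed_cis \<theta> (map Not x ! i = map Not x ! j)) =
      (case gate_ends n U of (i, j) \<Rightarrow> signed_cis \<theta> (x ! i = x ! j))"
    using assms(2) by (cases U) auto
qed

lemma sum_bits_map_Not: "(\<Sum>x\<in>bits n. f (map Not x)) = (\<Sum>x\<in>bits n. f x)"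
  by (rule sum.reindex_bij_witness[where i = "map Not" and j = "map Not"])
    (auto simp: bits_def o_def)

text \<open>\<open>bit_sign y y\<close> is the parity of \<open>y\<close>. In a product over the two
  copies it occurs squared and disappears.\<close>

lemma bit_sign_map_Not:
  assumes "length x = length y"
  shows "bit_sign y (map Not x) = bit_sign y y * bit_sign y x"
  unfolding bit_sign_def prod.distrib[symmetric] using assms by (intro prod.cong) auto

lemma bit_sign_square: "bit_sign y y * bit_sign y y = 1"
  unfolding bit_sign_def prod.distrib[symmetric] by (intro prod.neutral) auto

lemma glue_map_Not:
  assumes "length x = length m" "length x' = length m"
  shows "glue m (map Not x) (map Not x') = glue m x x'"
  unfolding glue_def using assms by (intro prod.cong) auto

lemma bit_sign_snoc: "length x = length y \<Longrightarrow> bit_sign (y @ [False]) (x @ [b]) = bit_sign y x"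
  by (simp add: bit_sign_def nth_append)

text \<open>The ancilla behaves like an unmeasured qubit: shared by both copies, with an isolated
  second vertex that contributes 2.\<close>

lemma glue_snoc:
  assumes "length x = length m" "length x' = length m"
  shows "glue (m @ [False]) (x @ [b]) (x' @ [c]) = (if b = c then 2 else 0) * glue m x x'"
  using assms by (simp add: glue_def nth_append cong: if_cong)

lemma field_factor_circuit_fields:
  assumes "length x = Suc (length m)" "length x' = Suc (length m)"
  shows "field_factor \<alpha> (circuit_fields m y @ circuit_fields m y) (x @ x') =
    bit_sign (expand m y @ [False]) x * bit_sign (expand m y @ [False]) x'"
proof -
  define n where "n = Suc (length m)"
  define Y where "Y = expand m y @ [False]"
  have l: "length (circuit_fields m y) = n" "length Y = n"
    by (simp_all add: circuit_fields_def n_def Y_def)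
  have f: "field_value \<alpha> (circuit_fields m y ! v) = (if Y ! v then -1 else 1)" if "v < n" for v
  proof -
    have "circuit_fields m y ! v = (of_bool (Y ! v), False, 0)"
      unfolding circuit_fields_def Y_def[symmetric] using that l by simp
    then show ?thesis by simp
  qed
  have "(\<Prod>v<n. if (x @ x') ! v
      then field_value \<alpha> ((circuit_fields m y @ circuit_fields m y) ! v) else 1) = bit_sign Y x"
    unfolding bit_sign_def l by (rule prod.cong) (use assms in \<open>auto simp: nth_append l f n_def[symmetric]\<close>)
  moreover have "(\<Prod>v<n. if (x @ x') ! (n + v)
      then field_value \<alpha> ((circuit_fields m y @ circuit_fields m y) ! (n + v)) else 1) = bit_sign Y x'"
    unfolding bit_sign_def l by (rule prod.cong) (use assms in \<open>auto simp: nth_append l f n_def[symmetric]\<close>)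
  ultimately show ?thesis
    unfolding field_factor_def length_append l prod_lessThan_add Y_def by simp
qed

lemma edge_factor_circuit_edges:
  assumes "diagonal_gate (length m) U" "length x = Suc (length m)" "length x' = Suc (length m)"
  shows "(\<Prod>e\<leftarrow>circuit_edges m U. edge_factor (2 * \<theta>) (x @ x') e) =
    (case gate_ends (length m) U of (i, j) \<Rightarrow> signed_cis \<theta> (x ! i = x ! j) *
      cnj (signed_cis \<theta> (mix (m @ [False]) x x' ! i = mix (m @ [False]) x x' ! j)))"
proof -
  obtain i j where e: "gate_ends (length m) U = (i, j)" by fastforce
  have ij: "i < Suc (length m)" "j < Suc (length m)"
    using e assms(1) by (cases U; auto)+
  have mix: "(x @ x') ! copy_vertex m i = mix (m @ [False]) x x' ! i" if "i < Suc (length m)" for i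
  proof -
    have "mix (m @ [False]) x x' ! i = (if (m @ [False]) ! i then x' ! i else x ! i)"
      using that by (intro nth_mix) simp
    then show ?thesis using that assms(2) by (auto simp: copy_vertex_def nth_append)
  qed
  have fst: "(x @ x') ! i = x ! i" "(x @ x') ! j = x ! j"
    using ij assms(2) by (auto simp: nth_append)
  \<comment> \<open>The constants \<open>cis (- \<theta>)\<close> and \<open>cis \<theta>\<close>
    that relate Ising factors to gate phases cancel between the two copies, so this identity is
    exact.\<close>
  have "(if b then signed_cis (2 * \<theta>) False else 1) * (if a then signed_cis (2 * \<theta>) True else 1) =
      signed_cis \<theta> a * cnj (signed_cis \<theta> b)" for a b
    by (cases a; cases b) (auto simp: signed_cis_def cis_mult cis_cnj)
  from this[of "mix (m @ [False]) x x' ! i = mix (m @ [False]) x x' ! j" "x ! i = x ! j"]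
  show ?thesis
    by (simp add: circuit_edges_def e mix ij fst)
qed

lemma prod_list_mult:
  "(\<Prod>a\<leftarrow>as. f a * g a) = (\<Prod>a\<leftarrow>as. f a) * (\<Prod>a\<leftarrow>as. g a :: 'a :: comm_monoid_mult)"
  by (induction as) (simp_all add: mult_ac)

lemma cnj_prod_list: "cnj (prod_list xs) = prod_list (map cnj xs)"
  by (induction xs) simp_all

lemma prod_list_concat_map:
  "(\<Prod>b\<leftarrow>concat (map g as). f b) = (\<Prod>a\<leftarrow>as. \<Prod>b\<leftarrow>g a. f b :: 'a :: monoid_mult)"
  by (induction as) simp_all

text \<open>Both factors of the 4 come from the ancilla: 2 from its isolated second vertex, and 2
  because its two spin values give equal contributions by the global flip.\<close>

lemma ising_sum_circuit:
  assumes "\<forall>U\<in>set Ds. diagonal_gate (length m) U"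
  shows "ising_sum (2 * \<theta>) (Suc (length m) + Suc (length m)) (concat (map (circuit_edges m) Ds))
    (circuit_fields m y @ circuit_fields m y) = 4 * double_sum \<theta> Ds m (expand m y)"
proof -
  let ?n = "length m" and ?Y = "expand m y" and ?W = "pair_phase \<theta> (length m) Ds"
  let ?m = "m @ [False]" and ?s = "\<lambda>x. bit_sign (expand m y @ [False]) x"
  have "ising_sum (2 * \<theta>) (Suc ?n + Suc ?n) (concat (map (circuit_edges m) Ds))
      (circuit_fields m y @ circuit_fields m y) =
      (\<Sum>x\<in>bits (Suc ?n). \<Sum>x'\<in>bits (Suc ?n). ?W x * ?s x * (cnj (?W (mix ?m x x')) * ?s (mix ?m x x')))"
    unfolding ising_sum_def sum_bits_append
  proof (intro sum.cong refl)
    fix x x' assume "x \<in> bits (Suc ?n)" "x' \<in> bits (Suc ?n)"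
    then have l: "length x = Suc ?n" "length x' = Suc ?n" by (auto simp: bits_def)
    have "(\<Prod>e\<leftarrow>concat (map (circuit_edges m) Ds). edge_factor (2 * \<theta>) (x @ x') e) =
        (\<Prod>U\<leftarrow>Ds. case gate_ends ?n U of (i, j) \<Rightarrow> signed_cis \<theta> (x ! i = x ! j) *
          cnj (signed_cis \<theta> (mix ?m x x' ! i = mix ?m x x' ! j)))"
      unfolding prod_list_concat_map using assms edge_factor_circuit_edges[OF _ l]
      by (intro arg_cong[where f = prod_list] map_cong) auto
    also have "\<dots> = ?W x * cnj (?W (mix ?m x x'))"
      unfolding pair_phase_def cnj_prod_list map_map prod_list_mult[symmetric]
      by (intro arg_cong[where f = prod_list] map_cong) (auto split: prod.splits)
    finally have E: "(\<Prod>e\<leftarrow>concat (map (circuit_edges m) Ds). edge_factor (2 * \<theta>) (x @ x') e) =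
      ?W x * cnj (?W (mix ?m x x'))" .
    \<comment> \<open>\<open>x'\<close> and \<open>mix\<close> differ only at positions without
      mask, where the expanded outcome is \<open>False\<close> and no sign arises.\<close>
    have "?s x' = ?s (mix ?m x x')"
      unfolding bit_sign_def
    proof (rule prod.cong[OF refl])
      fix i assume i: "i \<in> {..<length (?Y @ [False])}"
      then have "mix ?m x x' ! i = (if ?m ! i then x' ! i else x ! i)"
        by (intro nth_mix) simp
      moreover have "\<not> ?m ! i \<Longrightarrow> \<not> (?Y @ [False]) ! i"
        using i expand_unmasked[of i m y] by (auto simp: nth_append split: if_splits)
      ultimately show "(if (?Y @ [False]) ! i \<and> x' ! i then -1 else 1 :: complex) =
          (if (?Y @ [False]) ! i \<and> mix ?m x x' ! i then -1 else 1)" by auto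
    qed
    then show "(\<Prod>e\<leftarrow>concat (map (circuit_edges m) Ds). edge_factor (2 * \<theta>) (x @ x') e) *
        field_factor (2 * \<theta>) (circuit_fields m y @ circuit_fields m y) (x @ x') =
        ?W x * ?s x * (cnj (?W (mix ?m x x')) * ?s (mix ?m x x'))"
      unfolding E field_factor_circuit_fields[OF l] by (simp add: mult_ac)
  qed
  also have "\<dots> = (\<Sum>x\<in>bits (Suc ?n). \<Sum>x'\<in>bits (Suc ?n).
      ?W x * ?s x * (cnj (?W x') * ?s x') * glue ?m x x')"
  proof (rule sum.cong[OF refl])
    fix x assume "x \<in> bits (Suc ?n)"
    then have "length x = length ?m" by (simp add: bits_def)
    from sum_mix[OF this, of "\<lambda>z. ?W x * ?s x * (cnj (?W z) * ?s z)"]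
    show "(\<Sum>x'\<in>bits (Suc ?n). ?W x * ?s x * (cnj (?W (mix ?m x x')) * ?s (mix ?m x x'))) =
        (\<Sum>x'\<in>bits (Suc ?n). ?W x * ?s x * (cnj (?W x') * ?s x') * glue ?m x x')"
      by simp
  qed
  also have "\<dots> = (\<Sum>x\<in>bits ?n. \<Sum>x'\<in>bits ?n.
      2 * (?W (x @ [False]) * cnj (?W (x' @ [False])) * (bit_sign ?Y x * bit_sign ?Y x' * glue m x x')) +
      2 * (?W (x @ [True]) * cnj (?W (x' @ [True])) * (bit_sign ?Y x * bit_sign ?Y x' * glue m x x')))"
    unfolding sum_bits_snoc sum.distrib[symmetric]
    by (intro sum.cong refl) (auto simp: bits_def bit_sign_snoc glue_snoc)
  also have "\<dots> = 2 * (\<Sum>x\<in>bits ?n. \<Sum>x'\<in>bits ?n.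
      ?W (x @ [False]) * cnj (?W (x' @ [False])) * (bit_sign ?Y x * bit_sign ?Y x' * glue m x x')) +
      2 * (\<Sum>x\<in>bits ?n. \<Sum>x'\<in>bits ?n.
      ?W (x @ [True]) * cnj (?W (x' @ [True])) * (bit_sign ?Y x * bit_sign ?Y x' * glue m x x'))"
    by (simp add: sum.distrib sum_distrib_left)
  \<comment> \<open>Both summation variables are negated, so that a flip of all spins including the
    ancilla brings the \<open>True\<close> part to the \<open>False\<close> part.\<close>
  also have "(\<Sum>x\<in>bits ?n. \<Sum>x'\<in>bits ?n.
      ?W (x @ [True]) * cnj (?W (x' @ [True])) * (bit_sign ?Y x * bit_sign ?Y x' * glue m x x')) =
      (\<Sum>x\<in>bits ?n. \<Sum>x'\<in>bits ?n. ?W (map Not x @ [True]) * cnj (?W (map Not x' @ [True])) *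
        (bit_sign ?Y (map Not x) * bit_sign ?Y (map Not x') * glue m (map Not x) (map Not x')))"
    by (subst sum_bits_map_Not[symmetric], rule sum.cong[OF refl], subst sum_bits_map_Not[symmetric])
      simp
  also have "\<dots> = (\<Sum>x\<in>bits ?n. \<Sum>x'\<in>bits ?n.
      ?W (x @ [False]) * cnj (?W (x' @ [False])) * (bit_sign ?Y x * bit_sign ?Y x' * glue m x x'))"
  proof (intro sum.cong refl)
    fix x x' assume "x \<in> bits ?n" "x' \<in> bits ?n"
    then have l: "length x = ?n" "length x' = ?n" by (auto simp: bits_def)
    have W: "?W (map Not z @ [True]) = ?W (z @ [False])" if "length z = ?n" for z
      using pair_phase_map_Not[OF assms, of "z @ [False]" \<theta>] that by simp
    have "bit_sign ?Y (map Not x) * bit_sign ?Y (map Not x') = bit_sign ?Y ?Y * bit_sign ?Y ?Y * (bit_sign ?Y x * bit_sign ?Y x')"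
      using l by (simp add: bit_sign_map_Not mult_ac)
    then show "?W (map Not x @ [True]) * cnj (?W (map Not x' @ [True])) *
        (bit_sign ?Y (map Not x) * bit_sign ?Y (map Not x') * glue m (map Not x) (map Not x')) =
        ?W (x @ [False]) * cnj (?W (x' @ [False])) * (bit_sign ?Y x * bit_sign ?Y x' * glue m x x')"
      using l by (simp add: W glue_map_Not bit_sign_square)
  qed
  also have "\<dots> = double_sum \<theta> Ds m ?Y"
    unfolding double_sum_def using pair_phase_snoc_False[OF assms]
    by (intro sum.cong refl) (auto simp: bits_def)
  finally show ?thesis by simp
qed

lemma marginal_prob_nonneg: "0 \<le> marginal_prob \<theta> n Us I y"
  unfolding marginal_prob_def output_prob_def by (intro sum_nonneg) simp

section \<open>Disjoint copies of an Ising instance\<close>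

fun shift :: "nat \<Rightarrow> edge \<Rightarrow> edge" where
  "shift c (u, v, b) = (c + u, c + v, b)"

definition edges_below :: "nat \<Rightarrow> edge list \<Rightarrow> bool" where
  "edges_below n es \<longleftrightarrow> (\<forall>e\<in>set es. fst (edge_ends e) < n \<and> snd (edge_ends e) < n)"

text \<open>No edge joins the two blocks of vertices, so every weight factors and the double sum is
  a product. The edge list has the reversed form in which a loop that prepends edges leaves
  it.\<close>

lemma ising_sum_disjoint_union:
  assumes "edges_below n es" "edges_below n' es'" "length fs = n" "length fs' = n'"
  shows "ising_sum \<alpha> (n + n') (rev (map (shift n) es') @ es) (fs @ fs') =
    ising_sum \<alpha> n es fs * ising_sum \<alpha> n' es' fs'"
  unfolding ising_sum_def sum_bits_append sum_product
proof (intro sum.cong refl)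
  fix x y assume "x \<in> bits n" "y \<in> bits n'"
  then have l: "length x = n" "length y = n'" by (auto simp: bits_def)
  have "(\<Prod>e\<leftarrow>es. edge_factor \<alpha> (x @ y) e) = (\<Prod>e\<leftarrow>es. edge_factor \<alpha> x e)"
    using assms(1) l
    by (intro arg_cong[where f = prod_list] map_cong) (auto simp: edges_below_def nth_append)
  moreover have "(\<Prod>e\<leftarrow>rev (map (shift n) es'). edge_factor \<alpha> (x @ y) e) =
      (\<Prod>e\<leftarrow>es'. edge_factor \<alpha> y e)"
    unfolding rev_map[symmetric] prod_list.rev map_map
    using assms(2) l
    by (intro arg_cong[where f = prod_list] map_cong) (auto simp: edges_below_def nth_append)
  moreover have "field_factor \<alpha> (fs @ fs') (x @ y) = field_factor \<alpha> fs x * field_factor \<alpha> fs' y"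
    unfolding field_factor_def length_append prod_lessThan_add
    using assms(3,4) l by (intro arg_cong2[where f = times] prod.cong) (auto simp: nth_append)
  ultimately show "(\<Prod>e\<leftarrow>rev (map (shift n) es') @ es. edge_factor \<alpha> (x @ y) e) *
      field_factor \<alpha> (fs @ fs') (x @ y) =
      (\<Prod>e\<leftarrow>es. edge_factor \<alpha> x e) * field_factor \<alpha> fs x *
      ((\<Prod>e\<leftarrow>es'. edge_factor \<alpha> y e) * field_factor \<alpha> fs' y)"
    by (simp add: mult_ac)
qed

fun copies :: "nat \<Rightarrow> edge list \<Rightarrow> nat \<Rightarrow> edge list" where
  "copies n es 0 = []"
| "copies n es (Suc k) = rev (map (shift (k * n)) es) @ copies n es k"

lemma edges_below_copies: "edges_below n es \<Longrightarrow> edges_below (k * n) (copies n es k)"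
  by (induction k) (fastforce simp: edges_below_def)+

lemma concat_replicate_Suc: "concat (replicate (Suc k) xs) = concat (replicate k xs) @ xs"
  by (induction k) auto

lemma length_concat_replicate: "length (concat (replicate k xs)) = k * length xs"
  by (induction k) auto

lemma ising_sum_copies:
  assumes "edges_below n es" "length fs = n"
  shows "ising_sum \<alpha> (k * n) (copies n es k) (concat (replicate k fs)) = ising_sum \<alpha> n es fs ^ k"
proof (induction k)
  case 0
  show ?case by (simp add: ising_sum_def field_factor_def)
next
  case (Suc k)
  show ?case
    using ising_sum_disjoint_union[OF edges_below_copies[OF assms(1), of k] assms(1) _ assms(2),
        of "concat (replicate k fs)" \<alpha>] Suc assms(2)
    by (simp add: concat_replicate_Suc length_concat_replicate add.commute mult.commute
        del: replicate.simps)
qed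

lemma edges_below_circuit:
  assumes "\<forall>U\<in>set Ds. diagonal_gate (length m) U"
  shows "edges_below (Suc (length m) + Suc (length m)) (concat (map (circuit_edges m) Ds))"
  unfolding edges_below_def
proof
  fix e assume "e \<in> set (concat (map (circuit_edges m) Ds))"
  then obtain U where U: "U \<in> set Ds" "e \<in> set (circuit_edges m U)" by auto
  note U(2)
  moreover have "diagonal_gate (length m) U" using U assms by blast
  ultimately show "fst (edge_ends e) < Suc (length m) + Suc (length m) \<and>
      snd (edge_ends e) < Suc (length m) + Suc (length m)"
    by (cases U) (auto simp: circuit_edges_def copy_vertex_def)
qed

text \<open>One copy has the nonnegative real value \<open>4 * 4 ^ length m\<close> times the
  probability, so the modulus of the power is the power itself. The fields are repeated
  \<open>2 * k\<close> times because each of the \<open>k\<close> graphs carries two blocks of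
  them.\<close>

lemma iqp_to_ising:
  fixes m :: "bool list" and k :: nat
  defines "N \<equiv> Suc (length m) + Suc (length m)"
    and "I \<equiv> {i. i < length m \<and> m ! i}"
  assumes "\<forall>U\<in>set Ds. diagonal_gate (length m) U" "length y = count_list m True"
  shows "ising_instance (k * N) (copies N (concat (map (circuit_edges m) Ds)) k)
      (concat (replicate (2 * k) (circuit_fields m y)))"
    and "cmod (ising_value (2 * \<theta>) (k * N) (copies N (concat (map (circuit_edges m) Ds)) k)
      (concat (replicate (2 * k) (circuit_fields m y)))) =
      (4 ^ Suc (length m) * marginal_prob \<theta> (length m) ([HAll] @ Ds @ [HAll]) I y) ^ k"
proof -
  let ?E = "concat (map (circuit_edges m) Ds)" and ?F = "circuit_fields m y @ circuit_fields m y"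
  let ?P = "marginal_prob \<theta> (length m) ([HAll] @ Ds @ [HAll]) I y"
  have F: "length ?F = N" by (simp add: circuit_fields_def N_def)
  have below: "edges_below N ?E" unfolding N_def by (rule edges_below_circuit[OF assms(3)])
  have FF: "concat (replicate (2 * k) (circuit_fields m y)) = concat (replicate k ?F)"
    by (induction k) auto
  show inst: "ising_instance (k * N) (copies N ?E k) (concat (replicate (2 * k) (circuit_fields m y)))"
    using edges_below_copies[OF below, of k] F
    by (auto simp: ising_instance_def edges_below_def FF length_concat_replicate
        simp del: length_append)
  have "ising_sum (2 * \<theta>) N ?E ?F = complex_of_real (4 ^ Suc (length m) * ?P)"
    unfolding N_def ising_sum_circuit[OF assms(3)] I_def
    using marginal_prob_eq[OF assms(3) refl assms(4), of \<theta>] by simp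
  then show "cmod (ising_value (2 * \<theta>) (k * N) (copies N ?E k)
      (concat (replicate (2 * k) (circuit_fields m y)))) = (4 ^ Suc (length m) * ?P) ^ k"
    unfolding ising_value_eq[OF inst] unfolding FF ising_sum_copies[OF below F]
    using marginal_prob_nonneg[of \<theta> "length m" "[HAll] @ Ds @ [HAll]" I y]
    by (simp only: norm_power norm_of_real) simp
qed

section \<open>Extracting roots\<close>

abbreviation Seq_infix (infixr \<open>;;\<close> 60) where "c ;; d \<equiv> Seq c d"
abbreviation Assign_infix (infix \<open>::=\<close> 61) where "x ::= e \<equiv> Assign x e"

fun pow_expr :: "expr \<Rightarrow> nat \<Rightarrow> expr" where
  "pow_expr e 0 = Const 1"
| "pow_expr e (Suc k) = Times e (pow_expr e k)"

lemma eval_pow_expr: "eval_expr s (pow_expr e k) = Num (val_num (eval_expr s e) ^ k)"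
  by (induction k) auto

text \<open>For an answer \<open>a / b\<close> in variable \<open>0\<close>, steps through the values \<open>(1 + 1 / r) ^ j / b\<close> until the
  \<open>m\<close>-th power reaches \<open>a / b\<close>.\<close>

definition root_program :: "nat \<Rightarrow> nat \<Rightarrow> com" where
  "root_program m r =
    1 ::= Less (Const 0) (Snd (Fst (Var 0))) ;;
    2 ::= Snd (Var 0) ;;
    While (Less (Times (pow_expr (Var 1) m) (Snd (Var 0)))
        (Times (Snd (Fst (Var 0))) (pow_expr (Var 2) m)))
      (1 ::= Times (Const (Suc r)) (Var 1) ;; 2 ::= Times (Const r) (Var 2))"

text \<open>For an answer of size \<open>V\<close> the search takes at most \<open>r * V\<close>
  steps, and each step lengthens numerator and denominator by at most \<open>Suc r\<close>
  bits.\<close>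

definition root_size :: "nat \<Rightarrow> nat \<Rightarrow> nat" where
  "root_size r V = V + 2 + Suc r * (r * V)"

lemma less_two_power_vsize: "k < 2 ^ (vsize (Num k) - 1)"
  using floorlog_le_iff[of 2 k "floorlog 2 k"] by simp

lemma vsize_Num_leI: "k < 2 ^ j \<Longrightarrow> vsize (Num k) \<le> Suc j"
  by (simp add: floorlog_le_iff)

text \<open>Bernoulli's inequality: \<open>r\<close> steps with ratio \<open>1 + 1 / r\<close> at
  least double the guess. Hence the number of steps is linear in the length of the answer.\<close>

lemma power_Suc_ge_double: "r > 0 \<Longrightarrow> 2 * r ^ r \<le> Suc r ^ r"
proof -
  assume r: "r > 0"
  have "1 + real r * (1 / real r) \<le> (1 + 1 / real r) ^ r"
    by (rule Bernoulli_inequality) (simp add: order.trans[of _ 0])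
  then have "2 * real r ^ r \<le> (1 + 1 / real r) ^ r * real r ^ r"
    using r by (intro mult_right_mono) auto
  also have "\<dots> = real (Suc r) ^ r"
    using r by (simp add: field_simps flip: power_mult_distrib)
  finally have "real (2 * r ^ r) \<le> real (Suc r ^ r)" by simp
  then show ?thesis by (simp only: of_nat_le_iff)
qed

lemma power_Suc_ge: "r > 0 \<Longrightarrow> 2 ^ i * r ^ (r * i) \<le> Suc r ^ (r * i)"
  using power_mono[OF power_Suc_ge_double, of r i] by (simp add: power_mult power_mult_distrib)

text \<open>The search stops at the first guess whose \<open>m\<close>-th power reaches
  \<open>a / b\<close>. One step before, the guess was still too small, so its power overshoots by
  at most \<open>(1 + 1 / r) ^ m\<close>.\<close>

lemma wp_root_program:
  fixes a :: int and b m r M :: nat and s :: state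
  assumes s0: "s 0 = Pair (enc_int a) (Num b)" and a: "0 \<le> a" and b: "0 < b"
    and m: "0 < m" and r: "0 < r" and M: "root_size r (vsize (s 0)) \<le> M"
    and Q: "\<And>x y. 0 < y \<Longrightarrow> vsize (Num x) \<le> root_size r (vsize (s 0)) \<Longrightarrow>
      vsize (Num y) \<le> root_size r (vsize (s 0)) \<Longrightarrow> real_of_int a / b \<le> (x / y) ^ m \<Longrightarrow>
      (x / y) ^ m \<le> (1 + 1 / r) ^ m * (real_of_int a / b) \<Longrightarrow> Q (s(1 := Num x, 2 := Num y))"
  shows "wp ora M (root_program m r) Q s"
proof -
  define A where "A = nat a"
  have aA: "a = int A" using a by (simp add: A_def)
  have s0': "s 0 = Pair (Pair (Num 0) (Num A)) (Num b)"
    using s0 by (simp add: aA enc_int_def enc_bool_def)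
  define V where "V = vsize (s 0)"
  \<comment> \<open>Numerator after \<open>j\<close> steps. It is identically 0 for
    \<open>A = 0\<close>: then the only admissible estimate is 0, which a positive geometric
    sequence never attains.\<close>
  define num where "num j = of_bool (0 < A) * Suc r ^ j" for j
  define den where "den j = b * r ^ j" for j
  define stop where "stop j \<longleftrightarrow> \<not> num j ^ m * b < A * den j ^ m" for j
  define J where "J = (LEAST j. stop j)"
  have V: "vsize (Num A) - 1 + (vsize (Num b) - 1) \<le> V" "vsize (Num b) \<le> V"
    by (simp_all add: V_def s0')
  have "A * b \<le> 2 ^ (vsize (Num A) - 1) * 2 ^ (vsize (Num b) - 1)"
    using less_two_power_vsize[of A] less_two_power_vsize[of b]
    by (intro mult_mono) (auto simp del: vsize.simps)
  also have "\<dots> \<le> 2 ^ V" using V(1) by (simp add: power_add[symmetric] del: vsize.simps)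
  finally have AB: "A * b \<le> 2 ^ V" .
  \<comment> \<open>After \<open>r * V\<close> steps the guess is at least \<open>2 ^ V / b\<close>,
    hence at least \<open>A\<close>, and for \<open>A > 0\<close> already \<open>A ^ m\<close> is at
    least \<open>A / b\<close>.\<close>
  have stop: "stop (r * V)"
  proof (cases "A = 0")
    case False
    have "A * den (r * V) ^ m \<le> A ^ m * (b * r ^ (r * V)) ^ m"
      using False m by (simp add: den_def self_le_power)
    also have "\<dots> = (A * b * r ^ (r * V)) ^ m" by (simp add: power_mult_distrib mult_ac)
    also have "\<dots> \<le> (2 ^ V * r ^ (r * V)) ^ m"
      using AB by (intro power_mono mult_right_mono) auto
    also have "\<dots> \<le> num (r * V) ^ m"
      using power_Suc_ge[OF r, of V] False by (intro power_mono) (auto simp: num_def)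
    also have "\<dots> \<le> num (r * V) ^ m * b" using b by simp
    finally show ?thesis by (simp add: stop_def)
  qed (simp add: stop_def)
  have J: "stop J" "J \<le> r * V"
    unfolding J_def using stop by (auto intro: LeastI Least_le)
  have not_stop: "\<not> stop j" if "j < J" for j
    using that not_less_Least unfolding J_def by blast
  have num_size: "vsize (Num (num j)) \<le> root_size r V" if "j \<le> J" for j
  proof -
    have "num j \<le> (2 ^ Suc r) ^ j"
      unfolding num_def using less_exp[of "Suc r"] by (auto intro!: power_mono simp del: power_Suc)
    also have "\<dots> \<le> 2 ^ (Suc r * (r * V))"
      unfolding power_mult[symmetric] using that J(2)
      by (intro power_increasing mult_le_mono2) auto
    also have "\<dots> < 2 ^ Suc (Suc r * (r * V))" by simp
    finally have "vsize (Num (num j)) \<le> Suc (Suc (Suc r * (r * V)))" by (rule vsize_Num_leI)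
    then show ?thesis unfolding root_size_def by linarith
  qed
  have den_size: "vsize (Num (den j)) \<le> root_size r V" if "j \<le> J" for j
  proof -
    have "b < 2 ^ V"
      using less_two_power_vsize[of b] V(2)
      by (auto intro: less_le_trans power_increasing simp del: vsize.simps)
    moreover have "r ^ j \<le> 2 ^ (Suc r * (r * V))"
    proof -
      have "r ^ j \<le> (2 ^ r) ^ j" using less_exp[of r] by (intro power_mono) auto
      also have "\<dots> \<le> 2 ^ (Suc r * (r * V))"
        unfolding power_mult[symmetric] using that J(2)
        by (intro power_increasing mult_le_mono) auto
      finally show ?thesis .
    qed
    ultimately have "den j < 2 ^ (V + Suc r * (r * V))"
      unfolding den_def power_add by (intro mult_less_le_imp_less) (use r in auto)
    then have "vsize (Num (den j)) \<le> Suc (V + Suc r * (r * V))" by (rule vsize_Num_leI)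
    then show ?thesis unfolding root_size_def by linarith
  qed
  have Suc_num: "num (Suc j) = Suc r * num j" and Suc_den: "den (Suc j) = r * den j" for j
    by (simp_all add: num_def den_def)
  have MV: "root_size r V \<le> M" using M by (simp add: V_def)
  let ?body = "1 ::= Times (Const (Suc r)) (Var 1) ;; 2 ::= Times (Const r) (Var 2)"
  let ?Inv = "\<lambda>i t. i \<le> J \<and> t = s(1 := Num (num (J - i)), 2 := Num (den (J - i)))"
  have den_pos: "0 < den J" using b r by (simp add: den_def)
  have "real A / b \<le> (real (num J) / real (den J)) ^ m"
  proof -
    have "A * den J ^ m \<le> num J ^ m * b" using J(1) by (simp add: stop_def)
    then have "real (A * den J ^ m) \<le> real (num J ^ m * b)" by (simp only: of_nat_le_iff)
    then show ?thesis using b den_pos by (simp add: field_simps power_divide)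
  qed
  moreover have "(real (num J) / real (den J)) ^ m \<le> (1 + 1 / r) ^ m * (real A / b)"
  proof (cases J)
    case 0
    \<comment> \<open>A stop at the very first guess could overshoot without control; starting at
      \<open>1 / b\<close> prevents this, as its power is at most \<open>1 / b\<close> and so at
      most \<open>A / b\<close>.\<close>
    have "(1 / real b) ^ m \<le> 1 / b"
      using power_decreasing[of 1 m "1 / real b"] m b by simp
    moreover have "1 / real b \<le> real A / b" if "0 < A"
      using that by (intro divide_right_mono) auto
    ultimately have "(real (num 0) / real (den 0)) ^ m \<le> 1 * (real A / b)"
      using m by (cases "A = 0") (auto simp: num_def den_def power_0_left)
    also have "\<dots> \<le> (1 + 1 / r) ^ m * (real A / b)"
      by (intro mult_right_mono one_le_power) auto
    finally show ?thesis by (simp add: 0)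
  next
    case (Suc j)
    have "num j ^ m * b < A * den j ^ m" using not_stop[of j] Suc by (simp add: stop_def)
    then have "real (num j ^ m * b) \<le> real (A * den j ^ m)" by (simp only: of_nat_le_iff)
    moreover have "0 < den j" using b r by (simp add: den_def)
    ultimately have "(real (num j) / real (den j)) ^ m \<le> real A / b"
      using b by (simp add: field_simps power_divide)
    moreover have "real (num J) / real (den J) = (1 + 1 / r) * (real (num j) / real (den j))"
      using r by (simp add: Suc num_def den_def field_simps)
    ultimately show ?thesis
      by (simp add: power_mult_distrib mult_left_mono del: times_divide_eq_right)
  qed
  ultimately have QJ: "Q (s(1 := Num (num J), 2 := Num (den J)))"
    using den_pos num_size[of J] den_size[of J] Q[of "den J" "num J"] by (simp add: aA V_def)
  show ?thesis
    unfolding root_program_def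
  proof (intro wp_Seq wp_Assign)
    show "vsize (eval_expr s (Less (Const 0) (Snd (Fst (Var 0))))) \<le> M"
      using num_size[of 0] MV by (simp add: s0' num_def)
    show "vsize (eval_expr (s(1 := eval_expr s (Less (Const 0) (Snd (Fst (Var 0)))))) (Snd (Var 0))) \<le> M"
      using den_size[of 0] MV by (simp add: s0' den_def)
    show "wp ora M (While (Less (Times (pow_expr (Var 1) m) (Snd (Var 0)))
        (Times (Snd (Fst (Var 0))) (pow_expr (Var 2) m))) ?body) Q
      (s(1 := eval_expr s (Less (Const 0) (Snd (Fst (Var 0)))),
         2 := eval_expr (s(1 := eval_expr s (Less (Const 0) (Snd (Fst (Var 0)))))) (Snd (Var 0))))"
    proof (rule wp_While[where Inv = ?Inv and k = J])
      fix i t assume t: "?Inv (Suc i) t"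
      define j where "j = J - Suc i"
      have j: "J - i = Suc j" "j < J" using t by (auto simp: j_def)
      have tt: "t = s(1 := Num (num j), 2 := Num (den j))" using t by (simp add: j_def)
      have "eval_expr t (Less (Times (pow_expr (Var 1) m) (Snd (Var 0)))
          (Times (Snd (Fst (Var 0))) (pow_expr (Var 2) m))) \<noteq> Num 0"
        using not_stop[OF j(2)] by (simp add: tt s0' eval_pow_expr stop_def)
      moreover have "wp ora M ?body (?Inv i) t"
      proof -
        have "i \<le> J" using t by simp
        moreover have "vsize (Num (Suc r * num j)) \<le> M" "vsize (Num (r * den j)) \<le> M"
          using num_size[of "Suc j"] den_size[of "Suc j"] MV j(2) by (simp_all add: Suc_num Suc_den)
        ultimately show ?thesis
          by (intro wp_Seq wp_Assign) (simp_all add: tt j(1) Suc_num Suc_den fun_upd_twist)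
      qed
      ultimately show "eval_expr t (Less (Times (pow_expr (Var 1) m) (Snd (Var 0)))
          (Times (Snd (Fst (Var 0))) (pow_expr (Var 2) m))) \<noteq> Num 0 \<and> wp ora M ?body (?Inv i) t" ..
    next
      fix t assume "?Inv 0 t"
      then show "eval_expr t (Less (Times (pow_expr (Var 1) m) (Snd (Var 0)))
          (Times (Snd (Fst (Var 0))) (pow_expr (Var 2) m))) = Num 0 \<and> Q t"
        using J(1) QJ by (simp add: s0' eval_pow_expr stop_def)
    next
      show "?Inv J (s(1 := eval_expr s (Less (Const 0) (Snd (Fst (Var 0)))),
         2 := eval_expr (s(1 := eval_expr s (Less (Const 0) (Snd (Fst (Var 0)))))) (Snd (Var 0))))"
        by (auto simp: s0' num_def den_def)
      have "r * V \<le> root_size r V" by (simp add: root_size_def)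
      then show "J \<le> M" using J(2) MV by linarith
    qed
  qed
qed

lemma approximate_root:
  fixes X u p \<kappa> \<kappa>' d :: real
  assumes "X ^ m / \<kappa>' \<le> p" "p \<le> \<kappa>' * X ^ m" "p \<le> u ^ m" "u ^ m \<le> d ^ m * p"
    and "0 \<le> X" "0 \<le> u" "0 < \<kappa>" "0 < \<kappa>'" "1 \<le> d" "d ^ m * \<kappa>' \<le> \<kappa> ^ m" "0 < m"
  shows "X / \<kappa> \<le> u" "u \<le> \<kappa> * X"
proof -
  have \<kappa>': "\<kappa>' \<le> \<kappa> ^ m"
  proof -
    have "1 * \<kappa>' \<le> d ^ m * \<kappa>'" using assms by (intro mult_right_mono one_le_power) auto
    then show ?thesis using assms(10) by simp
  qed
  have "(X / \<kappa>) ^ m \<le> X ^ m / \<kappa>'"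
    using \<kappa>' assms by (simp add: power_divide frac_le)
  then have "(X / \<kappa>) ^ m \<le> u ^ m" using assms(1,3) by linarith
  then show "X / \<kappa> \<le> u" using assms by (subst (asm) power_mono_iff) auto
  have "u ^ m \<le> d ^ m * (\<kappa>' * X ^ m)"
    using assms by (meson mult_left_mono order.trans zero_le_power zero_le_one)
  also have "\<dots> \<le> (\<kappa> * X) ^ m"
    using mult_right_mono[OF assms(10), of "X ^ m"] assms(5) by (simp add: power_mult_distrib mult_ac)
  finally show "u \<le> \<kappa> * X" using assms by (subst (asm) power_mono_iff) auto
qed

section \<open>Choice of the search ratio, and polynomial budgets\<close>

lemma exists_step_close_to_one:
  fixes \<kappa> :: real
  assumes "\<kappa> > 1"
  obtains r :: nat where "0 < r" "(1 + 1 / r) ^ m \<le> \<kappa>"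
proof -
  have "(\<lambda>r. (1 + 1 / real (Suc r)) ^ m) \<longlonglongrightarrow> (1 + 0) ^ m"
    by (intro tendsto_intros LIMSEQ_Suc[OF lim_1_over_n])
  then have "\<forall>\<^sub>F r in sequentially. (1 + 1 / real (Suc r)) ^ m < \<kappa>"
    using assms by (intro order_tendstoD(2)) auto
  then obtain r where "(1 + 1 / real (Suc r)) ^ m < \<kappa>"
    by (auto simp: eventually_sequentially)
  then show thesis by (intro that[of "Suc r"]) auto
qed

text \<open>Allows budgets to be written as arithmetic formulas; the polynomial behind a formula is
  then found by closure properties, including composition with the oracle bound
  \<open>q\<close>.\<close>

definition polynomial :: "(nat \<Rightarrow> nat) \<Rightarrow> bool" where
  "polynomial f \<longleftrightarrow> (\<exists>P. \<forall>x. poly P x = f x)"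

lemma polynomial_intros:
  "polynomial (\<lambda>x. x)"
  "polynomial (\<lambda>x. c)"
  "polynomial f \<Longrightarrow> polynomial g \<Longrightarrow> polynomial (\<lambda>x. f x + g x)"
  "polynomial f \<Longrightarrow> polynomial g \<Longrightarrow> polynomial (\<lambda>x. f x * g x)"
  "polynomial f \<Longrightarrow> polynomial (\<lambda>x. poly q (f x))"
  "polynomial f \<Longrightarrow> polynomial (\<lambda>x. Suc (f x))"
proof -
  show "polynomial (\<lambda>x. x)" unfolding polynomial_def by (intro exI[of _ "[:0, 1:]"]) simp
  show "polynomial (\<lambda>x. c)" unfolding polynomial_def by (intro exI[of _ "[:c:]"]) simp
  show "polynomial f \<Longrightarrow> polynomial g \<Longrightarrow> polynomial (\<lambda>x. f x + g x)"
    unfolding polynomial_def by (metis poly_add)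
  show "polynomial f \<Longrightarrow> polynomial g \<Longrightarrow> polynomial (\<lambda>x. f x * g x)"
    unfolding polynomial_def by (metis poly_mult)
  show "polynomial f \<Longrightarrow> polynomial (\<lambda>x. poly q (f x))"
    unfolding polynomial_def by (metis poly_pcompose)
  assume "polynomial f"
  then obtain P where "\<And>x. poly P x = f x" unfolding polynomial_def by blast
  then show "polynomial (\<lambda>x. Suc (f x))"
    unfolding polynomial_def by (intro exI[of _ "1 + P"]) simp
qed

section \<open>The program reducing Ising instances to IQP circuits\<close>

text \<open>Since lists grow by prepending, every intermediate list is a suffix of the final one,
  and only the size of the final list has to be estimated.\<close>

lemma vsize_enc_list_append_le: "vsize (enc_list f ys) \<le> vsize (enc_list f (xs @ ys))"
  by (induction xs) auto

text \<open>Variables: \<open>3\<close> edges, \<open>4\<close> fields, \<open>5\<close> gates, \<open>6\<close> bit vector of the measured qubits, \<open>7\<close> reversed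
  outcome, \<open>8\<close> current vertex, \<open>9\<close> counter, \<open>10\<close> power of two, \<open>11\<close> outcome.\<close>

definition repeat_gate :: com where
  "repeat_gate = While (Less (Const 0) (Var 9))
     (5 ::= MkPair (MkPair (Const 0) (Var 8)) (Var 5) ;; 9 ::= Minus (Var 9) (Const 1))"

text \<open>There is one field per vertex, so the same pass also produces the all-ones measurement
  vector, the outcome bits and \<open>2 ^ n\<close>.\<close>

definition field_loop :: "nat \<Rightarrow> com" where
  "field_loop k = While (IsPair (Var 4))
    (6 ::= MkPair (Const 1) (Var 6) ;;
     7 ::= MkPair (Mod (Fst (Fst (Var 4))) (Const 2)) (Var 7) ;;
     10 ::= Times (Const 2) (Var 10) ;;
     Cond (Fst (Snd (Fst (Var 4))))
       (9 ::= Mod (Times (Snd (Snd (Fst (Var 4)))) (Const (k - 1))) (Const k))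
       (9 ::= Mod (Snd (Snd (Fst (Var 4)))) (Const k)) ;;
     repeat_gate ;;
     8 ::= Plus (Var 8) (Const 1) ;;
     4 ::= Snd (Var 4))"

definition edge_loop :: "nat \<Rightarrow> com" where
  "edge_loop k = While (IsPair (Var 3))
    (Cond (Equal (Fst (Fst (Var 3))) (Fst (Snd (Fst (Var 3))))) Skip
       (Cond (Snd (Snd (Fst (Var 3))))
         (5 ::= push 1 (MkPair (Const 1) (MkPair (Fst (Fst (Var 3))) (Fst (Snd (Fst (Var 3)))))) (Var 5))
         (5 ::= push (k - 1) (MkPair (Const 1) (MkPair (Fst (Fst (Var 3))) (Fst (Snd (Fst (Var 3)))))) (Var 5))) ;;
     3 ::= Snd (Var 3))"

text \<open>The circuit is built from its end: the pair of zeros in variable 5 encodes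
  \<open>[HAll]\<close>. The final factor in variable 10 turns the square root of the probability
  into the modulus of the partition function.\<close>

definition ising_program :: "nat \<Rightarrow> nat \<Rightarrow> com" where
  "ising_program k r =
    3 ::= Fst (Snd (Var 0)) ;;
    4 ::= Snd (Snd (Var 0)) ;;
    5 ::= MkPair (Const 0) (Const 0) ;;
    10 ::= Const 1 ;;
    field_loop k ;;
    edge_loop k ;;
    5 ::= MkPair (Const 0) (Var 5) ;;
    reverse 7 11 ;;
    Query 0 (MkPair (Fst (Var 0)) (MkPair (Var 5) (MkPair (Var 6) (Var 11)))) ;;
    root_program 2 r ;;
    0 ::= MkPair (MkPair (Const 0) (Times (Var 1) (Var 10))) (Var 2)"

section \<open>Correctness of the loops that build the circuit\<close>

lemma wp_repeat_gate:
  assumes "s 5 = enc_list enc_gate gs" "s 8 = Num v" "s 9 = Num j" "j \<le> M"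
    and size: "vsize (enc_list enc_gate (replicate j (PGate v) @ gs)) \<le> M"
    and Q: "Q (s(5 := enc_list enc_gate (replicate j (PGate v) @ gs), 9 := Num 0))"
  shows "wp ora M repeat_gate Q s"
  unfolding repeat_gate_def
proof (rule wp_While[where k = j and
      Inv = "\<lambda>i t. i \<le> j \<and> t = s(5 := enc_list enc_gate (replicate (j - i) (PGate v) @ gs), 9 := Num i)"])
  fix i t assume t: "Suc i \<le> j \<and> t = s(5 := enc_list enc_gate (replicate (j - Suc i) (PGate v) @ gs), 9 := Num (Suc i))"
  have ji: "j - i = Suc (j - Suc i)" using t by linarith
  have "replicate j (PGate v) @ gs = replicate i (PGate v) @ replicate (j - i) (PGate v) @ gs"
    using t by (simp flip: append_assoc replicate_add)
  then have size': "vsize (enc_list enc_gate (replicate (j - i) (PGate v) @ gs)) \<le> M"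
    using size vsize_enc_list_append_le[of enc_gate _ "replicate i (PGate v)"] le_trans by metis
  have wp: "wp ora M (5 ::= MkPair (MkPair (Const 0) (Var 8)) (Var 5) ;; 9 ::= Minus (Var 9) (Const 1))
      (\<lambda>t. i \<le> j \<and> t = s(5 := enc_list enc_gate (replicate (j - i) (PGate v) @ gs), 9 := Num i)) t"
  proof (rule wp_bounded)
    assume "bounded M t"
    then have "vsize (Num i) \<le> M"
      using boundedD[of M t 9] vsize_Num_mono[of i "Suc i"] t by simp
    then show ?thesis
      using t size' assms(2) unfolding ji
      by (intro wp_Seq wp_Assign) (auto simp: fun_upd_twist)
  qed
  show "eval_expr t (Less (Const 0) (Var 9)) \<noteq> Num 0 \<and>
      wp ora M (5 ::= MkPair (MkPair (Const 0) (Var 8)) (Var 5) ;; 9 ::= Minus (Var 9) (Const 1))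
        (\<lambda>t. i \<le> j \<and> t = s(5 := enc_list enc_gate (replicate (j - i) (PGate v) @ gs), 9 := Num i)) t"
    using wp t by simp
next
  show "j \<le> j \<and> s = s(5 := enc_list enc_gate (replicate (j - j) (PGate v) @ gs), 9 := Num j)"
    using assms by auto
qed (use Q assms(4) in auto)

lemma vsize_enc_list_appendD: "vsize (enc_list f (xs @ ys)) \<le> M \<Longrightarrow> vsize (enc_list f ys) \<le> M"
  using vsize_enc_list_append_le le_trans by blast

lemma wp_Assign_Seq:
  assumes "bounded M s \<Longrightarrow> vsize (eval_expr s e) \<le> M"
    and "wp ora M c Q (s(x := eval_expr s e))"
  shows "wp ora M (x ::= e ;; c) Q s"
  by (rule wp_Seq, rule wp_Assign) (use assms in auto)

text \<open>\<open>F l\<close> is the gate list after \<open>l\<close> vertices. The premise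
  \<open>length fs + 2 \<le> M\<close> pays for the power of two and the vertex counter.\<close>

lemma wp_field_loop:
  fixes fs :: "field list" and k M :: nat and s :: state
  defines "F \<equiv> \<lambda>l. concat (rev (map (\<lambda>v. field_gates k v (fs ! v)) [0..<l])) @ [HAll]"
  assumes k: "0 < k" "Suc k \<le> M"
    and s: "s 4 = enc_list enc_field fs" "s 5 = enc_list enc_gate [HAll]" "s 6 = Num 0" "s 7 = Num 0"
      "s 8 = Num 0" "s 10 = Num 1"
    and size: "vsize (enc_list enc_gate (F (length fs))) \<le> M"
      "vsize (enc_list enc_bool (replicate (length fs) True)) \<le> M"
      "vsize (enc_list enc_bool (map (\<lambda>f. odd (fst f)) fs)) \<le> M"
      "length fs + 2 \<le> M"
    and Q: "\<And>t. t 0 = s 0 \<Longrightarrow> t 3 = s 3 \<Longrightarrow> t 5 = enc_list enc_gate (F (length fs)) \<Longrightarrow>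
      t 6 = enc_list enc_bool (replicate (length fs) True) \<Longrightarrow>
      t 7 = enc_list enc_bool (rev (map (\<lambda>f. odd (fst f)) fs)) \<Longrightarrow>
      t 10 = Num (2 ^ length fs) \<Longrightarrow> Q t"
  shows "wp ora M (field_loop k) Q s"
  unfolding field_loop_def
proof (rule wp_list_loop[where xs = fs and f = enc_field and Inv = "\<lambda>ys t.
      t 0 = s 0 \<and> t 3 = s 3 \<and> t 5 = enc_list enc_gate (F (length ys)) \<and>
      t 6 = enc_list enc_bool (replicate (length ys) True) \<and>
      t 7 = enc_list enc_bool (rev (map (\<lambda>f. odd (fst f)) ys)) \<and>
      t 8 = Num (length ys) \<and> t 10 = Num (2 ^ length ys)"])
  fix ys z zs t
  assume fs: "fs = ys @ z # zs"
    and t: "t 0 = s 0 \<and> t 3 = s 3 \<and> t 5 = enc_list enc_gate (F (length ys)) \<and>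
      t 6 = enc_list enc_bool (replicate (length ys) True) \<and>
      t 7 = enc_list enc_bool (rev (map (\<lambda>f. odd (fst f)) ys)) \<and>
      t 8 = Num (length ys) \<and> t 10 = Num (2 ^ length ys)"
    and b: "bounded M t" and t4: "t 4 = Pair (enc_field z) (enc_list enc_field zs)"
  let ?l = "length ys"
  obtain a sg e where z: "z = (a, sg, e)" by (rule prod_cases3)
  define j where "j = (if sg then e * (k - 1) else e) mod k"
  have j: "j < k" using k by (simp add: j_def)
  have F: "F (Suc ?l) = replicate j (PGate ?l) @ F ?l"
    by (simp add: F_def fs z j_def)
  have "F (length fs) = concat (rev (map (\<lambda>v. field_gates k v (fs ! v)) [Suc ?l..<length fs])) @ F (Suc ?l)"
  proof -
    have "[0..<length fs] = [0..<Suc ?l] @ [Suc ?l..<length fs]"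
      using upt_add_eq_append[of 0 "Suc ?l" "length zs"] by (simp add: fs del: upt_Suc)
    then show ?thesis by (simp add: F_def del: upt_Suc)
  qed
  then have size_F: "vsize (enc_list enc_gate (replicate j (PGate ?l) @ F ?l)) \<le> M"
    using size(1) vsize_enc_list_appendD[of enc_gate _ "F (Suc ?l)" M] unfolding F by simp
  have size_6: "vsize (enc_list enc_bool (replicate (Suc ?l) True)) \<le> M"
  proof (rule vsize_enc_list_appendD)
    show "vsize (enc_list enc_bool (replicate (length zs) True @ replicate (Suc ?l) True)) \<le> M"
      using size(2) unfolding replicate_add[symmetric] by (simp only: fs) (simp add: add.commute)
  qed
  have size_7: "vsize (enc_list enc_bool (odd a # rev (map (\<lambda>f. odd (fst f)) ys))) \<le> M"
    using size(3) by (simp only: vsize_enc_list) (simp add: fs z sum_list_rev rev_map[symmetric])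
  have size_8: "vsize (Num (Suc ?l)) \<le> M"
    using size(4) vsize_Num_le[of "Suc ?l"] by (simp add: fs)
  have size_10: "vsize (Num (2 * 2 ^ ?l)) \<le> M"
  proof -
    have "vsize (Num (2 * 2 ^ ?l)) \<le> Suc (Suc (Suc ?l))" by (rule vsize_Num_leI) simp
    then show ?thesis using size(4) by (simp add: fs)
  qed
  have size_9: "vsize (Num j) \<le> M"
    using vsize_Num_le[of j] j k by linarith
  have size_4: "vsize (enc_list enc_field zs) \<le> M"
    using boundedD[OF b, of 4] by (simp add: t4)
  let ?R = "\<lambda>t. (t 0 = s 0 \<and> t 3 = s 3 \<and> t 5 = enc_list enc_gate (F (length (ys @ [z]))) \<and>
      t 6 = enc_list enc_bool (replicate (length (ys @ [z])) True) \<and>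
      t 7 = enc_list enc_bool (rev (map (\<lambda>f. odd (fst f)) (ys @ [z]))) \<and>
      t 8 = Num (length (ys @ [z])) \<and> t 10 = Num (2 ^ length (ys @ [z]))) \<and>
      t 4 = enc_list enc_field zs"
  have repeat: "wp ora M (repeat_gate ;; 8 ::= Plus (Var 8) (Const 1) ;; 4 ::= Snd (Var 4)) ?R u"
    if u: "u = t(6 := Pair (Num 1) (t 6), 7 := Pair (enc_bool (odd a)) (t 7),
      10 := Num (2 * 2 ^ ?l), 9 := Num j)" for u
  proof (rule wp_Seq, rule wp_repeat_gate[where gs = "F ?l" and v = ?l and j = j])
    show "j \<le> M" using j k by linarith
    show "wp ora M (8 ::= Plus (Var 8) (Const 1) ;; 4 ::= Snd (Var 4)) ?R
        (u(5 := enc_list enc_gate (replicate j (PGate ?l) @ F ?l), 9 := Num 0))"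
      using size_8 size_4 t t4 u
      by (intro wp_Seq wp_Assign) (auto simp: F z enc_bool_def)
  qed (use t u size_F in auto)
  show "wp ora M
    (6 ::= MkPair (Const 1) (Var 6) ;;
     7 ::= MkPair (Mod (Fst (Fst (Var 4))) (Const 2)) (Var 7) ;;
     10 ::= Times (Const 2) (Var 10) ;;
     Cond (Fst (Snd (Fst (Var 4))))
       (9 ::= Mod (Times (Snd (Snd (Fst (Var 4)))) (Const (k - 1))) (Const k))
       (9 ::= Mod (Snd (Snd (Fst (Var 4)))) (Const k)) ;;
     repeat_gate ;;
     8 ::= Plus (Var 8) (Const 1) ;;
     4 ::= Snd (Var 4)) ?R t"
  proof (intro wp_Assign_Seq, goal_cases)
    case 4
    let ?t = "t(6 := Pair (Num 1) (t 6), 7 := Pair (enc_bool (odd a)) (t 7), 10 := Num (2 * 2 ^ ?l))"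
    have "wp ora M (Cond (Fst (Snd (Fst (Var 4))))
       (9 ::= Mod (Times (Snd (Snd (Fst (Var 4)))) (Const (k - 1))) (Const k))
       (9 ::= Mod (Snd (Snd (Fst (Var 4)))) (Const k)) ;;
     repeat_gate ;; 8 ::= Plus (Var 8) (Const 1) ;; 4 ::= Snd (Var 4)) ?R ?t"
    proof (rule wp_Seq, rule wp_Cond)
      assume "eval_expr ?t (Fst (Snd (Fst (Var 4)))) \<noteq> Num 0"
      then have "eval_expr ?t (Mod (Times (Snd (Snd (Fst (Var 4)))) (Const (k - 1))) (Const k)) = Num j"
        by (simp add: t4 z enc_bool_def j_def)
      then show "wp ora M (9 ::= Mod (Times (Snd (Snd (Fst (Var 4)))) (Const (k - 1))) (Const k))
          (wp ora M (repeat_gate ;; 8 ::= Plus (Var 8) (Const 1) ;; 4 ::= Snd (Var 4)) ?R) ?t"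
        using size_9 by (intro wp_Assign repeat) simp_all
    next
      assume "eval_expr ?t (Fst (Snd (Fst (Var 4)))) = Num 0"
      then have "eval_expr ?t (Mod (Snd (Snd (Fst (Var 4)))) (Const k)) = Num j"
        by (simp add: t4 z enc_bool_def j_def)
      then show "wp ora M (9 ::= Mod (Snd (Snd (Fst (Var 4)))) (Const k))
          (wp ora M (repeat_gate ;; 8 ::= Plus (Var 8) (Const 1) ;; 4 ::= Snd (Var 4)) ?R) ?t"
        using size_9 by (intro wp_Assign repeat) simp_all
    qed
    then show ?case using t by (simp add: t4 z enc_bool_def mod_2_eq_odd)
  qed (use size_6 size_7 size_10 t in \<open>simp_all add: t4 z enc_bool_def mod_2_eq_odd\<close>)
next
  show "s 0 = s 0 \<and> s 3 = s 3 \<and> s 5 = enc_list enc_gate (F (length [])) \<and>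
      s 6 = enc_list enc_bool (replicate (length []) True) \<and>
      s 7 = enc_list enc_bool (rev (map (\<lambda>f. odd (fst f)) [])) \<and>
      s 8 = Num (length []) \<and> s 10 = Num (2 ^ length [])"
    using s by (simp add: F_def)
qed (use s Q in auto)

lemma wp_edge_loop:
  fixes s :: state
  assumes s: "s 3 = enc_list enc_edge es" "s 5 = enc_list enc_gate gs"
    and size: "vsize (enc_list enc_gate (concat (rev (map (edge_gates k) es)) @ gs)) \<le> M"
    and Q: "Q (s(3 := Num 0, 5 := enc_list enc_gate (concat (rev (map (edge_gates k) es)) @ gs)))"
  shows "wp ora M (edge_loop k) Q s"
  unfolding edge_loop_def
proof (rule wp_list_loop[where xs = es and f = enc_edge and Inv = "\<lambda>ys t.
      t 5 = enc_list enc_gate (concat (rev (map (edge_gates k) ys)) @ gs) \<and> (\<forall>x. x \<noteq> 3 \<longrightarrow> x \<noteq> 5 \<longrightarrow> t x = s x)"])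
  fix ys z zs t
  assume es: "es = ys @ z # zs"
    and t: "t 5 = enc_list enc_gate (concat (rev (map (edge_gates k) ys)) @ gs) \<and>
      (\<forall>x. x \<noteq> 3 \<longrightarrow> x \<noteq> 5 \<longrightarrow> t x = s x)"
    and b: "bounded M t" and t3: "t 3 = Pair (enc_edge z) (enc_list enc_edge zs)"
  obtain u v c where z: "z = (u, v, c)" by (rule prod_cases3)
  let ?gs = "concat (rev (map (edge_gates k) ys)) @ gs"
  have size': "vsize (enc_list enc_gate (edge_gates k z @ ?gs)) \<le> M"
  proof (rule vsize_enc_list_appendD)
    show "vsize (enc_list enc_gate (concat (rev (map (edge_gates k) zs)) @ edge_gates k z @ ?gs)) \<le> M"
      using size by (simp add: es)
  qed
  let ?g = "MkPair (Const 1) (MkPair (Fst (Fst (Var 3))) (Fst (Snd (Fst (Var 3)))))"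
  have push: "eval_expr t (push j ?g (Var 5)) = enc_list enc_gate (replicate j (ZZGate u v) @ ?gs)" for j
    using t t3 z by (intro eval_push) auto
  have size_3: "vsize (enc_list enc_edge zs) \<le> M"
    using boundedD[OF b, of 3] by (simp add: t3)
  let ?R = "\<lambda>t. (t 5 = enc_list enc_gate (concat (rev (map (edge_gates k) (ys @ [z]))) @ gs) \<and>
      (\<forall>x. x \<noteq> 3 \<longrightarrow> x \<noteq> 5 \<longrightarrow> t x = s x)) \<and> t 3 = enc_list enc_edge zs"
  have next_edge: "wp ora M (3 ::= Snd (Var 3)) ?R (t(5 := enc_list enc_gate (edge_gates k z @ ?gs)))"
    using t size_3 by (intro wp_Assign) (simp_all add: t3)
  show "wp ora M (Cond (Equal (Fst (Fst (Var 3))) (Fst (Snd (Fst (Var 3))))) Skip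
       (Cond (Snd (Snd (Fst (Var 3)))) (5 ::= push 1 ?g (Var 5)) (5 ::= push (k - 1) ?g (Var 5))) ;;
     3 ::= Snd (Var 3)) ?R t"
  proof (rule wp_Seq, rule wp_Cond, rule wp_Skip)
    assume "eval_expr t (Equal (Fst (Fst (Var 3))) (Fst (Snd (Fst (Var 3))))) \<noteq> Num 0"
    then have "u = v" by (simp add: t3 z)
    then have "t(5 := enc_list enc_gate (edge_gates k z @ ?gs)) = t" using t by (auto simp: z)
    with next_edge show "wp ora M (3 ::= Snd (Var 3)) ?R t" by simp
  next
    assume "eval_expr t (Equal (Fst (Fst (Var 3))) (Fst (Snd (Fst (Var 3))))) = Num 0"
    then have uv: "u \<noteq> v" by (simp add: t3 z)
    have push_case: "wp ora M (5 ::= push j ?g (Var 5)) (wp ora M (3 ::= Snd (Var 3)) ?R) t"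
      if "edge_gates k z = replicate j (ZZGate u v)" for j
    proof (rule wp_Assign; unfold push)
      show "vsize (enc_list enc_gate (replicate j (ZZGate u v) @ ?gs)) \<le> M"
        using size' by (simp only: that)
      show "wp ora M (3 ::= Snd (Var 3)) ?R (t(5 := enc_list enc_gate (replicate j (ZZGate u v) @ ?gs)))"
        using next_edge by (simp only: that)
    qed
    show "wp ora M (Cond (Snd (Snd (Fst (Var 3)))) (5 ::= push 1 ?g (Var 5))
        (5 ::= push (k - 1) ?g (Var 5))) (wp ora M (3 ::= Snd (Var 3)) ?R) t"
    proof (rule wp_Cond)
      assume "eval_expr t (Snd (Snd (Fst (Var 3)))) \<noteq> Num 0"
      then have c by (simp add: t3 z enc_bool_def)
      then show "wp ora M (5 ::= push 1 ?g (Var 5)) (wp ora M (3 ::= Snd (Var 3)) ?R) t"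
        using uv by (intro push_case) (simp add: z)
    next
      assume "eval_expr t (Snd (Snd (Fst (Var 3)))) = Num 0"
      then have "\<not> c" by (simp add: t3 z enc_bool_def)
      then show "wp ora M (5 ::= push (k - 1) ?g (Var 5)) (wp ora M (3 ::= Snd (Var 3)) ?R) t"
        using uv by (intro push_case) (simp add: z)
    qed
  qed
next
  fix t assume t: "t 5 = enc_list enc_gate (concat (rev (map (edge_gates k) es)) @ gs) \<and>
      (\<forall>x. x \<noteq> 3 \<longrightarrow> x \<noteq> 5 \<longrightarrow> t x = s x)" "t 3 = Num 0"
  then have "t = s(3 := Num 0, 5 := enc_list enc_gate (concat (rev (map (edge_gates k) es)) @ gs))"
    by auto
  then show "Q t" using Q by simp
qed (use s in auto)

section \<open>Size of the circuit query, and reading of oracle answers\<close>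

lemma vsize_enc_gate_le: "diagonal_gate n U \<Longrightarrow> vsize (enc_gate U) \<le> 2 * n + 5"
proof (cases U)
  case (PGate i)
  then show "diagonal_gate n U \<Longrightarrow> ?thesis"
    using floorlog_less_self[of i] by (simp add: floorlog_def[of 2 0])
next
  case (ZZGate i j)
  then show "diagonal_gate n U \<Longrightarrow> ?thesis"
    using floorlog_less_self[of i] floorlog_less_self[of j] by (simp add: floorlog_def[of 2 "Suc 0"])
qed simp

lemma vsize_enc_gate_circuit_le: "(\<forall>U\<in>set Ds. diagonal_gate n U) \<Longrightarrow> U \<in> set ([HAll] @ Ds @ [HAll]) \<Longrightarrow>
    vsize (enc_gate U) \<le> 2 * n + 5"
  using vsize_enc_gate_le[of n U] by (auto simp: floorlog_def)

lemma length_edge_gates_le: "0 < k \<Longrightarrow> length (edge_gates k e) \<le> k"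
  by (cases e) auto

lemma length_field_gates_le: "0 < k \<Longrightarrow> length (field_gates k v f) \<le> k"
  by (cases f) (auto simp: less_imp_le)

lemma length_concat_le: "(\<And>xs. xs \<in> set xss \<Longrightarrow> length xs \<le> k) \<Longrightarrow> length (concat xss) \<le> length xss * k"
proof (induction xss)
  case (Cons xs xss)
  then show ?case using add_mono[of "length xs" k "length (concat xss)"] by simp
qed simp

lemma length_ising_gates_le:
  assumes "0 < k"
  shows "length (ising_gates k es fs) \<le> length es * k + length fs * k"
proof -
  have "length (concat (rev (map (edge_gates k) es))) \<le> length (rev (map (edge_gates k) es)) * k"
    using length_edge_gates_le[OF assms] by (intro length_concat_le) (auto simp del: edge_gates.simps)
  moreover have "length (concat (rev (map (\<lambda>v. field_gates k v (fs ! v)) [0..<length fs]))) \<le>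
      length (rev (map (\<lambda>v. field_gates k v (fs ! v)) [0..<length fs])) * k"
  proof (rule length_concat_le)
    fix xs assume "xs \<in> set (rev (map (\<lambda>v. field_gates k v (fs ! v)) [0..<length fs]))"
    then obtain v where "xs = field_gates k v (fs ! v)" by auto
    then show "length xs \<le> k" by (simp only: length_field_gates_le[OF assms])
  qed
  ultimately show ?thesis
    unfolding ising_gates_def length_append by simp
qed

lemma vsize_enc_bool_list_le: "vsize (enc_list enc_bool xs) \<le> 1 + length xs * 3"
  using vsize_enc_list_le[of xs enc_bool 2] vsize_of_bool by (simp add: enc_bool_def del: vsize.simps)

text \<open>Solutions are defined through some decoding of the query; injectivity of the encoding
  identifies it with the instance that was asked.\<close>

lemma SSimIQP_oracle:
  assumes "solves_within q ora (SSimIQP \<kappa> \<theta>)" "iqp_instance n Us I y"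
  obtains a b where "0 < b" "ora (enc_iqp n Us I y) = Pair (enc_int a) (Num b)"
    "marginal_prob \<theta> n Us I y / \<kappa> \<le> real_of_int a / real b"
    "real_of_int a / real b \<le> \<kappa> * marginal_prob \<theta> n Us I y"
    "vsize (ora (enc_iqp n Us I y)) \<le> poly q (vsize (enc_iqp n Us I y))"
proof -
  let ?w = "enc_iqp n Us I y"
  have "?w \<in> instances (SSimIQP \<kappa> \<theta>)" using assms(2) by (auto simp: SSimIQP_def)
  then have sol: "ora ?w \<in> solutions (SSimIQP \<kappa> \<theta>) ?w" and size: "vsize (ora ?w) \<le> poly q (vsize ?w)"
    using assms(1) unfolding solves_within_def by blast+
  then obtain n' Us' I' y' p where *: "iqp_instance n' Us' I' y'" "?w = enc_iqp n' Us' I' y'"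
      "represents_rat (ora ?w) p" "approximates \<kappa> (marginal_prob \<theta> n' Us' I' y') p"
    unfolding SSimIQP_def by force
  have "n = n' \<and> Us = Us' \<and> I = I' \<and> y = y'"
    using *(1,2) assms(2) enc_iqp_inject[of I n I' n' Us y Us' y'] by (auto simp: iqp_instance_def)
  moreover obtain a b where "0 < b" "ora ?w = Pair (enc_int a) (Num b)" "p = of_int a / of_nat b"
    using *(3) unfolding represents_rat_def by blast
  ultimately show thesis
    using *(4) size by (intro that[of b a]) (simp_all add: approximates_def of_rat_divide)
qed

lemma IQPIsing_oracle:
  assumes "solves_within q ora (IQPIsing \<kappa> \<alpha>)" "ising_instance n es fs"
  obtains a b where "0 < b" "ora (enc_ising n es fs) = Pair (enc_int a) (Num b)"
    "cmod (ising_value \<alpha> n es fs) / \<kappa> \<le> real_of_int a / real b"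
    "real_of_int a / real b \<le> \<kappa> * cmod (ising_value \<alpha> n es fs)"
    "vsize (ora (enc_ising n es fs)) \<le> poly q (vsize (enc_ising n es fs))"
proof -
  let ?w = "enc_ising n es fs"
  have "?w \<in> instances (IQPIsing \<kappa> \<alpha>)" using assms(2) by (auto simp: IQPIsing_def)
  then have sol: "ora ?w \<in> solutions (IQPIsing \<kappa> \<alpha>) ?w" and size: "vsize (ora ?w) \<le> poly q (vsize ?w)"
    using assms(1) unfolding solves_within_def by blast+
  then obtain n' es' fs' p where *: "?w = enc_ising n' es' fs'"
      "represents_rat (ora ?w) p" "approximates \<kappa> (cmod (ising_value \<alpha> n' es' fs')) p"
    unfolding IQPIsing_def by force
  have "n = n' \<and> es = es' \<and> fs = fs'" using *(1) by (simp add: enc_ising_inject)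
  moreover obtain a b where "0 < b" "ora ?w = Pair (enc_int a) (Num b)" "p = of_int a / of_nat b"
    using *(2) unfolding represents_rat_def by blast
  ultimately show thesis
    using *(3) size by (intro that[of b a]) (simp_all add: approximates_def of_rat_divide)
qed

text \<open>The summands are the pair nodes with the qubit count, at most
  \<open>2 * (L * k) + 2\<close> gates of size at most \<open>2 * L + 5\<close>, and two bit
  lists.\<close>

definition iqp_query_bound :: "nat \<Rightarrow> nat \<Rightarrow> nat" where
  "iqp_query_bound k L = (L + 4) + (1 + (2 * (L * k) + 2) * (1 + (2 * L + 5))) + (1 + L * 3) + (1 + L * 3)"

lemma vsize_iqp_query_le:
  assumes "ising_instance n es fs" "0 < k" "n \<le> L" "length es \<le> L" "length y = n"
  shows "vsize (enc_iqp n ([HAll] @ ising_gates k es fs @ [HAll]) {..<n} y) \<le> iqp_query_bound k L"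
proof -
  let ?Us = "[HAll] @ ising_gates k es fs @ [HAll]"
  have "vsize (enc_list enc_gate ?Us) \<le> 1 + length ?Us * (1 + (2 * n + 5))"
    by (rule vsize_enc_list_le) (rule vsize_enc_gate_circuit_le[OF diagonal_ising_gates[OF assms(1)]])
  also have "\<dots> \<le> 1 + (2 * (L * k) + 2) * (1 + (2 * L + 5))"
  proof (intro add_left_mono mult_le_mono)
    have "length es * k \<le> L * k" "length fs * k \<le> L * k"
      using assms by (auto simp: ising_instance_def)
    moreover have "length ?Us = length (ising_gates k es fs) + 2" by simp
    ultimately show "length ?Us \<le> 2 * (L * k) + 2"
      using length_ising_gates_le[OF assms(2), of es fs] by linarith
  qed (use assms in simp)
  finally show ?thesis
    using vsize_enc_bool_list_le[of "map (\<lambda>i. i \<in> {..<n}) [0..<n]"] vsize_enc_bool_list_le[of y]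
      vsize_Num_le[of n] assms
    by (simp add: enc_iqp_def iqp_query_bound_def del: vsize.simps(1))
qed

text \<open>A sum in place of a maximum, so that it is a polynomial; the multiple of
  \<open>root_size\<close> covers the answer, the search and the output fraction.\<close>

definition ising_program_bound :: "nat \<Rightarrow> nat \<Rightarrow> nat poly \<Rightarrow> nat \<Rightarrow> nat" where
  "ising_program_bound k r q L = iqp_query_bound k L + k + L + 4 +
     3 * root_size r (poly q (iqp_query_bound k L))"

lemma root_size_mono: "V \<le> W \<Longrightarrow> root_size r V \<le> root_size r W"
  unfolding root_size_def by (intro add_mono mult_le_mono) auto

lemma le_root_size: "V \<le> root_size r V"
  by (simp add: root_size_def)

lemma represents_rat_of_nat:
  "0 < b \<Longrightarrow> represents_rat (Pair (Pair (Num 0) (Num a)) (Num b)) (of_nat a / of_nat b)"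
  unfolding represents_rat_def
  by (intro exI[of _ "int a"] exI[of _ b]) (simp add: enc_int_def enc_bool_def)

lemma wp_ising_program:
  assumes "0 < k" "cis \<theta> ^ k = 1" "0 < r" "(1 + 1 / real r) ^ 2 * \<kappa> powr (1 / 2) \<le> \<kappa>\<^sup>2" "1 < \<kappa>"
    and inst: "ising_instance n es fs" and x: "x = enc_ising n es fs"
    and ora: "solves_within q ora (SSimIQP (\<kappa> powr (1 / 2)) \<theta>)"
    and M: "ising_program_bound k r q (vsize x) \<le> M"
  shows "wp ora M (ising_program k r) (\<lambda>s. s 0 \<in> solutions (IQPIsing \<kappa> (2 * \<theta>)) x) (init_state x)"
proof -
  define L where "L = vsize x"
  define Ds where "Ds = ising_gates k es fs"
  define Us where "Us = [HAll] @ Ds @ [HAll]"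
  define y where "y = map (\<lambda>f. odd (fst f)) fs"
  define w where "w = enc_iqp n Us {..<n} y"
  have n: "length fs = n" using inst by (simp add: ising_instance_def)
  have y: "length y = n" by (simp add: y_def n)
  have L: "length es \<le> L" "n \<le> L" "vsize (enc_list enc_edge es) \<le> L" "vsize (enc_list enc_field fs) \<le> L"
    using length_le_vsize_enc_list[of es enc_edge] length_le_vsize_enc_list[of fs enc_field]
    by (simp_all add: L_def x enc_ising_def n)
  have w_size: "vsize w \<le> iqp_query_bound k L"
    unfolding w_def Us_def Ds_def by (rule vsize_iqp_query_le[OF inst assms(1) L(2,1) y])
  let ?V = "poly q (iqp_query_bound k L)"
  have MB: "iqp_query_bound k L + k + L + 4 + 3 * root_size r ?V \<le> M"
    using M by (simp add: ising_program_bound_def L_def)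
  have iqp: "iqp_instance n Us {..<n} y"
    using diagonal_ising_gates[OF inst, of k] y
    by (auto simp: iqp_instance_def iqp_circuit_def Us_def Ds_def)
  define P where "P = marginal_prob \<theta> n Us {..<n} y"
  obtain a b where ab: "0 < b" "ora w = Pair (enc_int a) (Num b)" "P / \<kappa> powr (1 / 2) \<le> real_of_int a / b"
      "real_of_int a / b \<le> \<kappa> powr (1 / 2) * P" and "vsize (ora w) \<le> poly q (vsize w)"
    using SSimIQP_oracle[OF ora iqp] unfolding w_def P_def by blast
  then have ora_size: "vsize (ora w) \<le> ?V"
    using poly_nat_mono[OF w_size, of q] by linarith
  have Z: "(cmod (ising_value (2 * \<theta>) n es fs))\<^sup>2 = 4 ^ n * P"
    using ising_to_iqp[OF inst assms(2,1)] by (simp add: P_def Us_def Ds_def y_def)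
  \<comment> \<open>The square root of the probability. The search estimates \<open>X\<close>, and
    \<open>2 ^ n\<close> is multiplied back afterwards without changing the relative error.\<close>
  define X where "X = cmod (ising_value (2 * \<theta>) n es fs) / 2 ^ n"
  have "((2::real) ^ n)\<^sup>2 = 4 ^ n" by (simp add: power_even_eq[symmetric] power2_eq_square flip: power_mult_distrib)
  then have X: "P = X\<^sup>2" using Z by (simp add: X_def power_divide)
  note approx = ab(3,4)[unfolded X]
  have "0 \<le> real_of_int a / b"
    by (rule order.trans[OF _ approx(1)]) simp
  then have a: "0 \<le> a" using ab(1) by (simp add: zero_le_divide_iff)
  \<comment> \<open>The gate list between the two loops, a suffix of the circuit.\<close>
  define w' where "w' = concat (rev (map (\<lambda>v. field_gates k v (fs ! v)) [0..<length fs])) @ [HAll]"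
  have Us: "Us = HAll # concat (rev (map (edge_gates k) es)) @ w'"
    by (simp add: Us_def Ds_def ising_gates_def w'_def)
  have bits: "map (\<lambda>i. i \<in> {..<n}) [0..<n] = replicate n True"
    by (rule nth_equalityI) auto
  have sizes: "vsize (enc_list enc_gate Us) \<le> M" "vsize (enc_list enc_bool (replicate n True)) \<le> M"
      "vsize (enc_list enc_bool y) \<le> M" "vsize w \<le> M"
    using w_size MB unfolding w_def enc_iqp_def bits by simp_all
  have sizes': "vsize (enc_list enc_gate (concat (rev (map (edge_gates k) es)) @ w')) \<le> M"
      "vsize (enc_list enc_gate w') \<le> M"
    using sizes(1) vsize_enc_list_appendD[of enc_gate "HAll # concat (rev (map (edge_gates k) es))" w' M]
    by (simp_all add: Us)
  \<comment> \<open>The program is verified from its end: each of the following claims covers the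
    remaining commands and constrains only the variables that they still need.\<close>
  have finish: "wp ora M (root_program 2 r ;; 0 ::= MkPair (MkPair (Const 0) (Times (Var 1) (Var 10))) (Var 2))
      (\<lambda>s. s 0 \<in> solutions (IQPIsing \<kappa> (2 * \<theta>)) x) s"
    if s: "s 0 = ora w" "s 10 = Num (2 ^ n)" for s
  proof (rule wp_Seq, rule wp_root_program[of s a b])
    have le: "root_size r (vsize (s 0)) \<le> root_size r ?V"
      unfolding s by (rule root_size_mono[OF ora_size])
    then show "root_size r (vsize (s 0)) \<le> M" using MB by linarith
    fix u v :: nat
    assume uv: "0 < v" "vsize (Num u) \<le> root_size r (vsize (s 0))"
      "vsize (Num v) \<le> root_size r (vsize (s 0))"
      "real_of_int a / b \<le> (real u / real v)\<^sup>2"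
      "(real u / real v)\<^sup>2 \<le> (1 + 1 / real r)\<^sup>2 * (real_of_int a / b)"
    let ?s = "s(1 := Num u, 2 := Num v)"
    have "vsize (Num (u * 2 ^ n)) \<le> vsize (Num u) + Suc n"
      using floorlog_mult[of u "2 ^ n"] vsize_Num_leI[of "2 ^ n" "Suc n"] by simp
    then have size: "vsize (Pair (Pair (Num 0) (Num (u * 2 ^ n))) (Num v)) \<le> M"
      using uv(2,3) le MB L(2) by (simp add: floorlog_def)
    have X0: "0 \<le> X" by (simp add: X_def)
    have "X / \<kappa> \<le> real u / real v" "real u / real v \<le> \<kappa> * X"
      by (rule approximate_root[OF approx uv(4,5)]; use X0 assms(3-5) in simp)+
    then have "2 ^ n * (X / \<kappa>) \<le> 2 ^ n * (real u / real v)" "2 ^ n * (real u / real v) \<le> 2 ^ n * (\<kappa> * X)"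
      by (simp_all only: mult_left_mono zero_le_power zero_le_numeral)
    then have "approximates \<kappa> (cmod (ising_value (2 * \<theta>) n es fs)) (of_nat (u * 2 ^ n) / of_nat v)"
      by (simp add: approximates_def X_def of_rat_divide of_rat_mult of_rat_power mult_ac)
    moreover have "represents_rat (Pair (Pair (Num 0) (Num (u * 2 ^ n))) (Num v))
        (of_nat (u * 2 ^ n) / of_nat v)"
      by (rule represents_rat_of_nat[OF uv(1)])
    ultimately have "Pair (Pair (Num 0) (Num (u * 2 ^ n))) (Num v) \<in> solutions (IQPIsing \<kappa> (2 * \<theta>)) x"
      using inst by (auto simp: IQPIsing_def x)
    then show "wp ora M (0 ::= MkPair (MkPair (Const 0) (Times (Var 1) (Var 10))) (Var 2))
        (\<lambda>s. s 0 \<in> solutions (IQPIsing \<kappa> (2 * \<theta>)) x) ?s"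
      using size s(2) by (intro wp_Assign) (simp_all del: vsize.simps)
  qed (use s ab a assms(3) in auto)
  have query: "wp ora M (5 ::= MkPair (Const 0) (Var 5) ;;
      reverse 7 11 ;;
      Query 0 (MkPair (Fst (Var 0)) (MkPair (Var 5) (MkPair (Var 6) (Var 11)))) ;;
      root_program 2 r ;;
      0 ::= MkPair (MkPair (Const 0) (Times (Var 1) (Var 10))) (Var 2))
      (\<lambda>s. s 0 \<in> solutions (IQPIsing \<kappa> (2 * \<theta>)) x) s"
    if s: "s 0 = x" "s 5 = enc_list enc_gate (concat (rev (map (edge_gates k) es)) @ w')"
      "s 6 = enc_list enc_bool (replicate n True)" "s 7 = enc_list enc_bool (rev y)" "s 10 = Num (2 ^ n)" for s
  proof (intro wp_Seq wp_Assign, goal_cases)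
    case 1
    show ?case using sizes(1) by (simp add: s Us)
  next
    case 2
    show ?case
    proof (rule wp_reverse[where f = enc_bool and xs = "rev y"], goal_cases)
      case 3
      let ?s = "s(5 := eval_expr s (MkPair (Const 0) (Var 5)), 7 := Num 0, 11 := enc_list enc_bool (rev (rev y)))"
      have q: "eval_expr ?s (MkPair (Fst (Var 0)) (MkPair (Var 5) (MkPair (Var 6) (Var 11)))) = w"
        by (simp add: s x enc_ising_def w_def enc_iqp_def bits[simplified] Us)
      show ?case
      proof (rule wp_Seq, rule wp_Query)
        show "vsize (ora (eval_expr ?s (MkPair (Fst (Var 0)) (MkPair (Var 5) (MkPair (Var 6) (Var 11)))))) \<le> M"
          unfolding q using ora_size le_root_size[of ?V r] MB by linarith
      qed (rule finish, unfold q, simp_all add: s)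
    qed (simp_all add: s)
  qed
  have edges: "wp ora M (edge_loop k ;; 5 ::= MkPair (Const 0) (Var 5) ;;
      reverse 7 11 ;;
      Query 0 (MkPair (Fst (Var 0)) (MkPair (Var 5) (MkPair (Var 6) (Var 11)))) ;;
      root_program 2 r ;;
      0 ::= MkPair (MkPair (Const 0) (Times (Var 1) (Var 10))) (Var 2))
      (\<lambda>s. s 0 \<in> solutions (IQPIsing \<kappa> (2 * \<theta>)) x) s"
    if "s 0 = x" "s 3 = enc_list enc_edge es" "s 5 = enc_list enc_gate w'"
      "s 6 = enc_list enc_bool (replicate n True)" "s 7 = enc_list enc_bool (rev y)" "s 10 = Num (2 ^ n)" for s
  proof (rule wp_Seq, rule wp_edge_loop[where gs = w' and es = es], goal_cases)
    case 4
    show ?case by (rule query) (simp_all add: that)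
  qed (use that sizes' in simp_all)
  have M4: "4 \<le> M" "n + 2 \<le> M" "Suc k \<le> M" "L \<le> M" using MB L(2) by simp_all
  have init: "init_state x 0 = x" "\<And>i. i \<noteq> 0 \<Longrightarrow> init_state x i = Num 0"
    by (simp_all add: init_state_def)
  let ?s = "(init_state x)(3 := enc_list enc_edge es, 4 := enc_list enc_field fs,
      5 := enc_list enc_gate [HAll], 10 := Num 1)"
  have loops: "wp ora M (field_loop k ;; edge_loop k ;; 5 ::= MkPair (Const 0) (Var 5) ;;
      reverse 7 11 ;;
      Query 0 (MkPair (Fst (Var 0)) (MkPair (Var 5) (MkPair (Var 6) (Var 11)))) ;;
      root_program 2 r ;;
      0 ::= MkPair (MkPair (Const 0) (Times (Var 1) (Var 10))) (Var 2))
      (\<lambda>s. s 0 \<in> solutions (IQPIsing \<kappa> (2 * \<theta>)) x) ?s"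
  proof (rule wp_Seq, rule wp_field_loop[where fs = fs, folded y_def], goal_cases)
    case (13 t)
    show ?case by (rule edges) (use 13 in \<open>simp_all add: init n w'_def\<close>)
  qed (use assms(1) M4 sizes sizes' in \<open>simp_all add: init n w'_def del: vsize.simps\<close>)
  have input: "val_fst (val_snd x) = enc_list enc_edge es" "val_snd (val_snd x) = enc_list enc_field fs"
    by (simp_all add: x enc_ising_def)
  have es: "vsize (enc_list enc_edge es) \<le> M" and fs: "vsize (enc_list enc_field fs) \<le> M"
    using L(3,4) M4(4) by linarith+
  show ?thesis
    unfolding ising_program_def
    by (intro wp_Assign_Seq)
      (use loops es fs M4 in \<open>simp_all add: init input floorlog_def\<close>)
qed

section \<open>The program reducing IQP circuits to Ising instances\<close>

text \<open>The number of copies is fixed in the program text, so the repetition is unrolled and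
  needs no counter.\<close>

fun repeat_com :: "nat \<Rightarrow> com \<Rightarrow> com" where
  "repeat_com 0 c = Skip"
| "repeat_com (Suc k) c = c ;; repeat_com k c"

lemma wp_repeat_com:
  assumes "\<And>j s. j < k \<Longrightarrow> Inv j s \<Longrightarrow> wp ora M c (Inv (Suc j)) s"
    and "Inv 0 s" and "\<And>s. Inv k s \<Longrightarrow> Q s"
  shows "wp ora M (repeat_com k c) Q s"
  using assms
proof (induction k arbitrary: Inv s)
  case 0
  then show ?case by (simp add: wp_Skip)
next
  case (Suc k)
  have "wp ora M (repeat_com k c) Q t" if "Inv (Suc 0) t" for t
    by (rule Suc.IH[of "\<lambda>j. Inv (Suc j)"]) (use Suc.prems that in auto)
  then show ?case
    using Suc.prems(1)[of 0 s] Suc.prems(2) by (auto intro!: wp_Seq elim: wp_mono)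
qed

text \<open>Variables: \<open>3\<close> gates, \<open>4\<close> bit vector of the measured qubits, \<open>5\<close> edges, \<open>6\<close> reversed fields,
  \<open>7\<close> first vertex of the current copy, \<open>8\<close> loop pointer, \<open>9\<close> and \<open>10\<close> qubits of the current gate, \<open>11\<close>
  and \<open>12\<close> their second copies, \<open>13\<close> and \<open>14\<close> lookup pointer and counter, \<open>15\<close> number of qubits including
  the ancilla, \<open>16\<close> power of four, \<open>17\<close> unread outcome bits and later the fields, \<open>18\<close> outcome. Looking up
  the ancilla runs off the end of the bit vector and reads \<open>Num 0\<close>.\<close>

definition lookup :: "nat \<Rightarrow> nat \<Rightarrow> com" where
  "lookup a b =
    13 ::= Var 4 ;;
    14 ::= Var a ;;
    While (Less (Const 0) (Var 14)) (13 ::= Snd (Var 13) ;; 14 ::= Minus (Var 14) (Const 1)) ;;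
    b ::= Plus (Var a) (Times (Fst (Var 13)) (Var 15))"

text \<open>Hadamard layers are encoded by an atom and skipped. The ancilla of a \<open>P\<close>
  gate is the qubit count, read from the input.\<close>

definition gate_loop :: com where
  "gate_loop =
    8 ::= Var 3 ;;
    While (IsPair (Var 8))
      (Cond (IsPair (Fst (Var 8)))
         (Cond (Fst (Fst (Var 8)))
           (9 ::= Fst (Snd (Fst (Var 8))) ;; 10 ::= Snd (Snd (Fst (Var 8))))
           (9 ::= Snd (Fst (Var 8)) ;; 10 ::= Fst (Var 0)) ;;
          lookup 9 11 ;;
          lookup 10 12 ;;
          5 ::= MkPair (MkPair (Plus (Var 7) (Var 9)) (MkPair (Plus (Var 7) (Var 10)) (Const 1)))
            (MkPair (MkPair (Plus (Var 7) (Var 11)) (MkPair (Plus (Var 7) (Var 12)) (Const 0)))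
              (Var 5)))
         Skip ;;
       8 ::= Snd (Var 8))"

text \<open>Outcome bits are consumed at measured positions only; the last assignment adds the field
  of the ancilla.\<close>

definition bit_loop :: com where
  "bit_loop =
    8 ::= Var 4 ;;
    17 ::= Var 18 ;;
    While (IsPair (Var 8))
      (Cond (Fst (Var 8))
         (6 ::= MkPair (MkPair (Fst (Var 17)) (MkPair (Const 0) (Const 0))) (Var 6) ;; 17 ::= Snd (Var 17))
         (6 ::= MkPair (MkPair (Const 0) (MkPair (Const 0) (Const 0))) (Var 6)) ;;
       8 ::= Snd (Var 8)) ;;
    6 ::= MkPair (MkPair (Const 0) (MkPair (Const 0) (Const 0))) (Var 6)"

definition power_loop :: com where
  "power_loop =
    8 ::= Var 4 ;;
    While (IsPair (Var 8)) (16 ::= Times (Const 4) (Var 16) ;; 8 ::= Snd (Var 8))"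

text \<open>After \<open>k\<close> rounds the first free vertex in variable 7 is the vertex count of
  the query. The power of four is divided out by enlarging the denominator.\<close>

definition iqp_program :: "nat \<Rightarrow> nat \<Rightarrow> com" where
  "iqp_program k r =
    3 ::= Fst (Snd (Var 0)) ;;
    4 ::= Fst (Snd (Snd (Var 0))) ;;
    18 ::= Snd (Snd (Snd (Var 0))) ;;
    15 ::= Plus (Fst (Var 0)) (Const 1) ;;
    16 ::= Const 4 ;;
    repeat_com k (gate_loop ;; 7 ::= Plus (Var 7) (Times (Const 2) (Var 15))) ;;
    repeat_com (2 * k) bit_loop ;;
    power_loop ;;
    reverse 6 17 ;;
    Query 0 (MkPair (Var 7) (MkPair (Var 5) (Var 17))) ;;
    root_program k r ;;
    0 ::= MkPair (MkPair (Const 0) (Var 1)) (Times (Var 2) (Var 16))"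

section \<open>Correctness of the loops that build the Ising instance\<close>

lemma val_snd_enc_list: "val_snd (enc_list f xs) = enc_list f (tl xs)"
  by (cases xs) auto

lemma val_fst_enc_bool_drop:
  "val_fst (enc_list enc_bool (drop i xs)) = Num (of_bool (i < length xs \<and> xs ! i))"
proof (cases "i < length xs")
  case True
  then show ?thesis by (simp add: Cons_nth_drop_Suc[symmetric] enc_bool_def)
qed simp

lemma vsize_enc_list_drop_le: "vsize (enc_list f (drop i xs)) \<le> vsize (enc_list f xs)"
  using vsize_enc_list_append_le[of f "drop i xs" "take i xs"] by simp

lemma wp_lookup:
  assumes s: "s 4 = enc_list enc_bool m" "s a = Num i" "s 15 = Num (Suc (length m))"
    and i: "i \<le> length m"
    and a: "a \<notin> {13, 14}" and M: "2 * length m + 3 \<le> M"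
    and Q: "\<And>t. (\<And>x. x \<notin> {13, 14, b} \<Longrightarrow> t x = s x) \<Longrightarrow> t b = Num (copy_vertex m i) \<Longrightarrow> Q t"
  shows "wp ora M (lookup a b) Q s"
  unfolding lookup_def
proof (rule wp_bounded)
  assume b: "bounded M s"
  have sm: "vsize (enc_list enc_bool m) \<le> M" using boundedD[OF b, of 4] s(1) by simp
  have si: "vsize (Num i) \<le> M" using boundedD[OF b, of a] s(2) by simp
  let ?c = "13 ::= Snd (Var 13) ;; 14 ::= Minus (Var 14) (Const 1)"
  let ?Inv = "\<lambda>c t. c \<le> i \<and> t = s(13 := enc_list enc_bool (drop (i - c) m), 14 := Num c)"
  have loop: "wp ora M (While (Less (Const 0) (Var 14)) ?c ;;
      b ::= Plus (Var a) (Times (Fst (Var 13)) (Var 15))) Q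
      (s(13 := enc_list enc_bool m, 14 := Num i))"
  proof (rule wp_Seq, rule wp_While[where Inv = ?Inv and k = i])
    fix c t assume t: "?Inv (Suc c) t"
    have ic: "i - c = Suc (i - Suc c)" using t by linarith
    have "vsize (Num c) \<le> M" using vsize_Num_mono[of c i] t si by simp
    then have "wp ora M ?c (?Inv c) t"
      using vsize_enc_list_drop_le[of enc_bool "i - c" m] sm t
      by (intro wp_Seq wp_Assign)
        (auto simp: val_snd_enc_list ic drop_Suc tl_drop fun_upd_twist simp del: vsize.simps)
    then show "eval_expr t (Less (Const 0) (Var 14)) \<noteq> Num 0 \<and> wp ora M ?c (?Inv c) t"
      using t by simp
  next
    fix t assume t: "?Inv 0 t"
    \<comment> \<open>\<open>copy_vertex\<close> is computed without a case distinction, as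
      \<open>i\<close> plus the mask bit times the offset \<open>Suc (length m)\<close>.\<close>
    have "eval_expr t (Plus (Var a) (Times (Fst (Var 13)) (Var 15))) = Num (copy_vertex m i)"
      using t s a by (auto simp: val_fst_enc_bool_drop copy_vertex_def)
    moreover have "vsize (Num (copy_vertex m i)) \<le> M"
      using vsize_Num_le[of "copy_vertex m i"] M i by (auto simp: copy_vertex_def simp del: vsize.simps)
    ultimately have "wp ora M (b ::= Plus (Var a) (Times (Fst (Var 13)) (Var 15))) Q t"
      using t by (intro wp_Assign Q) (auto simp del: eval_expr.simps)
    then show "eval_expr t (Less (Const 0) (Var 14)) = Num 0 \<and>
        wp ora M (b ::= Plus (Var a) (Times (Fst (Var 13)) (Var 15))) Q t"
      using t by simp
  qed (use M i in auto)
  show "wp ora M (13 ::= Var 4 ;; 14 ::= Var a ;; While (Less (Const 0) (Var 14)) ?c ;;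
      b ::= Plus (Var a) (Times (Fst (Var 13)) (Var 15))) Q s"
    by (intro wp_Assign_Seq) (use loop s a sm si in auto)
qed

text \<open>Extends the translation by no edges for \<open>HAll\<close>, because the loop runs over
  the complete circuit.\<close>

definition gate_edges :: "bool list \<Rightarrow> gate \<Rightarrow> edge list" where
  "gate_edges m U = (if U = HAll then [] else circuit_edges m U)"

lemma wp_gate_loop:
  fixes s :: state and M :: nat
  assumes s: "s 3 = enc_list enc_gate Us" "s 4 = enc_list enc_bool m" "val_fst (s 0) = Num (length m)"
      "s 7 = Num n" "s 15 = Num (Suc (length m))" "s 5 = enc_list enc_edge es"
    and Us: "\<And>U. U \<in> set Us \<Longrightarrow> U = HAll \<or> diagonal_gate (length m) U"
    and size: "vsize (enc_list enc_edge (rev (map (shift n) (concat (map (gate_edges m) Us))) @ es)) \<le> M"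
    and M: "2 * length m + 3 \<le> M"
    and Q: "\<And>t. (\<And>x. x \<notin> {5, 8, 9, 10, 11, 12, 13, 14} \<Longrightarrow> t x = s x) \<Longrightarrow>
      t 5 = enc_list enc_edge (rev (map (shift n) (concat (map (gate_edges m) Us))) @ es) \<Longrightarrow> Q t"
  shows "wp ora M gate_loop Q s"
proof (rule wp_bounded)
  assume b: "bounded M s"
  let ?E = "\<lambda>Us. rev (map (shift n) (concat (map (gate_edges m) Us))) @ es"
  let ?Inv = "\<lambda>ys t. (\<forall>x. x \<notin> {5, 8, 9, 10, 11, 12, 13, 14} \<longrightarrow> t x = s x) \<and> t 5 = enc_list enc_edge (?E ys)"
  let ?push = "5 ::= MkPair (MkPair (Plus (Var 7) (Var 9)) (MkPair (Plus (Var 7) (Var 10)) (Const 1)))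
            (MkPair (MkPair (Plus (Var 7) (Var 11)) (MkPair (Plus (Var 7) (Var 12)) (Const 0)))
              (Var 5))"
  let ?load = "Cond (Fst (Fst (Var 8)))
           (9 ::= Fst (Snd (Fst (Var 8))) ;; 10 ::= Snd (Snd (Fst (Var 8))))
           (9 ::= Snd (Fst (Var 8)) ;; 10 ::= Fst (Var 0))"
  let ?body = "Cond (IsPair (Fst (Var 8)))
         (?load ;; lookup 9 11 ;; lookup 10 12 ;; ?push) Skip ;;
       8 ::= Snd (Var 8)"
  have loop: "wp ora M (While (IsPair (Var 8)) ?body) Q (s(8 := enc_list enc_gate Us))"
  proof (rule wp_list_loop[where xs = Us and f = enc_gate and Inv = ?Inv])
    fix ys U zs t
    assume split: "Us = ys @ U # zs" and t: "?Inv ys t" and bt: "bounded M t"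
      and t8: "t 8 = Pair (enc_gate U) (enc_list enc_gate zs)"
    let ?R = "\<lambda>t. ?Inv (ys @ [U]) t \<and> t 8 = enc_list enc_gate zs"
    have size8: "vsize (enc_list enc_gate zs) \<le> M" using boundedD[OF bt, of 8] by (simp add: t8)
    have next_gate: "wp ora M (8 ::= Snd (Var 8)) ?R u"
      if "u 8 = t 8" "?Inv (ys @ [U]) u" for u
      using that size8 by (intro wp_Assign) (simp_all add: t8)
    show "wp ora M ?body ?R t"
    proof (rule wp_Seq, rule wp_Cond)
      assume "eval_expr t (IsPair (Fst (Var 8))) = Num 0"
      then have "U = HAll" by (cases U) (simp_all add: t8)
      then show "wp ora M Skip (wp ora M (8 ::= Snd (Var 8)) ?R) t"
        using t by (intro wp_Skip next_gate) (simp_all add: gate_edges_def)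
    next
      assume "eval_expr t (IsPair (Fst (Var 8))) \<noteq> Num 0"
      then have U: "U \<noteq> HAll" by (cases U) (simp_all add: t8)
      then have diag: "diagonal_gate (length m) U" using Us[of U] by (auto simp: split)
      obtain i j where ij: "gate_ends (length m) U = (i, j)" by fastforce
      have le: "i \<le> length m" "j \<le> length m" using diag ij by (cases U; auto)+
      have small: "vsize (Num i) \<le> M" "vsize (Num j) \<le> M"
        using vsize_Num_le[of i] vsize_Num_le[of j] le M by linarith+
      have E: "?E (ys @ [U]) = (n + i, n + j, True) #
          (n + copy_vertex m i, n + copy_vertex m j, False) # ?E ys"
        using U by (simp add: gate_edges_def circuit_edges_def ij)
      have "vsize (enc_list enc_edge (rev (map (shift n) (concat (map (gate_edges m) zs))) @ ?E (ys @ [U]))) \<le> M"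
        using size by (simp add: split)
      then have size5: "vsize (enc_list enc_edge (?E (ys @ [U]))) \<le> M"
        by (rule vsize_enc_list_appendD)
      have push: "wp ora M ?push (wp ora M (8 ::= Snd (Var 8)) ?R) u"
        if u: "\<And>x. x \<notin> {9, 10, 11, 12, 13, 14} \<Longrightarrow> u x = t x" "u 9 = Num i" "u 10 = Num j"
          "u 11 = Num (copy_vertex m i)" "u 12 = Num (copy_vertex m j)" for u
      proof -
        have "eval_expr u (MkPair (MkPair (Plus (Var 7) (Var 9)) (MkPair (Plus (Var 7) (Var 10)) (Const 1)))
            (MkPair (MkPair (Plus (Var 7) (Var 11)) (MkPair (Plus (Var 7) (Var 12)) (Const 0)))
              (Var 5))) = enc_list enc_edge (?E (ys @ [U]))"
          unfolding E using u t s(4) by (simp add: enc_bool_def)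
        then show ?thesis
          using size5 u t by (intro next_gate wp_Assign) (simp_all del: eval_expr.simps)
      qed
      have lookups: "wp ora M (lookup 9 11 ;; lookup 10 12 ;; ?push) (wp ora M (8 ::= Snd (Var 8)) ?R) u"
        if u: "u = t(9 := Num i, 10 := Num j)" for u
      proof (rule wp_Seq, rule wp_lookup[where m = m and i = i])
        fix v assume v: "\<And>x. x \<notin> {13, 14, 11} \<Longrightarrow> v x = u x" "v 11 = Num (copy_vertex m i)"
        show "wp ora M (lookup 10 12 ;; ?push) (wp ora M (8 ::= Snd (Var 8)) ?R) v"
        proof (rule wp_Seq, rule wp_lookup[where m = m and i = j])
          fix w assume w: "\<And>x. x \<notin> {13, 14, 12} \<Longrightarrow> w x = v x" "w 12 = Num (copy_vertex m j)"
          show "wp ora M ?push (wp ora M (8 ::= Snd (Var 8)) ?R) w"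
            by (rule push) (use u v w in auto)
        qed (use u v t s le M in auto)
      qed (use u t s le M in auto)
      have "wp ora M ?load (wp ora M (lookup 9 11 ;; lookup 10 12 ;; ?push)
          (wp ora M (8 ::= Snd (Var 8)) ?R)) t"
      proof (rule wp_Cond)
        assume "eval_expr t (Fst (Fst (Var 8))) \<noteq> Num 0"
        then have "U = ZZGate i j" using U ij by (cases U) (simp_all add: t8)
        then show "wp ora M (9 ::= Fst (Snd (Fst (Var 8))) ;; 10 ::= Snd (Snd (Fst (Var 8))))
            (wp ora M (lookup 9 11 ;; lookup 10 12 ;; ?push) (wp ora M (8 ::= Snd (Var 8)) ?R)) t"
          using small by (intro wp_Seq[of ora M "9 ::= _"] wp_Assign lookups) (simp_all add: t8)
      next
        assume "eval_expr t (Fst (Fst (Var 8))) = Num 0"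
        then have "U = PGate i" "j = length m" using U ij by (cases U; simp add: t8)+
        then show "wp ora M (9 ::= Snd (Fst (Var 8)) ;; 10 ::= Fst (Var 0))
            (wp ora M (lookup 9 11 ;; lookup 10 12 ;; ?push) (wp ora M (8 ::= Snd (Var 8)) ?R)) t"
          using small t s(3) by (intro wp_Seq[of ora M "9 ::= _"] wp_Assign lookups) (simp_all add: t8)
      qed
      then show "wp ora M (?load ;; lookup 9 11 ;; lookup 10 12 ;; ?push) (wp ora M (8 ::= Snd (Var 8)) ?R) t"
        by (rule wp_Seq)
    qed
  next
    fix t assume "?Inv Us t"
    then show "Q t" by (intro Q) auto
  qed (use s in auto)
  have "vsize (enc_list enc_gate Us) \<le> M" using boundedD[OF b, of 3] s(1) by simp
  with loop show ?thesis
    unfolding gate_loop_def by (intro wp_Assign_Seq) (simp_all add: s(1))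
qed

text \<open>\<open>expand\<close> recurses from the front, whereas the loop invariant extends its
  prefix at the end. The count of \<open>True\<close> is the number of outcome bits already
  consumed.\<close>

lemma expand_snoc: "expand (m @ [b]) y = expand m y @
    [b \<and> count_list m True < length y \<and> y ! count_list m True]"
proof (induction m y rule: expand.induct)
  case (1 y)
  then show ?case by (cases b; cases y) auto
qed auto

lemma wp_bit_loop:
  fixes s :: state and M :: nat and m y :: "bool list"
  assumes s: "s 4 = enc_list enc_bool m" "s 18 = enc_list enc_bool y" "s 6 = enc_list enc_field fs"
    and size: "vsize (enc_list enc_field (rev (circuit_fields m y) @ fs)) \<le> M"
    and Q: "\<And>t. (\<And>x. x \<notin> {6, 8, 17} \<Longrightarrow> t x = s x) \<Longrightarrow>
      t 6 = enc_list enc_field (rev (circuit_fields m y) @ fs) \<Longrightarrow> Q t"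
  shows "wp ora M bit_loop Q s"
proof (rule wp_bounded)
  assume b: "bounded M s"
  let ?f = "\<lambda>b. (of_bool b, False, 0) :: field"
  let ?F = "\<lambda>ys. rev (map ?f (expand ys y)) @ fs"
  let ?Inv = "\<lambda>ys t. (\<forall>x. x \<notin> {6, 8, 17} \<longrightarrow> t x = s x) \<and> t 6 = enc_list enc_field (?F ys) \<and>
    t 17 = enc_list enc_bool (drop (count_list ys True) y)"
  let ?push = "6 ::= MkPair (MkPair (Const 0) (MkPair (Const 0) (Const 0))) (Var 6)"
  let ?push_bit = "6 ::= MkPair (MkPair (Fst (Var 17)) (MkPair (Const 0) (Const 0))) (Var 6) ;; 17 ::= Snd (Var 17)"
  let ?body = "Cond (Fst (Var 8)) ?push_bit ?push ;; 8 ::= Snd (Var 8)"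
  have final: "rev (circuit_fields m y) @ fs = ?f False # ?F m" by (simp add: circuit_fields_def)
  have F: "vsize (enc_list enc_field (?F m)) \<le> M"
    using size vsize_enc_list_appendD[of enc_field "[?f False]" "?F m"] unfolding final by simp
  have sy: "vsize (enc_list enc_bool (drop c y)) \<le> M" for c
    using boundedD[OF b, of 18] vsize_enc_list_drop_le[of enc_bool c y] s(2) by simp
  have loop: "wp ora M (While (IsPair (Var 8)) ?body ;; ?push) Q
      (s(8 := enc_list enc_bool m, 17 := enc_list enc_bool y))"
  proof (rule wp_Seq, rule wp_list_loop[where xs = m and f = enc_bool and Inv = ?Inv])
    fix ys z zs t
    assume split: "m = ys @ z # zs" and t: "?Inv ys t" and bt: "bounded M t"
      and t8: "t 8 = Pair (enc_bool z) (enc_list enc_bool zs)"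
    let ?R = "\<lambda>t. ?Inv (ys @ [z]) t \<and> t 8 = enc_list enc_bool zs"
    have size8: "vsize (enc_list enc_bool zs) \<le> M" using boundedD[OF bt, of 8] by (simp add: t8)
    have next_bit: "wp ora M (8 ::= Snd (Var 8)) ?R u"
      if "u 8 = t 8" "?Inv (ys @ [z]) u" for u
      using that size8 by (intro wp_Assign) (simp_all add: t8)
    \<comment> \<open>The expansion of a prefix is a prefix of the expansion, so intermediate field
      lists are suffixes of the final reversed one.\<close>
    have "\<exists>X. expand m y = expand (ys @ [z]) y @ X"
      unfolding split
    proof (induction zs rule: rev_induct)
      case (snoc z' zs)
      then show ?case using expand_snoc[of "ys @ z # zs" z' y] by auto
    qed simp
    then obtain X where "expand m y = expand (ys @ [z]) y @ X" by blast
    then have size6: "vsize (enc_list enc_field (?F (ys @ [z]))) \<le> M"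
      using F vsize_enc_list_appendD[of enc_field "rev (map ?f X)" "?F (ys @ [z])" M] by simp
    show "wp ora M ?body ?R t"
    proof (rule wp_Seq, rule wp_Cond)
      assume "eval_expr t (Fst (Var 8)) \<noteq> Num 0"
      then have z: "z = True" by (simp add: t8 enc_bool_def)
      let ?u = "t(6 := enc_list enc_field (?F (ys @ [z])), 17 := enc_list enc_bool (drop (Suc (count_list ys True)) y))"
      have "eval_expr t (MkPair (MkPair (Fst (Var 17)) (MkPair (Const 0) (Const 0))) (Var 6)) =
          enc_list enc_field (?F (ys @ [z]))"
        using t z by (simp add: expand_snoc val_fst_enc_bool_drop enc_bool_def)
      moreover have "wp ora M (17 ::= Snd (Var 17)) (wp ora M (8 ::= Snd (Var 8)) ?R)
          (t(6 := enc_list enc_field (?F (ys @ [z]))))"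
        using t z sy[of "Suc (count_list ys True)"]
        by (intro next_bit wp_Assign) (simp_all add: val_snd_enc_list drop_Suc tl_drop)
      ultimately show "wp ora M ?push_bit (wp ora M (8 ::= Snd (Var 8)) ?R) t"
        using size6 by (intro wp_Assign_Seq) (simp_all del: eval_expr.simps)
    next
      assume "eval_expr t (Fst (Var 8)) = Num 0"
      then have z: "z = False" by (simp add: t8 enc_bool_def)
      have "eval_expr t (MkPair (MkPair (Const 0) (MkPair (Const 0) (Const 0))) (Var 6)) =
          enc_list enc_field (?F (ys @ [z]))"
        using t z by (simp add: expand_snoc enc_bool_def)
      then show "wp ora M ?push (wp ora M (8 ::= Snd (Var 8)) ?R) t"
        using size6 t z by (intro next_bit wp_Assign) (simp_all del: eval_expr.simps)
    qed
  next
    fix t assume t: "?Inv m t"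
    have "eval_expr t (MkPair (MkPair (Const 0) (MkPair (Const 0) (Const 0))) (Var 6)) =
        enc_list enc_field (rev (circuit_fields m y) @ fs)"
      using t unfolding final by (simp add: enc_bool_def)
    then show "wp ora M ?push Q t"
      using size t by (intro wp_Assign Q) (simp_all del: eval_expr.simps)
  qed (use s in auto)
  have "vsize (enc_list enc_bool m) \<le> M" using boundedD[OF b, of 4] s(1) by simp
  with loop sy[of 0] show ?thesis
    unfolding bit_loop_def by (intro wp_Assign_Seq) (simp_all add: s)
qed

lemma wp_power_loop:
  fixes s :: state and M :: nat
  assumes s: "s 4 = enc_list enc_bool m" "s 16 = Num 4" and M: "2 * length m + 4 \<le> M"
    and Q: "Q (s(8 := Num 0, 16 := Num (4 ^ Suc (length m))))"
  shows "wp ora M power_loop Q s"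
proof (rule wp_bounded)
  assume b: "bounded M s"
  let ?Inv = "\<lambda>ys t. t 16 = Num (4 ^ Suc (length ys)) \<and> (\<forall>x. x \<noteq> 8 \<longrightarrow> x \<noteq> 16 \<longrightarrow> t x = s x)"
  have "wp ora M (While (IsPair (Var 8)) (16 ::= Times (Const 4) (Var 16) ;; 8 ::= Snd (Var 8))) Q
      (s(8 := enc_list enc_bool m))"
  proof (rule wp_list_loop[where xs = m and f = enc_bool and Inv = ?Inv])
    fix ys z zs t
    assume split: "m = ys @ z # zs" and t: "?Inv ys t" and bt: "bounded M t"
      and t8: "t 8 = Pair (enc_bool z) (enc_list enc_bool zs)"
    have size8: "vsize (enc_list enc_bool zs) \<le> M" using boundedD[OF bt, of 8] by (simp add: t8)
    have "4 * (4 * 4 ^ length ys) < (2::nat) ^ (2 * length ys + 5)"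
      by (simp add: power_add power_mult)
    then have "vsize (Num (4 * (4 * 4 ^ length ys))) \<le> Suc (2 * length ys + 5)" by (rule vsize_Num_leI)
    then have "vsize (Num (4 * (4 * 4 ^ length ys))) \<le> M" using M unfolding split by simp
    then show "wp ora M (16 ::= Times (Const 4) (Var 16) ;; 8 ::= Snd (Var 8))
        (\<lambda>t. ?Inv (ys @ [z]) t \<and> t 8 = enc_list enc_bool zs) t"
      using size8 t by (intro wp_Seq wp_Assign) (simp_all add: t8 del: vsize.simps)
  next
    fix t assume "?Inv m t" "t 8 = Num 0"
    then have "t = s(8 := Num 0, 16 := Num (4 ^ Suc (length m)))" by auto
    then show "Q t" using Q by simp
  qed (use s in auto)
  moreover have "vsize (enc_list enc_bool m) \<le> M" using boundedD[OF b, of 4] s(1) by simp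
  ultimately show ?thesis
    unfolding power_loop_def by (intro wp_Assign_Seq) (simp_all add: s)
qed

section \<open>Size of the Ising query\<close>

lemma vsize_copies_mono:
  assumes "c \<le> k"
  shows "vsize (enc_list f (copies n es c)) \<le> vsize (enc_list f (copies n es k))"
  using assms
proof (induction rule: dec_induct)
  case (step j)
  then show ?case using vsize_enc_list_append_le[of f "copies n es j"] le_trans by fastforce
qed simp

lemma vsize_enc_list_rev: "vsize (enc_list f (rev xs)) = vsize (enc_list f xs)"
  by (simp only: vsize_enc_list) (simp add: sum_list_rev flip: rev_map)

lemma vsize_concat_replicate_mono:
  assumes "c \<le> k"
  shows "vsize (enc_list f (concat (replicate c xs))) \<le> vsize (enc_list f (concat (replicate k xs)))"
  using assms
proof (induction rule: dec_induct)
  case (step j)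
  then show ?case using vsize_enc_list_append_le[of f "concat (replicate j xs)" xs] by simp
qed simp

lemma length_copies: "length (copies n es k) = k * length es"
  by (induction k) simp_all

lemma vsize_enc_ising_le:
  assumes "ising_instance n es fs" "\<And>f. f \<in> set fs \<Longrightarrow> vsize (enc_field f) \<le> 6"
  shows "vsize (enc_ising n es fs) \<le> 2 + (n + 1) + (1 + length es * (1 + (2 * n + 4))) + (1 + n * (1 + 6))"
proof -
  have "vsize (enc_edge e) \<le> 2 * n + 4" if "e \<in> set es" for e
  proof -
    obtain u v b where e: "e = (u, v, b)" by (rule prod_cases3)
    then have "u < n" "v < n" using that assms(1) by (auto simp: ising_instance_def)
    moreover have "vsize (enc_bool b) \<le> 2" unfolding enc_bool_def by (rule vsize_of_bool)
    ultimately show ?thesis using floorlog_less_self[of u] floorlog_less_self[of v] by (simp add: e)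
  qed
  then have "vsize (enc_list enc_edge es) \<le> 1 + length es * (1 + (2 * n + 4))"
    by (rule vsize_enc_list_le)
  moreover have "vsize (enc_list enc_field fs) \<le> 1 + n * (1 + 6)"
    using vsize_enc_list_le[of fs enc_field 6] assms by (simp add: ising_instance_def)
  ultimately show ?thesis
    using floorlog_less_self[of n] by (simp add: enc_ising_def)
qed

text \<open>At most \<open>k * (2 * L + 2)\<close> vertices, two edges per gate and copy, and fields
  of size at most 6.\<close>

definition ising_query_bound :: "nat \<Rightarrow> nat \<Rightarrow> nat" where
  "ising_query_bound k L = 2 + (k * (2 * L + 2) + 1) +
     (1 + k * (2 * L) * (1 + (2 * (k * (2 * L + 2)) + 4))) + (1 + k * (2 * L + 2) * (1 + 6))"

definition iqp_program_bound :: "nat \<Rightarrow> nat \<Rightarrow> nat poly \<Rightarrow> nat \<Rightarrow> nat" where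
  "iqp_program_bound k r q L = ising_query_bound k L + 3 * L + 8 +
     3 * root_size r (poly q (ising_query_bound k L))"

lemma SSimIQP_solutionI:
  assumes "iqp_instance n Us I y" "represents_rat v p" "approximates \<kappa> (marginal_prob \<theta> n Us I y) p"
  shows "v \<in> solutions (SSimIQP \<kappa> \<theta>) (enc_iqp n Us I y)"
  unfolding SSimIQP_def search_problem.simps using assms by blast

lemma wp_iqp_program:
  assumes "0 < k" "0 < r" "(1 + 1 / real r) ^ k * \<kappa> \<le> \<kappa>' ^ k" "0 < \<kappa>" "0 < \<kappa>'"
    and inst: "iqp_instance n Us I y" and x: "x = enc_iqp n Us I y"
    and ora: "solves_within q ora (IQPIsing \<kappa> (2 * \<theta>))"
    and M: "iqp_program_bound k r q (vsize x) \<le> M"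
  shows "wp ora M (iqp_program k r) (\<lambda>s. s 0 \<in> solutions (SSimIQP \<kappa>' \<theta>) x) (init_state x)"
proof -
  define L where "L = vsize x"
  obtain Ds where Us: "Us = [HAll] @ Ds @ [HAll]" and Ds: "\<forall>U\<in>set Ds. diagonal_gate n U"
    using inst by (auto simp: iqp_instance_def iqp_circuit_def)
  define m where "m = map (\<lambda>i. i \<in> I) [0..<n]"
  have n: "length m = n" by (simp add: m_def)
  have I: "{i. i < length m \<and> m ! i} = I" using inst by (auto simp: m_def iqp_instance_def)
  have "count_list m True = length (filter (\<lambda>i. i \<in> I) [0..<n])"
    by (simp add: m_def count_list_eq_length_filter filter_map o_def)
  also have "\<dots> = card (set (filter (\<lambda>i. i \<in> I) [0..<n]))"
    by (rule distinct_card[symmetric]) simp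
  also have "set (filter (\<lambda>i. i \<in> I) [0..<n]) = I"
    using inst by (auto simp: iqp_instance_def)
  finally have y: "length y = count_list m True" using inst by (simp add: iqp_instance_def)
  define N where "N = Suc (length m) + Suc (length m)"
  define E where "E = concat (map (circuit_edges m) Ds)"
  define F where "F = circuit_fields m y"
  define es where "es = copies N E k"
  define fs where "fs = concat (replicate (2 * k) F)"
  define w where "w = enc_ising (k * N) es fs"
  define P where "P = marginal_prob \<theta> n Us I y"
  have Ds': "\<forall>U\<in>set Ds. diagonal_gate (length m) U" using Ds by (simp add: n)
  have wi: "ising_instance (k * N) es fs"
    using iqp_to_ising(1)[OF Ds' y, of k] unfolding es_def fs_def N_def E_def F_def .
  have value_w: "cmod (ising_value (2 * \<theta>) (k * N) es fs) = (4 ^ Suc n * P) ^ k"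
    using iqp_to_ising(2)[where \<theta> = \<theta> and k = k, OF Ds' y]
    unfolding I unfolding es_def fs_def N_def E_def F_def by (simp only: n P_def Us)
  have L: "n \<le> L" "length Ds \<le> L" "vsize (enc_list enc_gate Us) \<le> L" "vsize (enc_list enc_bool m) \<le> L"
      "vsize (enc_list enc_bool y) \<le> L"
  proof -
    have x': "x = Pair (Num n) (Pair (enc_list enc_gate Us) (Pair (enc_list enc_bool m) (enc_list enc_bool y)))"
      by (simp add: x enc_iqp_def m_def)
    then show "vsize (enc_list enc_gate Us) \<le> L" "vsize (enc_list enc_bool m) \<le> L"
        "vsize (enc_list enc_bool y) \<le> L"
      by (simp_all add: L_def)
    then show "n \<le> L" "length Ds \<le> L"
      using length_le_vsize_enc_list[of m enc_bool] length_le_vsize_enc_list[of Us enc_gate]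
      by (simp_all add: n Us)
  qed
  have N: "N \<le> 2 * L + 2" using L(1) by (simp add: N_def n)
  have w_size: "vsize w \<le> ising_query_bound k L"
  proof -
    have "vsize (enc_field f) \<le> 6" if "f \<in> set fs" for f
    proof -
      have "f \<in> set F" using that by (auto simp: fs_def)
      then obtain b where "f = (of_bool b, False, 0)"
        by (auto simp only: F_def circuit_fields_def set_map)
      then show ?thesis using vsize_of_bool[of b] by (simp add: enc_bool_def floorlog_def)
    qed
    then have "vsize w \<le> 2 + (k * N + 1) + (1 + length es * (1 + (2 * (k * N) + 4))) + (1 + k * N * (1 + 6))"
      unfolding w_def by (rule vsize_enc_ising_le[OF wi])
    also have "\<dots> \<le> ising_query_bound k L"
    proof -
      have "length E = 2 * length Ds"
        unfolding E_def by (induction Ds) (simp_all add: circuit_edges_def split: prod.splits)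
      then have "length es \<le> k * (2 * L)"
        using L(2) by (simp add: es_def length_copies)
      then show ?thesis
        unfolding ising_query_bound_def using N
        by (intro add_mono mult_le_mono order.refl)
    qed
    finally show ?thesis .
  qed
  let ?V = "poly q (ising_query_bound k L)"
  have MB: "ising_query_bound k L + 3 * L + 8 + 3 * root_size r ?V \<le> M"
    using M by (simp add: iqp_program_bound_def L_def)
  define X where "X = 4 ^ Suc n * P"
  obtain a b where ab: "0 < b" "ora w = Pair (enc_int a) (Num b)" "X ^ k / \<kappa> \<le> real_of_int a / b"
      "real_of_int a / b \<le> \<kappa> * X ^ k" and "vsize (ora w) \<le> poly q (vsize w)"
    using IQPIsing_oracle[OF ora wi] unfolding w_def X_def value_w by blast
  then have ora_size: "vsize (ora w) \<le> ?V"
    using poly_nat_mono[OF w_size, of q] by linarith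
  have X0: "0 \<le> X" unfolding X_def P_def by (simp add: marginal_prob_nonneg)
  have "0 \<le> real_of_int a / b"
    by (rule order.trans[OF _ ab(3)]) (use X0 assms(4) in simp)
  then have a: "0 \<le> a" using ab(1) by (simp add: zero_le_divide_iff)
  have wM: "vsize w \<le> M" using w_size MB by linarith
  then have sizes: "vsize (Num (k * N)) \<le> M" "vsize (enc_list enc_edge es) \<le> M" "vsize (enc_list enc_field fs) \<le> M"
    by (simp_all add: w_def enc_ising_def)
  have nM: "2 * length m + 4 \<le> M" using MB L(1) by (simp add: n)
  let ?Q = "\<lambda>s. s 0 \<in> solutions (SSimIQP \<kappa>' \<theta>) x"
  let ?out = "0 ::= MkPair (MkPair (Const 0) (Var 1)) (Times (Var 2) (Var 16))"
  let ?query = "Query 0 (MkPair (Var 7) (MkPair (Var 5) (Var 17)))"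
  have finish: "wp ora M (root_program k r ;; ?out) ?Q s"
    if s: "s 0 = ora w" "s 16 = Num (4 ^ Suc n)" for s
  proof (rule wp_Seq, rule wp_root_program[of s a b])
    have le: "root_size r (vsize (s 0)) \<le> root_size r ?V"
      unfolding s by (rule root_size_mono[OF ora_size])
    then show "root_size r (vsize (s 0)) \<le> M" using MB by linarith
    fix u v :: nat
    assume uv: "0 < v" "vsize (Num u) \<le> root_size r (vsize (s 0))"
      "vsize (Num v) \<le> root_size r (vsize (s 0))"
      "real_of_int a / b \<le> (real u / real v) ^ k"
      "(real u / real v) ^ k \<le> (1 + 1 / real r) ^ k * (real_of_int a / b)"
    let ?s = "s(1 := Num u, 2 := Num v)"
    have "(4::nat) ^ Suc n = 2 ^ (2 * Suc n)" by (simp only: power_mult) simp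
    then have "vsize (Num (4 ^ Suc n)) \<le> Suc (Suc (2 * Suc n))"
      by (intro vsize_Num_leI) simp
    then have "vsize (Num (v * 4 ^ Suc n)) \<le> vsize (Num v) + (2 * n + 4)"
      using floorlog_mult[of v "4 ^ Suc n"] by simp
    then have size: "vsize (Pair (Pair (Num 0) (Num u)) (Num (v * 4 ^ Suc n))) \<le> M"
      using uv(2,3) le MB L(1) by (simp add: floorlog_def)
    have "X / \<kappa>' \<le> real u / real v" "real u / real v \<le> \<kappa>' * X"
      by (rule approximate_root[OF ab(3,4) uv(4,5)]; use X0 assms(1-5) in simp)+
    \<comment> \<open>Dividing by the known factor \<open>4 ^ Suc n\<close> leaves the relative
      error unchanged.\<close>
    then have "X / \<kappa>' / 4 ^ Suc n \<le> real u / real v / 4 ^ Suc n"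
        "real u / real v / 4 ^ Suc n \<le> \<kappa>' * X / 4 ^ Suc n"
      by (simp_all only: divide_right_mono zero_le_power zero_le_numeral)
    then have "approximates \<kappa>' P (of_nat u / of_nat (v * 4 ^ Suc n))"
      by (simp add: approximates_def X_def of_rat_divide of_rat_mult of_rat_power mult_ac)
    moreover have "represents_rat (Pair (Pair (Num 0) (Num u)) (Num (v * 4 ^ Suc n)))
        (of_nat u / of_nat (v * 4 ^ Suc n))"
      by (rule represents_rat_of_nat) (simp add: uv(1))
    ultimately have "Pair (Pair (Num 0) (Num u)) (Num (v * 4 ^ Suc n)) \<in> solutions (SSimIQP \<kappa>' \<theta>) x"
      unfolding x P_def by (intro SSimIQP_solutionI[OF inst])
    then show "wp ora M ?out ?Q ?s"
      using size s(2) by (intro wp_Assign) (simp_all del: vsize.simps power_Suc)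
  qed (use s ab a assms(1,2) in auto)
  have query: "wp ora M (power_loop ;; reverse 6 17 ;; ?query ;; root_program k r ;; ?out) ?Q s"
    if s: "s 4 = enc_list enc_bool m" "s 16 = Num 4" "s 5 = enc_list enc_edge es"
      "s 6 = enc_list enc_field (rev fs)" "s 7 = Num (k * N)" for s
  proof (rule wp_Seq, rule wp_power_loop[OF s(1,2) nM], rule wp_Seq,
      rule wp_reverse[where f = enc_field and xs = "rev fs"], goal_cases)
    case 3
    let ?s = "s(8 := Num 0, 16 := Num (4 ^ Suc (length m)), 6 := Num 0,
      17 := enc_list enc_field (rev (rev fs)))"
    have q: "eval_expr ?s (MkPair (Var 7) (MkPair (Var 5) (Var 17))) = w"
      by (simp add: s w_def enc_ising_def)
    show ?case
    proof (rule wp_Seq, rule wp_Query)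
      show "vsize (ora (eval_expr ?s (MkPair (Var 7) (MkPair (Var 5) (Var 17))))) \<le> M"
        unfolding q using ora_size le_root_size[of ?V r] MB by linarith
    qed (rule finish, unfold q, simp_all add: n)
  qed (simp_all add: s)
  have fields: "wp ora M (repeat_com (2 * k) bit_loop ;; power_loop ;; reverse 6 17 ;; ?query ;; root_program k r ;; ?out) ?Q s"
    if s: "s 4 = enc_list enc_bool m" "s 16 = Num 4" "s 5 = enc_list enc_edge es"
      "s 6 = Num 0" "s 7 = Num (k * N)" "s 18 = enc_list enc_bool y" for s
  proof (rule wp_Seq, rule wp_repeat_com[where Inv = "\<lambda>j t. (\<forall>x. x \<notin> {6, 8, 17} \<longrightarrow> t x = s x) \<and>
      t 6 = enc_list enc_field (rev (concat (replicate j F)))"])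
    fix j t
    assume j: "j < 2 * k" and t: "(\<forall>x. x \<notin> {6, 8, 17} \<longrightarrow> t x = s x) \<and>
      t 6 = enc_list enc_field (rev (concat (replicate j F)))"
    \<comment> \<open>All blocks of fields are equal, so prepending a reversed block amounts to
      appending a block before reversal.\<close>
    have rev: "rev F @ rev (concat (replicate j F)) = rev (concat (replicate (Suc j) F))"
      unfolding concat_replicate_Suc by simp
    show "wp ora M bit_loop (\<lambda>t. (\<forall>x. x \<notin> {6, 8, 17} \<longrightarrow> t x = s x) \<and>
      t 6 = enc_list enc_field (rev (concat (replicate (Suc j) F)))) t"
    proof (rule wp_bit_loop[of t m y "rev (concat (replicate j F))", folded F_def])
      show "vsize (enc_list enc_field (rev F @ rev (concat (replicate j F)))) \<le> M"
        unfolding rev vsize_enc_list_rev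
        using vsize_concat_replicate_mono[of "Suc j" "2 * k" enc_field F] j sizes(3)
        unfolding fs_def by linarith
    qed (use t s in \<open>auto simp: rev simp del: replicate.simps\<close>)
  next
    fix t assume t: "(\<forall>x. x \<notin> {6, 8, 17} \<longrightarrow> t x = s x) \<and>
      t 6 = enc_list enc_field (rev (concat (replicate (2 * k) F)))"
    show "wp ora M (power_loop ;; reverse 6 17 ;; ?query ;; root_program k r ;; ?out) ?Q t"
      by (rule query) (use t s in \<open>simp_all add: fs_def\<close>)
  qed (use s in simp)
  have gate_edges: "concat (map (gate_edges m) Us) = E"
  proof -
    have map: "map (gate_edges m) Ds = map (circuit_edges m) Ds"
      using Ds by (intro map_cong) (auto simp: gate_edges_def)
    show ?thesis unfolding Us E_def map[symmetric] by (simp add: gate_edges_def[of m HAll])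
  qed
  have val_fst_x: "val_fst x = Num n" and parts: "val_fst (val_snd x) = enc_list enc_gate Us"
    "val_fst (val_snd (val_snd x)) = enc_list enc_bool m" "val_snd (val_snd (val_snd x)) = enc_list enc_bool y"
    by (simp_all add: x enc_iqp_def m_def)
  have edges: "wp ora M (repeat_com k (gate_loop ;; 7 ::= Plus (Var 7) (Times (Const 2) (Var 15))) ;;
      repeat_com (2 * k) bit_loop ;; power_loop ;; reverse 6 17 ;; ?query ;; root_program k r ;; ?out) ?Q s"
    if s: "s 0 = x" "s 3 = enc_list enc_gate Us" "s 4 = enc_list enc_bool m" "s 5 = Num 0" "s 6 = Num 0" "s 7 = Num 0"
      "s 15 = Num (Suc n)" "s 16 = Num 4" "s 18 = enc_list enc_bool y" for s
  proof (rule wp_Seq, rule wp_repeat_com[where Inv = "\<lambda>j t.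
      (\<forall>x. x \<notin> {5, 7, 8, 9, 10, 11, 12, 13, 14} \<longrightarrow> t x = s x) \<and>
      t 5 = enc_list enc_edge (copies N E j) \<and> t 7 = Num (j * N)"])
    fix j t
    assume j: "j < k" and t: "(\<forall>x. x \<notin> {5, 7, 8, 9, 10, 11, 12, 13, 14} \<longrightarrow> t x = s x) \<and>
      t 5 = enc_list enc_edge (copies N E j) \<and> t 7 = Num (j * N)"
    show "wp ora M (gate_loop ;; 7 ::= Plus (Var 7) (Times (Const 2) (Var 15)))
      (\<lambda>t. (\<forall>x. x \<notin> {5, 7, 8, 9, 10, 11, 12, 13, 14} \<longrightarrow> t x = s x) \<and>
      t 5 = enc_list enc_edge (copies N E (Suc j)) \<and> t 7 = Num (Suc j * N)) t"
    proof (rule wp_Seq, rule wp_gate_loop[where Us = Us and m = m and n = "j * N" and es = "copies N E j",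
          unfolded gate_edges])
      show "U = HAll \<or> diagonal_gate (length m) U" if "U \<in> set Us" for U
        using that Ds by (auto simp: Us n)
      show "vsize (enc_list enc_edge (rev (map (shift (j * N)) E) @ copies N E j)) \<le> M"
        using vsize_copies_mono[of "Suc j" k enc_edge N E] j sizes(2) by (simp add: es_def)
      fix u assume u: "\<And>x. x \<notin> {5, 8, 9, 10, 11, 12, 13, 14} \<Longrightarrow> u x = t x"
        "u 5 = enc_list enc_edge (rev (map (shift (j * N)) E) @ copies N E j)"
      have "vsize (Num (Suc j * N)) \<le> vsize (Num (k * N))"
        using j by (intro vsize_Num_mono mult_le_mono1) simp
      then have "vsize (Num (Suc j * N)) \<le> M" using sizes(1) by linarith
      moreover have "eval_expr u (Plus (Var 7) (Times (Const 2) (Var 15))) = Num (Suc j * N)"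
        using u(1)[of 7] u(1)[of 15] t s by (simp add: N_def n)
      ultimately show "wp ora M (7 ::= Plus (Var 7) (Times (Const 2) (Var 15)))
        (\<lambda>t. (\<forall>x. x \<notin> {5, 7, 8, 9, 10, 11, 12, 13, 14} \<longrightarrow> t x = s x) \<and>
        t 5 = enc_list enc_edge (copies N E (Suc j)) \<and> t 7 = Num (Suc j * N)) u"
        using u t by (intro wp_Assign) (simp_all del: eval_expr.simps)
    qed (use t s nM in \<open>simp_all add: n val_fst_x\<close>)
  next
    fix t assume t: "(\<forall>x. x \<notin> {5, 7, 8, 9, 10, 11, 12, 13, 14} \<longrightarrow> t x = s x) \<and>
      t 5 = enc_list enc_edge (copies N E k) \<and> t 7 = Num (k * N)"
    show "wp ora M (repeat_com (2 * k) bit_loop ;; power_loop ;; reverse 6 17 ;; ?query ;; root_program k r ;; ?out) ?Q t"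
      by (rule fields) (use t s in \<open>simp_all add: es_def\<close>)
  qed (use s in simp)
  have init: "init_state x 0 = x" "\<And>i. i \<noteq> 0 \<Longrightarrow> init_state x i = Num 0"
    by (simp_all add: init_state_def)
  have small: "vsize (enc_list enc_gate Us) \<le> M" "vsize (enc_list enc_bool m) \<le> M"
    "vsize (enc_list enc_bool y) \<le> M" "vsize (Num (Suc n)) \<le> M" "vsize (Num 4) \<le> M"
    using L MB vsize_Num_le[of "Suc n"] vsize_Num_le[of 4] by linarith+
  have start: "wp ora M (repeat_com k (gate_loop ;; 7 ::= Plus (Var 7) (Times (Const 2) (Var 15))) ;;
      repeat_com (2 * k) bit_loop ;; power_loop ;; reverse 6 17 ;; ?query ;; root_program k r ;; ?out) ?Q
      ((init_state x)(3 := enc_list enc_gate Us, 4 := enc_list enc_bool m, 18 := enc_list enc_bool y,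
        15 := Num (Suc n), 16 := Num 4))"
    by (rule edges) (simp_all add: init)
  show ?thesis
    unfolding iqp_program_def
    by (intro wp_Assign_Seq)
      (use start small in \<open>simp_all add: init parts val_fst_x del: vsize.simps\<close>)
qed

section \<open>The two reductions\<close>

lemma IQPIsing_reducible_SSimIQP:
  assumes "cis \<theta> ^ k = 1" "0 < k" "1 < \<kappa>"
  shows "poly_turing_reducible (IQPIsing \<kappa> (2 * \<theta>)) (SSimIQP (\<kappa> powr (1 / 2)) \<theta>)"
proof -
  obtain r :: nat where r: "0 < r" "(1 + 1 / real r) ^ 2 \<le> \<kappa>"
    using exists_step_close_to_one[OF assms(3), of 2] .
  \<comment> \<open>The square root leaves an oracle error of only
    \<open>\<kappa> powr (1 / 4)\<close>, so this crude estimate still leaves a factor \<kappa> for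
    the square of the search ratio.\<close>
  have "\<kappa> powr (1 / 2) \<le> \<kappa>" using powr_mono[of "1 / 2" 1 \<kappa>] assms(3) by simp
  then have "(1 + 1 / real r) ^ 2 * \<kappa> powr (1 / 2) \<le> \<kappa> * \<kappa>"
    using r(2) assms(3) by (intro mult_mono) auto
  then have step: "(1 + 1 / real r) ^ 2 * \<kappa> powr (1 / 2) \<le> \<kappa>\<^sup>2" by (simp only: power2_eq_square)
  show ?thesis
  proof (rule poly_turing_reducibleI[of _ _ "ising_program k r"])
    fix q
    have "polynomial (\<lambda>L. ising_program_bound k r q L)"
      unfolding ising_program_bound_def iqp_query_bound_def root_size_def
      by (intro polynomial_intros)
    then obtain B where B: "\<And>L. poly B L = ising_program_bound k r q L"
      unfolding polynomial_def by blast
    have "wp ora (poly B (vsize x)) (ising_program k r)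
        (\<lambda>s. s 0 \<in> solutions (IQPIsing \<kappa> (2 * \<theta>)) x) (init_state x)"
      if ora: "solves_within q ora (SSimIQP (\<kappa> powr (1 / 2)) \<theta>)" and x: "x \<in> instances (IQPIsing \<kappa> (2 * \<theta>))" for ora x
    proof -
      obtain n es fs where "ising_instance n es fs" "x = enc_ising n es fs"
        using x by (auto simp: IQPIsing_def)
      then show ?thesis
        using wp_ising_program[OF assms(2,1) r(1) step assms(3) _ _ ora, where M = "poly B (vsize x)"]
        unfolding B by blast
    qed
    moreover have "L \<le> poly B L" for L by (simp add: B ising_program_bound_def)
    ultimately show "\<exists>B. \<forall>ora. solves_within q ora (SSimIQP (\<kappa> powr (1 / 2)) \<theta>) \<longrightarrow>
        (\<forall>x\<in>instances (IQPIsing \<kappa> (2 * \<theta>)). vsize x \<le> poly B (vsize x) \<and>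
          wp ora (poly B (vsize x)) (ising_program k r)
            (\<lambda>s. s 0 \<in> solutions (IQPIsing \<kappa> (2 * \<theta>)) x) (init_state x))"
      by blast
  qed
qed

lemma SSimIQP_reducible_IQPIsing:
  assumes "1 < \<kappa>"
  shows "poly_turing_reducible (SSimIQP (\<kappa> powr (1 / 2)) \<theta>) (IQPIsing \<kappa> (2 * \<theta>))"
proof -
  obtain r :: nat where r: "0 < r" "(1 + 1 / real r) ^ 4 \<le> \<kappa>"
    using exists_step_close_to_one[OF assms, of 4] .
  \<comment> \<open>With four copies the admissible error of the fourth power is
    \<open>\<kappa> * \<kappa>\<close>: one factor for the oracle, the other for the search.\<close>
  have "(\<kappa> powr (1 / 2)) ^ 4 = \<kappa> * \<kappa>"
    using assms by (simp add: powr_power flip: power2_eq_square)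
  moreover have "(1 + 1 / real r) ^ 4 * \<kappa> \<le> \<kappa> * \<kappa>"
    using r(2) assms by (intro mult_right_mono) auto
  ultimately have step: "(1 + 1 / real r) ^ 4 * \<kappa> \<le> (\<kappa> powr (1 / 2)) ^ 4" by simp
  show ?thesis
  proof (rule poly_turing_reducibleI[of _ _ "iqp_program 4 r"])
    fix q
    have "polynomial (\<lambda>L. iqp_program_bound 4 r q L)"
      unfolding iqp_program_bound_def ising_query_bound_def root_size_def
      by (intro polynomial_intros)
    then obtain B where B: "\<And>L. poly B L = iqp_program_bound 4 r q L"
      unfolding polynomial_def by blast
    have "wp ora (poly B (vsize x)) (iqp_program 4 r)
        (\<lambda>s. s 0 \<in> solutions (SSimIQP (\<kappa> powr (1 / 2)) \<theta>) x) (init_state x)"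
      if ora: "solves_within q ora (IQPIsing \<kappa> (2 * \<theta>))" and x: "x \<in> instances (SSimIQP (\<kappa> powr (1 / 2)) \<theta>)" for ora x
    proof -
      obtain n Us I y where "iqp_instance n Us I y" "x = enc_iqp n Us I y"
        using x by (auto simp: SSimIQP_def)
      then show ?thesis
        using wp_iqp_program[OF _ r(1) step _ _ _ _ ora, where M = "poly B (vsize x)"] assms
        unfolding B by simp
    qed
    moreover have "L \<le> poly B L" for L by (simp add: B iqp_program_bound_def)
    ultimately show "\<exists>B. \<forall>ora. solves_within q ora (IQPIsing \<kappa> (2 * \<theta>)) \<longrightarrow>
        (\<forall>x\<in>instances (SSimIQP (\<kappa> powr (1 / 2)) \<theta>). vsize x \<le> poly B (vsize x) \<and>
          wp ora (poly B (vsize x)) (iqp_program 4 r)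
            (\<lambda>s. s 0 \<in> solutions (SSimIQP (\<kappa> powr (1 / 2)) \<theta>) x) (init_state x))"
      by blast
  qed
qed

theorem theorem34:
  fixes \<theta> \<kappa> :: real
  assumes "\<exists>k>0. cis \<theta> ^ k = 1"
    and "\<kappa> > 1"
  shows "poly_turing_equivalent (IQPIsing \<kappa> (2 * \<theta>)) (SSimIQP (\<kappa> powr (1 / 2)) \<theta>)"
  unfolding poly_turing_equivalent_def
  using assms IQPIsing_reducible_SSimIQP SSimIQP_reducible_IQPIsing by blast

end
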